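(* Let $N$ be a free abelian group of rank $3$ and let $\Delta \subseteq N_{\mathbb{R}} = N\otimes\mathbb{R}$ be an arbitrary $3$-dimensional almost reflexive polytope. Then $$24 = v(\Delta) - \sum_{\theta \preceq \Delta,\ \dim(\theta)=2} \frac{1}{n_\theta}\cdot v(\theta) + \sum_{\theta \preceq \Delta,\ \dim(\theta)=1} v(\theta)\cdot v(\theta^* ),$$ where the sums run over the $2$-dimensional and the $1$-dimensional faces $\theta$ of $\Delta$, respectively.
   Context: Let $N$ be a free abelian group of rank $d$ (here $d=3$), $M = \mathrm{Hom}(N,\mathbb{Z})$ its dual lattice, $N_{\mathbb{R}} = N\otimes\mathbb{R}$, $M_{\mathbb{R}} = M\otimes\mathbb{R}$, with natural pairing $\langle\cdot,\cdot\rangle : M_{\mathbb{R}}\times N_{\mathbb{R}}\to\mathbb{R}$. A lattice polytope is a $d$-dimensional convex polytope all of whose vertices lie in the lattice. $\theta\preceq\Delta$ means that $\theta$ is a face of $\Delta$. Dual polytope: for a $d$-dimensional convex polytope $\Delta\subseteq N_{\mathbb{R}}$ containing $0$ in its interior, $\Delta^* = \{y\in M_{\mathbb{R}} : \langle y,x\rangle\ge -1\ \forall x\in\Delta\}$. For a face $\theta\preceq\Delta$ of dimension $k$, the dual face is $\theta^* = \{y\in\Delta^* : \langle y,x\rangle = -1\ \forall x\in\theta\}$, a face of $\Delta^*$ of dimension $d-k-1$. (If $\Delta$ is a lattice polytope then $\Delta^*$ is a rational polytope, in general not a lattice polytope.) Reflexive: a $d$-dimensional lattice polytope with $0$ in its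 interior is reflexive if its dual polytope is also a lattice polytope (with respect to the dual lattice). Almost reflexive: a $d$-dimensional lattice polytope $\Delta\subseteq N_{\mathbb{R}}$ containing $0$ in its interior is called almost reflexive if the convex hull $[\Delta^*] = \mathrm{conv}(\Delta^*\cap M)$ of all lattice points of $\Delta^*$ contains $0$ in its interior and is a reflexive polytope. Lattice distance: for a facet ($(d-1)$-dimensional face) $\theta$ of $\Delta$, $n_\theta$ is the positive integer such that $\theta$ is defined by the equation $-\langle m,x\rangle = n_\theta$ for a primitive lattice point $m\in M$. Normalized volume: for a $k$-dimensional lattice polytope $\theta$ (for example $\Delta$ itself or a face of it), $v(\theta) = k!\cdot\mathrm{vol}_k(\theta)$, where $\mathrm{vol}_k$ is the $k$-dimensional volume relative to the ambient lattice, i.e. normalized so that a fundamental parallelepiped of the rank-$k$ lattice of all lattice vectors parallel to the affine hull of $\theta$ has volume $1$. For a $k$-dimensional face $\theta$ of a rational polytope $P$, choose a positive integer $l$ such that $lP$ is a lattice polytope and put $v(\theta) = l^{-k}\, v(l\theta)$. Faces of $\Delta$ are measured with respect to $N$ and faces of $\Delta^*$ with respect to $M$. *)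

theory Defs
  imports "HOL-Analysis.Analysis"
begin

text \<open>
  A free abelian group N of finite rank is realized as a full-rank lattice in the Euclidean
  space \<^typ>\<open>'a::euclidean_space\<close>, which plays the role of \<open>N \<otimes> \<real>\<close>; the lattice need not be the
  standard one.  The dual space \<open>M \<otimes> \<real>\<close> is identified with the same type through the inner
  product, which serves as the pairing between the two spaces.
\<close>

definition int_span :: "'a::euclidean_space set \<Rightarrow> 'a set" where
  "int_span B = {\<Sum>v\<in>B. of_int (c v) *\<^sub>R v | c :: 'a \<Rightarrow> int. True}"

definition lattice_basis :: "'a::euclidean_space set \<Rightarrow> 'a set \<Rightarrow> bool" where
  "lattice_basis L B \<longleftrightarrow> independent B \<and> L = int_span B"

definition full_lattice :: "'a::euclidean_space set \<Rightarrow> bool" where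
  "full_lattice L \<longleftrightarrow> (\<exists>B. lattice_basis L B \<and> span B = UNIV)"

definition dual_lattice :: "'a::euclidean_space set \<Rightarrow> 'a set" where
  "dual_lattice L = {m. \<forall>x\<in>L. m \<bullet> x \<in> \<int>}"

definition lattice_polytope :: "'a::euclidean_space set \<Rightarrow> 'a set \<Rightarrow> bool" where
  "lattice_polytope L P \<longleftrightarrow>
     polytope P \<and> aff_dim P = int DIM('a) \<and> {x. x extreme_point_of P} \<subseteq> L"

definition dual_polytope :: "'a::euclidean_space set \<Rightarrow> 'a set" where
  "dual_polytope P = {y. \<forall>x\<in>P. y \<bullet> x \<ge> -1}"

definition dual_face :: "'a::euclidean_space set \<Rightarrow> 'a set \<Rightarrow> 'a set" where
  "dual_face P \<theta> = {y \<in> dual_polytope P. \<forall>x\<in>\<theta>. y \<bullet> x = -1}"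

definition reflexive_polytope :: "'a::euclidean_space set \<Rightarrow> 'a set \<Rightarrow> bool" where
  "reflexive_polytope L P \<longleftrightarrow>
     lattice_polytope L P \<and> 0 \<in> interior P \<and>
     lattice_polytope (dual_lattice L) (dual_polytope P)"

definition lattice_hull :: "'a::euclidean_space set \<Rightarrow> 'a set \<Rightarrow> 'a set" where
  "lattice_hull L P = convex hull (P \<inter> L)"

definition almost_reflexive :: "'a::euclidean_space set \<Rightarrow> 'a set \<Rightarrow> bool" where
  "almost_reflexive L P \<longleftrightarrow>
     lattice_polytope L P \<and> 0 \<in> interior P \<and>
     0 \<in> interior (lattice_hull (dual_lattice L) (dual_polytope P)) \<and>
     reflexive_polytope (dual_lattice L) (lattice_hull (dual_lattice L) (dual_polytope P))"

definition primitive_in :: "'a::euclidean_space set \<Rightarrow> 'a \<Rightarrow> bool" where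
  "primitive_in L m \<longleftrightarrow>
     m \<in> L \<and> m \<noteq> 0 \<and> (\<forall>k::nat. \<forall>m'\<in>L. m = real k *\<^sub>R m' \<longrightarrow> k = 1)"

text \<open>Only meaningful when \<open>\<theta>\<close> is a facet of \<open>P\<close> and \<open>0\<close> is an interior point of \<open>P\<close>.\<close>

definition lattice_distance :: "'a::euclidean_space set \<Rightarrow> 'a set \<Rightarrow> 'a set \<Rightarrow> nat" where
  "lattice_distance L P \<theta> =
     (THE n. n > 0 \<and>
        (\<exists>m. primitive_in (dual_lattice L) m \<and> \<theta> = P \<inter> {x. - (m \<bullet> x) = real n}))"

definition parallel_lattice :: "'a::euclidean_space set \<Rightarrow> 'a set \<Rightarrow> 'a set" where
  "parallel_lattice L \<theta> = L \<inter> span {x - y | x y. x \<in> \<theta> \<and> y \<in> \<theta>}"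

text \<open>
  The volume of \<open>\<theta>\<close> is computed in the affine coordinates given by a basis \<open>B\<close> of the lattice
  parallel to \<open>\<theta>\<close> and a base point of \<open>\<theta>\<close>: these coordinates send the fundamental parallelepiped
  of \<open>B\<close> to the unit cube, so it has volume 1.  The value depends neither on \<open>B\<close> (a change
  of basis is unimodular) nor on the base point (Lebesgue measure is translation invariant).
\<close>

definition lattice_vol :: "'a::euclidean_space set \<Rightarrow> 'a set \<Rightarrow> real" where
  "lattice_vol L \<theta> =
     (let B = (SOME B. lattice_basis (parallel_lattice L \<theta>) B);
          p = (SOME p. p \<in> \<theta>)
      in measure (Pi\<^sub>M B (\<lambda>_. lborel))
           {c \<in> B \<rightarrow>\<^sub>E UNIV. p + (\<Sum>v\<in>B. c v *\<^sub>R v) \<in> \<theta>})"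

definition normalized_vol :: "'a::euclidean_space set \<Rightarrow> 'a set \<Rightarrow> real" where
  "normalized_vol L \<theta> = fact (nat (aff_dim \<theta>)) * lattice_vol L \<theta>"

text \<open>For a face \<open>\<theta>\<close> of a rational polytope \<open>P\<close>; the value does not depend on the choice of \<open>l\<close>.\<close>

definition rational_normalized_vol ::
    "'a::euclidean_space set \<Rightarrow> 'a set \<Rightarrow> 'a set \<Rightarrow> real" where
  "rational_normalized_vol L P \<theta> =
     (let l = (SOME l::nat. l > 0 \<and> lattice_polytope L ((*\<^sub>R) (real l) ` P))
      in normalized_vol L ((*\<^sub>R) (real l) ` \<theta>) / real l ^ nat (aff_dim \<theta>))"

end

(*
  Triangulate the boundary of the polytope by all its nonzero lattice points, by lifting them with
  generic weights.  Since the lattice points of the dual polytope surround the origin, no nonzero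
  lattice point lies strictly inside the polytope, so every tetrahedron spanned by the origin and a
  triangle has no lattice points besides its vertices.  For generic x and t > 0, attach to each cone
  over a triangle the sum of exp (- t (m . x)) over dual lattice points m, with a sign depending on
  the position of m relative to the cone.  For m \<noteq> 0 the signs of all cones add up to 0, by a winding
  number argument in the plane modulo x, and to 3 for m = 0; so these sums add up to 3 for every t.
  By the terminal lemma for empty tetrahedra, the constant coefficient of the expansion of each sum
  at t = 0 is explicit.  The part of it that depends on x regroups along edges, where it
  becomes the bend of the piecewise linear function that is 1 on the boundary, and this bend is
  the lattice length of the dual edge.  The remaining parts are the volumes of the polytope and
  of its two-dimensional faces.
*)
theory Submission
  imports Defs "HOL-Real_Asymp.Real_Asymp" "HOL-Computational_Algebra.Polynomial" "HOL-Number_Theory.Cong"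
begin

section \<open>Expansions at the origin\<close>

text \<open>The constants have a geometric source: the identity is Riemann-Roch for the structure
  sheaf of the toric threefold whose fan lies over the triangulation, evaluated by localization; its
  Euler characteristic is 1. The Todd class contributes c_1 c_2 / 24, which at a cone of determinant
  n is \<open>(x + y + z) * (1 / x + 1 / y + 1 / z) / n\<close> over 24, and a terminal cyclic
  quotient point of index n adds (n - 1 / n) / 24. Triangles are stored as oriented triples, each in
  three rotations, which turns 1 into 3 and 24 into 72. The signs in the exponential sums are forced
  by convergence: where a coordinate of the generic vector is negative, the geometric series has to
  be expanded in the opposite direction. The obstacle is that the coefficient of a single cone
  involves Dedekind sums. Instead of classifying empty tetrahedra, the proof extracts from emptiness
  one linear relation between sawtooth values; squaring and summing it yields exactly the
  combination of Dedekind sums that occurs.\<close>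

definition cubic_approx :: "(real \<Rightarrow> real) \<Rightarrow> real poly \<Rightarrow> bool" where
  "cubic_approx f P \<longleftrightarrow> ((\<lambda>t. (f t - poly P t) / t ^ 3) \<longlongrightarrow> 0) (at 0)"

lemma cubic_approx_cong:
  assumes "cubic_approx f P" "\<And>t. t \<noteq> 0 \<Longrightarrow> f t = g t"
  shows "cubic_approx g P"
  using assms(1) unfolding cubic_approx_def
  by (rule Lim_transform_eventually) (auto simp: eventually_at_filter assms(2))

lemma cubic_approx_add:
  assumes "cubic_approx f P" "cubic_approx g Q"
  shows "cubic_approx (\<lambda>t. f t + g t) (P + Q)"
  using tendsto_add[OF assms[unfolded cubic_approx_def]]
  unfolding cubic_approx_def by (simp add: add_divide_distrib diff_divide_distrib algebra_simps)

lemma cubic_approx_zero: "cubic_approx (\<lambda>_. 0) 0"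
  by (simp add: cubic_approx_def)

lemma cubic_approx_sum:
  assumes "finite I" "\<And>i. i \<in> I \<Longrightarrow> cubic_approx (f i) (P i)"
  shows "cubic_approx (\<lambda>t. \<Sum>i\<in>I. f i t) (\<Sum>i\<in>I. P i)"
  using assms by (induction I rule: finite_induct) (auto intro: cubic_approx_zero cubic_approx_add)

lemma cubic_approx_smult:
  assumes "cubic_approx f P"
  shows "cubic_approx (\<lambda>t. c * f t) (smult c P)"
  using tendsto_mult_left[OF assms[unfolded cubic_approx_def], of c]
  unfolding cubic_approx_def by (simp add: algebra_simps)

lemma cubic_approx_tendsto:
  assumes "cubic_approx f P"
  shows "(f \<longlongrightarrow> poly P 0) (at 0)"
proof -
  have "((\<lambda>t. t ^ 3 * ((f t - poly P t) / t ^ 3) + poly P t) \<longlongrightarrow> 0 ^ 3 * 0 + poly P 0) (at 0)"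
    using assms unfolding cubic_approx_def by (intro tendsto_intros) auto
  then have "(f \<longlongrightarrow> 0 ^ 3 * 0 + poly P 0) (at 0)"
    by (rule Lim_transform_eventually) (auto simp: eventually_at_filter)
  then show ?thesis by simp
qed

text \<open>The error splits as (f - P) g + P (g - Q). The approximating polynomials may have any
  degree, so products need no truncation.\<close>

lemma cubic_approx_mult:
  assumes "cubic_approx f P" "cubic_approx g Q"
  shows "cubic_approx (\<lambda>t. f t * g t) (P * Q)"
proof -
  have "((\<lambda>t. (f t - poly P t) / t ^ 3 * g t + poly P t * ((g t - poly Q t) / t ^ 3))
      \<longlongrightarrow> 0 * poly Q 0 + poly P 0 * 0) (at 0)"
    using assms cubic_approx_tendsto[OF assms(2)] unfolding cubic_approx_def
    by (intro tendsto_intros) auto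
  then have "((\<lambda>t. (f t * g t - poly (P * Q) t) / t ^ 3) \<longlongrightarrow> 0 * poly Q 0 + poly P 0 * 0) (at 0)"
    by (rule Lim_transform_eventually) (auto simp: eventually_at_filter field_simps)
  then show ?thesis
    unfolding cubic_approx_def by simp
qed

text \<open>Peel off one coefficient at a time: convergence of the quotient forces the constant term
  to vanish, and cancelling t lowers the exponent. After three rounds the limit 0 is the value at 0
  of what remains.\<close>

lemma poly_div_cube_tendsto_0:
  fixes P :: "real poly"
  assumes "((\<lambda>t. poly P t / t ^ 3) \<longlongrightarrow> 0) (at_right 0)"
  shows "coeff P 3 = 0"
proof -
  have step: "coeff Q 0 = 0 \<and> ((\<lambda>t. poly R t / t ^ k) \<longlongrightarrow> 0) (at_right 0)"
    if "((\<lambda>t. poly Q t / t ^ Suc k) \<longlongrightarrow> 0) (at_right 0)" "Q = pCons a R" for Q R :: "real poly" and a k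
  proof -
    have "((\<lambda>t. t ^ Suc k * (poly Q t / t ^ Suc k)) \<longlongrightarrow> 0 ^ Suc k * 0) (at_right 0)"
      using that by (intro tendsto_intros) auto
    then have "((\<lambda>t. poly Q t) \<longlongrightarrow> 0 ^ Suc k * 0) (at_right 0)"
      by (rule Lim_transform_eventually) (auto simp: eventually_at_filter)
    moreover have "((\<lambda>t. poly Q t) \<longlongrightarrow> poly Q 0) (at_right 0)"
      by (intro tendsto_intros)
    ultimately have "0 ^ Suc k * 0 = poly Q 0"
      by (intro tendsto_unique[of "at_right (0::real)"]) auto
    then have "poly Q 0 = 0" by simp
    then have a: "a = 0"
      using that by simp
    have "((\<lambda>t. poly R t / t ^ k) \<longlongrightarrow> 0) (at_right 0)"
      using that(1)
      by (rule Lim_transform_eventually) (auto simp: eventually_at_filter that(2) a)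
    then show ?thesis
      using a that by simp
  qed
  obtain a0 P1 where P: "P = pCons a0 P1" by (cases P)
  obtain a1 P2 where P1: "P1 = pCons a1 P2" by (cases P1)
  obtain a2 P3 where P2: "P2 = pCons a2 P3" by (cases P2)
  have "((\<lambda>t. poly P1 t / t ^ 2) \<longlongrightarrow> 0) (at_right 0)"
    using step[of P 2] assms P by (simp add: numeral_eq_Suc)
  then have "((\<lambda>t. poly P2 t / t ^ 1) \<longlongrightarrow> 0) (at_right 0)"
    using step[of P1 1] P1 by (simp add: numeral_eq_Suc)
  then have "((\<lambda>t. poly P3 t) \<longlongrightarrow> 0) (at_right 0)"
    using step[of P2 0] P2 by (simp add: numeral_eq_Suc)
  moreover have "((\<lambda>t. poly P3 t) \<longlongrightarrow> poly P3 0) (at_right 0)"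
    by (intro tendsto_intros)
  ultimately have "0 = poly P3 0"
    by (intro tendsto_unique[of "at_right (0::real)"]) auto
  then show ?thesis
    by (simp add: P P1 P2 numeral_eq_Suc poly_0_coeff_0)
qed

text \<open>This turns the asymptotic expansion into an exact number. The total of the exponential
  sums is known for positive t only, hence the passage to the one-sided limit.\<close>

lemma cubic_approx_coeff:
  assumes "cubic_approx f P" "\<And>t. t > 0 \<Longrightarrow> f t = c * t ^ 3"
  shows "coeff P 3 = c"
proof -
  have "((\<lambda>t. - ((f t - poly P t) / t ^ 3)) \<longlongrightarrow> - 0) (at_right 0)"
    using assms(1) unfolding cubic_approx_def
    by (intro tendsto_minus) (rule tendsto_within_subset, auto)
  then have "((\<lambda>t. poly (P - monom c 3) t / t ^ 3) \<longlongrightarrow> - 0) (at_right 0)"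
    by (rule Lim_transform_eventually)
       (auto simp: eventually_at_filter assms(2) poly_monom field_simps)
  then have "((\<lambda>t. poly (P - monom c 3) t / t ^ 3) \<longlongrightarrow> 0) (at_right 0)"
    by simp
  then have "coeff (P - monom c 3) 3 = 0"
    by (rule poly_div_cube_tendsto_0)
  then show ?thesis by simp
qed

section \<open>Bernoulli polynomials and the Todd series\<close>

definition bern1 :: "real \<Rightarrow> real" where "bern1 u = u - 1 / 2"
definition bern2 :: "real \<Rightarrow> real" where "bern2 u = u ^ 2 - u + 1 / 6"
definition bern3 :: "real \<Rightarrow> real" where "bern3 u = u ^ 3 - 3 / 2 * u ^ 2 + u / 2"

text \<open>Terms of degree four and more tend to 0 even after division by t^3; this cuts a product
  of two cubics back to a cubic.\<close>

lemma cubic_approx_truncate: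
  assumes "cubic_approx f P"
    and "coeff P 0 = coeff Q 0" "coeff P 1 = coeff Q 1" "coeff P 2 = coeff Q 2" "coeff P 3 = coeff Q 3"
  shows "cubic_approx f Q"
proof -
  obtain a0 P1 where P: "P - Q = pCons a0 P1" by (cases "P - Q")
  obtain a1 P2 where P1: "P1 = pCons a1 P2" by (cases P1)
  obtain a2 P3 where P2: "P2 = pCons a2 P3" by (cases P2)
  obtain a3 R where P3: "P3 = pCons a3 R" by (cases P3)
  have "coeff (P - Q) 0 = 0" "coeff (P - Q) 1 = 0" "coeff (P - Q) 2 = 0" "coeff (P - Q) 3 = 0"
    using assms(2-) by auto
  then have "a0 = 0" "a1 = 0" "a2 = 0" "a3 = 0"
    by (simp_all add: P P1 P2 P3 numeral_eq_Suc)
  then have PQ: "poly P t - poly Q t = t ^ 4 * poly R t" for t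
    unfolding poly_diff [symmetric] P P1 P2 P3 by (simp add: power4_eq_xxxx)
  have "((\<lambda>t. (f t - poly P t) / t ^ 3 + t * poly R t) \<longlongrightarrow> 0 + 0 * poly R 0) (at 0)"
    using assms(1) unfolding cubic_approx_def by (intro tendsto_intros) auto
  then have "((\<lambda>t. (f t - poly Q t) / t ^ 3) \<longlongrightarrow> 0 + 0 * poly R 0) (at 0)"
  proof (rule Lim_transform_eventually)
    have "(f t - poly P t) / t ^ 3 + t * poly R t = (f t - poly Q t) / t ^ 3" if "t \<noteq> 0" for t
    proof -
      have "t * poly R t = (t ^ 4 * poly R t) / t ^ 3"
        using that by (simp add: power4_eq_xxxx power3_eq_cube)
      then show ?thesis
        unfolding PQ[symmetric] by (simp add: add_divide_distrib[symmetric])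
    qed
    then show "\<forall>\<^sub>F t in at 0. (f t - poly P t) / t ^ 3 + t * poly R t = (f t - poly Q t) / t ^ 3"
      by (auto simp: eventually_at_filter)
  qed
  then show ?thesis
    unfolding cubic_approx_def by simp
qed

lemma cubic_approx_scale:
  assumes "cubic_approx f [:a0, a1, a2, a3:]" "y \<noteq> 0"
  shows "cubic_approx (\<lambda>t. f (y * t)) [:a0, a1 * y, a2 * y ^ 2, a3 * y ^ 3:]"
proof -
  define F where "F s = (f s - poly [:a0, a1, a2, a3:] s) / s ^ 3" for s
  have "filterlim (\<lambda>t. y * t) (at 0) (at 0)"
    using assms(2) by (intro filterlim_atI tendsto_eq_intros) (auto simp: eventually_at_filter)
  from filterlim_compose[OF assms(1)[unfolded cubic_approx_def] this]
  have "((\<lambda>t. y ^ 3 * F (y * t)) \<longlongrightarrow> y ^ 3 * 0) (at 0)"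
    unfolding F_def by (intro tendsto_mult_left)
  then have "((\<lambda>t. (f (y * t) - poly [:a0, a1 * y, a2 * y ^ 2, a3 * y ^ 3:] t) / t ^ 3) \<longlongrightarrow> y ^ 3 * 0) (at 0)"
  proof (rule Lim_transform_eventually)
    have "y ^ 3 * F (y * t) = (f (y * t) - poly [:a0, a1 * y, a2 * y ^ 2, a3 * y ^ 3:] t) / t ^ 3"
      if "t \<noteq> 0" for t
    proof -
      have "y ^ 3 * (X / (y * t) ^ 3) = X / t ^ 3" for X
        using assms(2) that by (simp add: power_mult_distrib)
      moreover have "poly [:a0, a1, a2, a3:] (y * t) = poly [:a0, a1 * y, a2 * y ^ 2, a3 * y ^ 3:] t"
        by (simp add: algebra_simps power2_eq_square power3_eq_cube)
      ultimately show ?thesis unfolding F_def by metis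
    qed
    then show "\<forall>\<^sub>F t in at 0. y ^ 3 * F (y * t)
        = (f (y * t) - poly [:a0, a1 * y, a2 * y ^ 2, a3 * y ^ 3:] t) / t ^ 3"
      by (auto simp: eventually_at_filter)
  qed
  then show ?thesis
    unfolding cubic_approx_def by simp
qed

lemma cubic_approx_exp: "cubic_approx (\<lambda>t. exp (y * t)) [:1, y, y ^ 2 / 2, y ^ 3 / 6:]"
proof (cases "y = 0")
  case True
  then show ?thesis by (simp add: cubic_approx_def)
next
  case False
  have "((\<lambda>s::real. (exp s - poly [:1, 1, 1 / 2, 1 / 6:] s) / s ^ 3) \<longlongrightarrow> 0) (at 0)"
    by simp real_asymp
  then have "cubic_approx exp [:1, 1, 1 / 2, 1 / 6:]"
    by (simp add: cubic_approx_def)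
  from cubic_approx_scale[OF this False] show ?thesis by simp
qed

text \<open>The generating function s exp (u s) / (exp s - 1) of the Bernoulli polynomials at s = -
  y t, whence the alternating signs. Only s / (1 - exp (- s)) is expanded directly; the parameter u
  enters through a product with an exponential series.\<close>

lemma cubic_approx_todd:
  assumes "y \<noteq> 0"
  shows "cubic_approx (\<lambda>t. y * t * exp (- u * y * t) / (1 - exp (- (y * t))))
           [:1, - bern1 u * y, bern2 u / 2 * y ^ 2, - bern3 u / 6 * y ^ 3:]"
proof -
  have "((\<lambda>s::real. (s / (1 - exp (- s)) - poly [:1, 1 / 2, 1 / 12, 0:] s) / s ^ 3) \<longlongrightarrow> 0) (at 0)"
    by simp real_asymp
  then have "cubic_approx (\<lambda>s. s / (1 - exp (- s))) [:1, 1 / 2, 1 / 12, 0:]"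
    by (simp add: cubic_approx_def)
  from cubic_approx_mult[OF cubic_approx_scale[OF this assms] cubic_approx_exp[of "- u * y"]]
  have "cubic_approx (\<lambda>t. y * t * exp (- u * y * t) / (1 - exp (- (y * t))))
     ([:1, 1 / 2 * y, 1 / 12 * y ^ 2, 0 * y ^ 3:] *
      [:1, - u * y, (- u * y) ^ 2 / 2, (- u * y) ^ 3 / 6:])"
    by simp
  then show ?thesis
    by (rule cubic_approx_truncate)
       (simp_all add: numeral_eq_Suc bern1_def bern2_def bern3_def algebra_simps)
qed

section \<open>Sawtooth sums\<close>

text \<open>The sawtooth function of Dedekind sums at u / n. The value 0 at multiples of n, instead
  of - 1 / 2, makes it odd, and oddness is what annihilates the triple sum below.\<close>

definition saw :: "int \<Rightarrow> int \<Rightarrow> real" where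
  "saw n u = (if n dvd u then 0 else of_int (u mod n) / of_int n - 1 / 2)"

lemma saw_mod [simp]: "saw n (u mod n) = saw n u"
  by (simp add: saw_def dvd_mod_iff)

lemma saw_uminus:
  assumes "n > 0"
  shows "saw n (- u) = - saw n u"
proof (cases "n dvd u")
  case True
  then show ?thesis by (simp add: saw_def)
next
  case False
  then have "(- u) mod n = n - u mod n"
    by (simp add: zmod_zminus1_eq_if dvd_eq_mod_eq_0)
  then have "saw n (- u) = of_int (n - u mod n) / of_int n - 1 / 2"
    unfolding saw_def using False by simp
  also have "\<dots> = - (of_int (u mod n) / of_int n - 1 / 2)"
    using assms by (simp only: of_int_diff diff_divide_distrib) simp
  finally show ?thesis
    unfolding saw_def using False by simp
qed

lemma saw_cong: "u mod n = v mod n \<Longrightarrow> saw n u = saw n v"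
  by (metis saw_mod)

lemma bij_betw_mult_mod:
  fixes c n :: int
  assumes "n > 0" "coprime c n"
  shows "bij_betw (\<lambda>u. (c * u) mod n) {0..<n} {0..<n}"
proof (rule bij_betwI')
  show "((c * x) mod n = (c * y) mod n) = (x = y)" if "x \<in> {0..<n}" "y \<in> {0..<n}" for x y
  proof
    assume "(c * x) mod n = (c * y) mod n"
    then have "[c * x = c * y] (mod n)" by (simp add: cong_def)
    then have "[x = y] (mod n)" using assms(2) by (simp add: cong_mult_lcancel coprime_commute)
    then show "x = y" using that by (simp add: cong_def)
  qed simp
  show "(c * x) mod n \<in> {0..<n}" for x using assms by simp
  show "\<exists>x\<in>{0..<n}. y = (c * x) mod n" if y: "y \<in> {0..<n}" for y
  proof -
    obtain x where x: "[c * x = 1] (mod n)"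
      using cong_solve_coprime_int assms by blast
    have "[c * (x * y) = 1 * y] (mod n)"
      using cong_mult[OF x cong_refl[of y]] by (simp add: mult.assoc)
    then have "(c * (x * y)) mod n = y" using y by (simp add: cong_def)
    then have "y = (c * ((x * y) mod n)) mod n" by (simp add: mod_mult_right_eq)
    then show ?thesis using assms(1) by (intro bexI[of _ "(x * y) mod n"]) auto
  qed
qed

lemma residue_subst:
  fixes p q n i j :: int
  shows "(p * (i mod n) + q * j) mod n = (p * i + q * j) mod n"
    and "(p * i + q * (j mod n)) mod n = (p * i + q * j) mod n"
  by (metis mod_add_left_eq mod_mult_right_eq, metis mod_add_right_eq mod_mult_right_eq)

lemma sum_residues_mult:
  fixes f :: "int \<Rightarrow> real"
  assumes "n > 0" "coprime c n" "\<And>u. f (u mod n) = f u"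
  shows "(\<Sum>u\<in>{0..<n}. f (c * u)) = (\<Sum>u\<in>{0..<n}. f u)"
  using sum.reindex_bij_betw[OF bij_betw_mult_mod[OF assms(1,2)], of f] by (simp add: assms(3))

lemma sum_residues_shift:
  fixes f :: "int \<Rightarrow> real"
  assumes "n > 0" "\<And>u. f (u mod n) = f u"
  shows "(\<Sum>u\<in>{0..<n}. f (u + c)) = (\<Sum>u\<in>{0..<n}. f u)"
proof -
  have "bij_betw (\<lambda>u. (u + c) mod n) {0..<n} {0..<n}"
  proof (rule bij_betw_byWitness[where f' = "\<lambda>u. (u - c) mod n"])
  qed (use assms in \<open>auto simp: mod_simps\<close>)
  from sum.reindex_bij_betw[OF this, of f] show ?thesis by (simp add: assms(2))
qed

lemma sum_int_powers:
  fixes n :: int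
  assumes "n \<ge> 0"
  shows "(\<Sum>u\<in>{0..<n}. real_of_int u) = n * (n - 1) / 2"
    and "(\<Sum>u\<in>{0..<n}. real_of_int u ^ 2) = n * (n - 1) * (2 * n - 1) / 6"
    and "(\<Sum>u\<in>{0..<n}. real_of_int u ^ 3) = (n * (n - 1) / 2) ^ 2"
proof -
  have *: "(\<Sum>u\<in>{0..<int k}. real_of_int u) = real k * (real k - 1) / 2 \<and>
     (\<Sum>u\<in>{0..<int k}. real_of_int u ^ 2) = real k * (real k - 1) * (2 * real k - 1) / 6 \<and>
     (\<Sum>u\<in>{0..<int k}. real_of_int u ^ 3) = (real k * (real k - 1) / 2) ^ 2" for k
  proof (induction k)
    case (Suc k)
    have "{0..<int (Suc k)} = insert (int k) {0..<int k}" by auto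
    then show ?case using Suc
      by (simp add: field_simps power2_eq_square power3_eq_cube)
  qed simp
  obtain k where "n = int k" using assms by (rule nonneg_int_cases)
  then show "(\<Sum>u\<in>{0..<n}. real_of_int u) = n * (n - 1) / 2"
    "(\<Sum>u\<in>{0..<n}. real_of_int u ^ 2) = n * (n - 1) * (2 * n - 1) / 6"
    "(\<Sum>u\<in>{0..<n}. real_of_int u ^ 3) = (n * (n - 1) / 2) ^ 2"
    using *[of k] by simp_all
qed

lemma sum_bern:
  fixes n :: int
  assumes "n > 0"
  shows "(\<Sum>u\<in>{0..<n}. bern1 (u / n)) = - 1 / 2"
    and "(\<Sum>u\<in>{0..<n}. bern2 (u / n)) = 1 / (6 * n)"
    and "(\<Sum>u\<in>{0..<n}. bern3 (u / n)) = 0"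
proof -
  have n: "real_of_int n \<noteq> 0" using assms by simp
  have c: "(\<Sum>u\<in>{0..<n}. c) = n * c" for c :: real using assms by simp
  have s1: "(\<Sum>u\<in>{0..<n}. real_of_int u / n) = (n - 1) / 2"
    using sum_int_powers(1)[of n] assms by (simp add: sum_divide_distrib[symmetric] field_simps)
  have s2: "(\<Sum>u\<in>{0..<n}. (real_of_int u / n) ^ 2) = (n - 1) * (2 * n - 1) / (6 * n)"
    using sum_int_powers(2)[of n] assms
    by (simp add: power_divide sum_divide_distrib[symmetric] field_simps power2_eq_square)
  have s3: "(\<Sum>u\<in>{0..<n}. (real_of_int u / n) ^ 3) = (n - 1) ^ 2 / (4 * n)"
    using sum_int_powers(3)[of n] assms
    by (simp add: power_divide sum_divide_distrib[symmetric] field_simps power2_eq_square power3_eq_cube)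
  show "(\<Sum>u\<in>{0..<n}. bern1 (u / n)) = - 1 / 2"
    unfolding bern1_def sum_subtractf s1 c by (simp add: field_simps)
  show "(\<Sum>u\<in>{0..<n}. bern2 (u / n)) = 1 / (6 * n)"
    unfolding bern2_def sum_subtractf sum.distrib s1 s2 c using n
    by (simp add: field_simps power2_eq_square)
  have "(\<Sum>u\<in>{0..<n}. bern3 (u / n)) = (n - 1) ^ 2 / (4 * n)
      - 3 / 2 * ((n - 1) * (2 * n - 1) / (6 * n)) + (n - 1) / 2 / 2"
    unfolding bern3_def sum_subtractf sum.distrib
    unfolding sum_distrib_left[symmetric] sum_divide_distrib[of _ "{0..<n}" "2::real", symmetric] s1 s2 s3 by simp
  also have "\<dots> = 0" using n by (simp add: field_simps power2_eq_square)
  finally show "(\<Sum>u\<in>{0..<n}. bern3 (u / n)) = 0" .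
qed

lemma bern1_saw:
  assumes "n > 0"
  shows "bern1 (of_int (u mod n) / of_int n) = saw n u - of_bool (n dvd u) / 2"
  by (auto simp: saw_def bern1_def dvd_eq_mod_eq_0)

lemma sum_saw_square:
  assumes "n > 0"
  shows "(\<Sum>u\<in>{0..<n}. saw n u ^ 2) = (real_of_int n - 1) * (real_of_int n - 2) / (12 * real_of_int n)"
proof -
  have n: "real_of_int n \<noteq> 0" using assms by simp
  \<comment> \<open>\<open>saw\<close> and B_1 differ only at 0, where B_1 squared is 1 / 4; then
    B_1^2 = B_2 + 1 / 12 reduces everything to the sum of B_2.\<close>
  have "(\<Sum>u\<in>{0..<n}. saw n u ^ 2) = (\<Sum>u\<in>{0..<n}. bern1 (u / n) ^ 2 - of_bool (u = 0) / 4)"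
  proof (rule sum.cong[OF refl])
    fix u assume u: "u \<in> {0..<n}"
    then have "n dvd u \<longleftrightarrow> u = 0" by (auto dest: zdvd_imp_le)
    then show "saw n u ^ 2 = bern1 (u / n) ^ 2 - of_bool (u = 0) / 4"
      using u by (auto simp: saw_def bern1_def power2_eq_square)
  qed
  also have "\<dots> = (\<Sum>u\<in>{0..<n}. bern1 (u / n) ^ 2) - (\<Sum>u\<in>{0..<n}. of_bool (u = 0)) / 4"
    by (simp add: sum_subtractf sum_divide_distrib[symmetric])
  also have "(\<Sum>u\<in>{0..<n}. of_bool (u = 0)) = (1::real)"
    using assms by (simp add: of_bool_def)
  also have "(\<Sum>u\<in>{0..<n}. bern1 (u / n) ^ 2) = (\<Sum>u\<in>{0..<n}. bern2 (u / n) + 1 / 12)"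
    by (intro sum.cong) (auto simp: bern1_def bern2_def power2_eq_square algebra_simps)
  also have "\<dots> - 1 / 4 = 1 / (6 * real_of_int n) + real_of_int n / 12 - 1 / 4"
    using sum_bern(2)[OF assms] assms by (simp add: sum.distrib)
  also have "\<dots> = (real_of_int n - 1) * (real_of_int n - 2) / (12 * real_of_int n)"
    using n by (simp add: field_simps)
  finally show ?thesis .
qed

text \<open>Arithmetic form of an empty tetrahedron 0, a, b, c of determinant \<open>n\<close>: with
  c = p a + q b + n e, the point k e has coordinates - k p / n, - k q / n, k / n. Coprimality of
  \<open>p\<close>, \<open>q\<close> and \<open>p + q - 1\<close> expresses emptiness of the faces 0
  b c, 0 c a and a b c; \<open>terminal\<close> says that the representative of k e in the unit box
  lies beyond the plane of a, b, c.\<close>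

locale terminal_weights =
  fixes n p q :: int
  assumes n_pos: "n > 0"
    and coprime_p: "coprime p n" and coprime_q: "coprime q n" and coprime_sum: "coprime (p + q - 1) n"
    and terminal: "\<And>k. 0 < k \<Longrightarrow> k < n \<Longrightarrow> (- (k * p)) mod n + (- (k * q)) mod n + k > n"
begin

text \<open>Applied to k and to n - k, \<open>terminal\<close> pins the sum of three residues
  strictly between n and 2 n, so the carry in the residue of k (p + q - 1) is known. This linear
  relation is all that is extracted from the terminal lemma.\<close>

lemma saw_relation: "saw n (u * (p + q - 1)) = saw n (p * u) + saw n (q * u) - saw n u"
proof (cases "n dvd u")
  case True
  then show ?thesis by (simp add: saw_def)
next
  case False
  define k where "k = u mod n"
  have k: "0 < k" "k < n"
    using False n_pos pos_mod_sign[of n u] by (auto simp: k_def dvd_eq_mod_eq_0 order.order_iff_strict)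
  have nd: "\<not> n dvd k" using k by (auto dest: zdvd_imp_le)
  have ndp: "\<not> n dvd k * p" "\<not> n dvd k * q" "\<not> n dvd k * (p + q - 1)"
    using nd coprime_p coprime_q coprime_sum by (simp_all add: coprime_dvd_mult_left_iff coprime_commute)
  define P where "P = (- (k * p)) mod n"
  define Q where "Q = (- (k * q)) mod n"
  have P: "(k * p) mod n = n - P" and Q: "(k * q) mod n = n - Q"
    using ndp by (auto simp: P_def Q_def zmod_zminus1_eq_if dvd_eq_mod_eq_0)
  have lower: "P + Q + k > n"
    using terminal[OF k] by (simp add: P_def Q_def)
  \<comment> \<open>The reflection k to n - k replaces P and Q by n - P and n - Q and turns the
    lower bound into an upper bound.\<close>
  have "(- ((n - k) * p)) mod n = (k * p - n * p) mod n" by (simp add: algebra_simps)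
  also have "\<dots> = (k * p) mod n" by (simp add: mod_simps mod_diff_right_eq[symmetric] del: mod_diff_right_eq)
  finally have "(- ((n - k) * p)) mod n = n - P" by (simp add: P)
  moreover have "(- ((n - k) * q)) mod n = (k * q - n * q) mod n" by (simp add: algebra_simps)
  then have "(- ((n - k) * q)) mod n = n - Q"
    using Q by (simp add: mod_simps mod_diff_right_eq[symmetric] del: mod_diff_right_eq)
  ultimately have upper: "P + Q + k < 2 * n"
    using terminal[of "n - k"] k by simp
  have "(k * (p + q - 1)) mod n = (k * p + k * q - k) mod n" by (simp add: algebra_simps)
  also have "\<dots> = ((k * p) mod n + (k * q) mod n - k) mod n"
    by (metis mod_add_eq mod_diff_left_eq)
  also have "\<dots> = (n - (P + Q + k - n)) mod n" by (simp add: P Q algebra_simps)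
  also have "\<dots> = n - (P + Q + k - n)" using lower upper by (intro mod_pos_pos_trivial) auto
  finally have D: "(k * (p + q - 1)) mod n = 2 * n - P - Q - k" by simp
  have "saw n (k * (p + q - 1)) = saw n (k * p) + saw n (k * q) - saw n k"
  proof -
    have "saw n (k * (p + q - 1)) = (2 * n - P - Q - k) / n - 1 / 2"
      unfolding saw_def using ndp D by simp
    moreover have "saw n (k * p) = (n - P) / n - 1 / 2" "saw n (k * q) = (n - Q) / n - 1 / 2"
      unfolding saw_def using ndp P Q by simp_all
    moreover have "saw n k = k / n - 1 / 2"
      unfolding saw_def using nd k by simp
    ultimately show ?thesis
      using n_pos by (simp only:) (simp add: diff_divide_distrib add_divide_distrib)
  qed
  moreover have "saw n (k * c) = saw n (u * c)" for c
    by (rule saw_cong) (simp add: k_def mod_simps)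
  moreover have "saw n k = saw n u" by (simp add: k_def)
  ultimately show ?thesis
    by (simp only: mult.commute[of p] mult.commute[of q])
qed

text \<open>Square the linear relation and sum over a period. The multipliers p, q and p + q - 1
  permute the residues, so all square sums agree, and what is left is precisely the combination of
  Dedekind sums that a cone requires.\<close>

lemma sum_saw_products:
  "(\<Sum>u\<in>{0..<n}. saw n u * saw n (q * u)) + (\<Sum>u\<in>{0..<n}. saw n u * saw n (p * u))
    - (\<Sum>u\<in>{0..<n}. saw n (p * u) * saw n (q * u)) = (real_of_int n - 1) * (real_of_int n - 2) / (12 * real_of_int n)"
proof -
  define S where "S = (\<Sum>u\<in>{0..<n}. saw n u ^ 2)"
  have S: "(\<Sum>u\<in>{0..<n}. saw n (c * u) ^ 2) = S" if "coprime c n" for c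
    using sum_residues_mult[OF n_pos that, of "\<lambda>u. saw n u ^ 2"] by (simp add: S_def)
  define T1 where "T1 = (\<Sum>u\<in>{0..<n}. saw n u * saw n (q * u))"
  define T2 where "T2 = (\<Sum>u\<in>{0..<n}. saw n u * saw n (p * u))"
  define T3 where "T3 = (\<Sum>u\<in>{0..<n}. saw n (p * u) * saw n (q * u))"
  have "S = (\<Sum>u\<in>{0..<n}. (saw n (p * u) + saw n (q * u) - saw n u) ^ 2)"
    using S[OF coprime_sum] saw_relation by (simp add: mult.commute)
  also have "\<dots> = (\<Sum>u\<in>{0..<n}. saw n (p * u) ^ 2) + (\<Sum>u\<in>{0..<n}. saw n (q * u) ^ 2)
      + (\<Sum>u\<in>{0..<n}. saw n u ^ 2) + 2 * T3 - 2 * T2 - 2 * T1"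
    unfolding T1_def T2_def T3_def
    by (simp add: sum.distrib[symmetric] sum_subtractf[symmetric] sum_distrib_left power2_eq_square algebra_simps)
  also have "\<dots> = S + S + S + 2 * T3 - 2 * T2 - 2 * T1"
    unfolding S[OF coprime_p] S[OF coprime_q] by (simp add: S_def)
  finally show ?thesis
    using sum_saw_square[OF n_pos] by (simp add: S_def T1_def T2_def T3_def)
qed

text \<open>For fixed i the argument p i + q j runs once through all residues, as q is a unit. Thus
  any two of the three residues i, j, p i + q j behave as independent.\<close>

lemma sum_residues_13:
  fixes f g :: "int \<Rightarrow> real"
  shows "(\<Sum>i\<in>{0..<n}. \<Sum>j\<in>{0..<n}. f i * g ((p * i + q * j) mod n)) = sum f {0..<n} * sum g {0..<n}"
proof -
  have "(\<Sum>j\<in>{0..<n}. g ((p * i + q * j) mod n)) = sum g {0..<n}" for i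
    using sum_residues_mult[OF n_pos coprime_q, of "\<lambda>u. g ((p * i + u) mod n)"]
      sum_residues_shift[OF n_pos, of "\<lambda>u. g (u mod n)" "p * i"]
    by (simp add: mod_simps add.commute)
  then show ?thesis
    by (simp add: sum_distrib_left[symmetric] sum_distrib_right[symmetric])
qed

lemma sum_residues_23:
  fixes f g :: "int \<Rightarrow> real"
  shows "(\<Sum>i\<in>{0..<n}. \<Sum>j\<in>{0..<n}. f j * g ((p * i + q * j) mod n)) = sum f {0..<n} * sum g {0..<n}"
proof -
  have "(\<Sum>i\<in>{0..<n}. g ((p * i + q * j) mod n)) = sum g {0..<n}" for j
    using sum_residues_mult[OF n_pos coprime_p, of "\<lambda>u. g ((u + q * j) mod n)"]
      sum_residues_shift[OF n_pos, of "\<lambda>u. g (u mod n)" "q * j"]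
    by (simp add: mod_simps add.commute)
  then show ?thesis
    by (subst sum.swap) (simp add: sum_distrib_left[symmetric] sum_distrib_right[symmetric])
qed

text \<open>The solutions of p i + q j = 0 modulo n are i = q u, j = - p u, one for each residue u;
  oddness of \<open>saw\<close> produces the sign.\<close>

lemma sum_saw_dvd:
  "(\<Sum>i\<in>{0..<n}. \<Sum>j\<in>{0..<n}. of_bool (n dvd p * i + q * j) * saw n i * saw n j)
    = - (\<Sum>u\<in>{0..<n}. saw n (p * u) * saw n (q * u))"
proof -
  have per: "of_bool (n dvd p * (i mod n) + q * j) = (of_bool (n dvd p * i + q * j) :: real)"
    "of_bool (n dvd p * i + q * (j mod n)) = (of_bool (n dvd p * i + q * j) :: real)" for i j
    by (simp_all add: dvd_eq_mod_eq_0 residue_subst)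
  have "(\<Sum>i\<in>{0..<n}. \<Sum>j\<in>{0..<n}. of_bool (n dvd p * i + q * j) * saw n i * saw n j)
      = (\<Sum>i\<in>{0..<n}. \<Sum>j\<in>{0..<n}. of_bool (n dvd p * (q * i) + q * j) * saw n (q * i) * saw n j)"
    by (rule sum_residues_mult[OF n_pos coprime_q, symmetric,
          of "\<lambda>i. \<Sum>j\<in>{0..<n}. of_bool (n dvd p * i + q * j) * saw n i * saw n j"])
       (simp add: per)
  also have "\<dots> = (\<Sum>i\<in>{0..<n}. \<Sum>j\<in>{0..<n}. of_bool (n dvd p * i + j) * saw n (q * i) * saw n j)"
  proof (intro sum.cong[OF refl])
    fix i j
    have "p * (q * i) + q * j = q * (p * i + j)" by (simp add: algebra_simps)
    then show "of_bool (n dvd p * (q * i) + q * j) * saw n (q * i) * saw n j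
        = of_bool (n dvd p * i + j) * saw n (q * i) * saw n j"
      using coprime_q by (simp add: coprime_dvd_mult_right_iff coprime_commute)
  qed
  also have "\<dots> = (\<Sum>i\<in>{0..<n}. saw n (q * i) * saw n (- (p * i)))"
  proof (rule sum.cong[OF refl])
    fix i
    have "(n dvd p * i + j) \<longleftrightarrow> j = (- (p * i)) mod n" if "j \<in> {0..<n}" for j
    proof -
      have "n dvd p * i + j \<longleftrightarrow> j mod n = (- (p * i)) mod n"
        by (simp add: mod_eq_dvd_iff add.commute)
      then show ?thesis using that by simp
    qed
    then have "(\<Sum>j\<in>{0..<n}. of_bool (n dvd p * i + j) * saw n (q * i) * saw n j)
        = (\<Sum>j\<in>{0..<n}. if j = (- (p * i)) mod n then saw n (q * i) * saw n j else 0)"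
      by (intro sum.cong) auto
    also have "\<dots> = saw n (q * i) * saw n (- (p * i))"
      using n_pos by simp
    finally show "(\<Sum>j\<in>{0..<n}. of_bool (n dvd p * i + j) * saw n (q * i) * saw n j)
        = saw n (q * i) * saw n (- (p * i))" .
  qed
  also have "\<dots> = - (\<Sum>u\<in>{0..<n}. saw n (p * u) * saw n (q * u))"
    using n_pos by (simp add: saw_uminus sum_negf[symmetric] mult.commute)
  finally show ?thesis .
qed

text \<open>The substitution of - i, - j for i, j permutes the pairs of residues and changes the
  sign of each of three odd factors, so the sum equals its negative.\<close>

lemma sum_saw_triple: "(\<Sum>i\<in>{0..<n}. \<Sum>j\<in>{0..<n}. saw n i * saw n j * saw n (p * i + q * j)) = 0"
proof -
  have per1: "saw n (p * (i mod n) + q * j) = saw n (p * i + q * j)" for i j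
    by (rule saw_cong[OF residue_subst(1)])
  have per2: "saw n (p * i + q * (j mod n)) = saw n (p * i + q * j)" for i j
    by (rule saw_cong[OF residue_subst(2)])
  note per = per1 per2
  have m1: "coprime (-1) n" by simp
  have "(\<Sum>i\<in>{0..<n}. \<Sum>j\<in>{0..<n}. saw n i * saw n j * saw n (p * i + q * j))
     = (\<Sum>i\<in>{0..<n}. \<Sum>j\<in>{0..<n}. saw n (-1 * i) * saw n j * saw n (p * (-1 * i) + q * j))"
    by (rule sum_residues_mult[OF n_pos m1, symmetric,
          of "\<lambda>i. \<Sum>j\<in>{0..<n}. saw n i * saw n j * saw n (p * i + q * j)"]) (simp add: per)
  also have "\<dots> = (\<Sum>i\<in>{0..<n}. \<Sum>j\<in>{0..<n}. saw n (-1 * i) * saw n (-1 * j) * saw n (p * (-1 * i) + q * (-1 * j)))"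
  proof (rule sum.cong[OF refl])
    fix i
    show "(\<Sum>j\<in>{0..<n}. saw n (-1 * i) * saw n j * saw n (p * (-1 * i) + q * j))
        = (\<Sum>j\<in>{0..<n}. saw n (-1 * i) * saw n (-1 * j) * saw n (p * (-1 * i) + q * (-1 * j)))"
      by (rule sum_residues_mult[OF n_pos m1, symmetric,
          of "\<lambda>j. saw n (-1 * i) * saw n j * saw n (p * (-1 * i) + q * j)"])
         (simp only: per saw_mod)
  qed
  also have "\<dots> = - (\<Sum>i\<in>{0..<n}. \<Sum>j\<in>{0..<n}. saw n i * saw n j * saw n (p * i + q * j))"
    unfolding sum_negf[symmetric]
  proof (intro sum.cong[OF refl])
    fix i j
    have "saw n (p * (-1 * i) + q * (-1 * j)) = - saw n (p * i + q * j)"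
      using saw_uminus[OF n_pos, of "p * i + q * j"] by (simp only: minus_add_distrib mult_minus1 mult_minus_right)
    moreover have "saw n (-1 * i) = - saw n i" "saw n (-1 * j) = - saw n j"
      by (simp_all only: mult_minus1 saw_uminus[OF n_pos])
    ultimately show "saw n (-1 * i) * saw n (-1 * j) * saw n (p * (-1 * i) + q * (-1 * j))
        = - (saw n i * saw n j * saw n (p * i + q * j))" by simp
  qed
  finally show ?thesis by linarith
qed

lemma sum_bern1_triple:
  "(\<Sum>i\<in>{0..<n}. \<Sum>j\<in>{0..<n}. bern1 (i / n) * bern1 (j / n) * bern1 (real_of_int ((p * i + q * j) mod n) / n))
    = - 1 / 8 - (real_of_int n - 1) * (real_of_int n - 2) / (12 * real_of_int n) / 2"
proof -
  \<comment> \<open>Each factor is \<open>saw\<close> minus half an indicator. When two of i, j, p i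
    + q j vanish modulo n, so does the third; hence products of two indicators with a
    \<open>saw\<close> are 0, and the product of all three leaves - 1 / 8 at i = j = 0.\<close>
  have pt: "bern1 (i / n) * bern1 (j / n) * bern1 (real_of_int ((p * i + q * j) mod n) / n)
      = saw n i * saw n j * saw n (p * i + q * j)
        - (of_bool (i = 0) * saw n j * saw n (q * j) + of_bool (j = 0) * saw n i * saw n (p * i)
           + of_bool (n dvd p * i + q * j) * saw n i * saw n j) / 2
        - of_bool (i = 0) * of_bool (j = 0) / 8"
    if "i \<in> {0..<n}" "j \<in> {0..<n}" for i j
  proof -
    have b: "bern1 (u / n) = saw n u - of_bool (u = 0) / 2" if "u \<in> {0..<n}" for u
      using bern1_saw[OF n_pos, of u] that by (auto simp: dvd_eq_mod_eq_0)
    have 0: "saw n 0 = 0" by (simp add: saw_def)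
    have i0: "n dvd q * j \<longleftrightarrow> j = 0" "n dvd p * i \<longleftrightarrow> i = 0"
      using coprime_p coprime_q that
      by (auto simp: coprime_dvd_mult_right_iff coprime_commute dest: zdvd_imp_le)
    show ?thesis
      unfolding b[OF that(1)] b[OF that(2)] bern1_saw[OF n_pos]
      using i0 by (cases "i = 0"; cases "j = 0"; cases "n dvd p * i + q * j")
        (auto simp: 0 saw_def[of n "p * i + q * j"] algebra_simps)
  qed
  have "(\<Sum>i\<in>{0..<n}. \<Sum>j\<in>{0..<n}. bern1 (i / n) * bern1 (j / n) * bern1 (real_of_int ((p * i + q * j) mod n) / n))
      = (\<Sum>i\<in>{0..<n}. \<Sum>j\<in>{0..<n}. saw n i * saw n j * saw n (p * i + q * j))
        - ((\<Sum>i\<in>{0..<n}. \<Sum>j\<in>{0..<n}. of_bool (i = 0) * saw n j * saw n (q * j))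
           + (\<Sum>i\<in>{0..<n}. \<Sum>j\<in>{0..<n}. of_bool (j = 0) * saw n i * saw n (p * i))
           + (\<Sum>i\<in>{0..<n}. \<Sum>j\<in>{0..<n}. of_bool (n dvd p * i + q * j) * saw n i * saw n j)) / 2
        - (\<Sum>i\<in>{0..<n}. \<Sum>j\<in>{0..<n}. of_bool (i = 0) * of_bool (j = 0)) / 8"
    unfolding sum_divide_distrib sum.distrib[symmetric] sum_subtractf[symmetric]
    by (intro sum.cong[OF refl]) (use pt in auto)
  also have "(\<Sum>i\<in>{0..<n}. \<Sum>j\<in>{0..<n}. of_bool (i = 0) * saw n j * saw n (q * j))
      = (\<Sum>u\<in>{0..<n}. saw n u * saw n (q * u))"
    using n_pos by (subst sum.swap) (simp add: sum_distrib_right[symmetric] mult.assoc of_bool_def)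
  also have "(\<Sum>i\<in>{0..<n}. \<Sum>j\<in>{0..<n}. of_bool (j = 0) * saw n i * saw n (p * i))
      = (\<Sum>u\<in>{0..<n}. saw n u * saw n (p * u))"
    using n_pos by (simp add: sum_distrib_right[symmetric] mult.assoc of_bool_def)
  also have "(\<Sum>i\<in>{0..<n}. \<Sum>j\<in>{0..<n}. of_bool (i = 0) * of_bool (j = 0)) = (1::real)"
    using n_pos by (simp add: sum_distrib_left[symmetric] of_bool_def)
  finally show ?thesis
    unfolding sum_saw_triple sum_saw_dvd sum_saw_products[symmetric]
    by (simp add: diff_divide_distrib add_divide_distrib)
qed

end

section \<open>Exponential sums over a cone\<close>

text \<open>Selects the convergent one of two geometric expansions: for negative \<open>x\<close>
  the series over c >= 0 is replaced by minus the series over c < 0. Both have the same closed form,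
  so the formulas for cones do not see the signs of coordinates.\<close>

definition flip :: "real \<Rightarrow> int \<Rightarrow> real" where
  "flip x c = (if x > 0 \<and> c \<ge> 0 then 1 else if x < 0 \<and> c < 0 then - 1 else 0)"

lemma has_sum_flip_residue:
  assumes x: "x \<noteq> 0" and t: "t > 0" and n: "n > 0" and r: "0 \<le> r" "r < n"
  shows "((\<lambda>c. flip x c * exp (- t * (of_int c * x))) has_sum
           exp (- t * (of_int r * x)) / (1 - exp (- t * (of_int n * x)))) {c. c mod n = r}"
proof (cases "x > 0")
  case True
  define z where "z = exp (- t * (of_int n * x))"
  have z: "0 < z" "z < 1" using True t n by (simp_all add: z_def)
  have "((\<lambda>k. z ^ k) has_sum (1 / (1 - z))) UNIV"
    using z by (intro norm_summable_imp_has_sum geometric_sums) (auto simp: norm_power intro: summable_geometric)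
  then have "((\<lambda>k. exp (- t * (of_int r * x)) * z ^ k) has_sum (exp (- t * (of_int r * x)) * (1 / (1 - z)))) UNIV"
    by (rule has_sum_cmult_right)
  also have "?this \<longleftrightarrow> ((\<lambda>c. flip x c * exp (- t * (of_int c * x))) has_sum
      (exp (- t * (of_int r * x)) * (1 / (1 - z)))) {c. c mod n = r \<and> c \<ge> 0}"
  proof (rule has_sum_reindex_bij_witness[where j = "\<lambda>k. r + n * int k" and i = "\<lambda>c. nat ((c - r) div n)"])
    fix k :: nat
    show "nat ((r + n * int k - r) div n) = k" using n by simp
    show "r + n * int k \<in> {c. c mod n = r \<and> c \<ge> 0}" using n r by simp
    have "exp (- t * (of_int (r + n * int k) * x)) = exp (- t * (of_int r * x)) * exp (of_nat k * (- t * (of_int n * x)))"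
      by (simp add: algebra_simps flip: exp_add)
    also have "exp (of_nat k * (- t * (of_int n * x))) = z ^ k"
      by (simp only: z_def exp_of_nat_mult)
    finally show "flip x (r + n * int k) * exp (- t * (of_int (r + n * int k) * x))
        = exp (- t * (of_int r * x)) * z ^ k"
      using True n r by (simp only: flip_def) simp
  next
    fix c assume c: "c \<in> {c. c mod n = r \<and> c \<ge> 0}"
    then have "c = r + n * (c div n)" by auto
    moreover have "c div n \<ge> 0" using c n by (simp add: pos_imp_zdiv_nonneg_iff)
    ultimately show "r + n * int (nat ((c - r) div n)) = c"
      using n by (metis add_diff_cancel_left' nat_0_le nonzero_mult_div_cancel_left less_irrefl)
  qed simp_all
  also have "\<dots> \<longleftrightarrow> ((\<lambda>c. flip x c * exp (- t * (of_int c * x))) has_sum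
      (exp (- t * (of_int r * x)) * (1 / (1 - z)))) {c. c mod n = r}"
    by (rule has_sum_cong_neutral) (use True in \<open>auto simp: flip_def\<close>)
  finally show ?thesis by (simp add: z_def)
next
  case False
  define z where "z = exp (t * (of_int n * x))"
  have z: "0 < z" "z < 1" using False x t n by (simp_all add: z_def mult_pos_neg)
  have "((\<lambda>k. z ^ k) has_sum (z / (1 - z))) {1..}"
    using z by (intro has_sum_geometric_from_1) auto
  then have "((\<lambda>k. - exp (- t * (of_int r * x)) * z ^ k) has_sum (- exp (- t * (of_int r * x)) * (z / (1 - z)))) {1..}"
    by (rule has_sum_cmult_right)
  also have "?this \<longleftrightarrow> ((\<lambda>c. flip x c * exp (- t * (of_int c * x))) has_sum
      (- exp (- t * (of_int r * x)) * (z / (1 - z)))) {c. c mod n = r \<and> c < 0}"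
  proof (rule has_sum_reindex_bij_witness[where j = "\<lambda>k. r - n * int k" and i = "\<lambda>c. nat ((r - c) div n)"])
    fix k :: nat assume k: "k \<in> {1..}"
    show "nat ((r - (r - n * int k)) div n) = k" using n by simp
    have "n * 1 \<le> n * int k" using k n by (intro mult_left_mono) auto
    then have neg: "r - n * int k < 0" using r by linarith
    have "(r - n * int k) mod n = r"
      using r mod_mult_self2[of r n "- int k"] by simp
    then show "r - n * int k \<in> {c. c mod n = r \<and> c < 0}" using neg by simp
    have "exp (- t * (of_int (r - n * int k) * x)) = exp (- t * (of_int r * x)) * exp (of_nat k * (t * (of_int n * x)))"
      by (simp add: algebra_simps flip: exp_add)
    also have "exp (of_nat k * (t * (of_int n * x))) = z ^ k"
      by (simp only: z_def exp_of_nat_mult)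
    finally show "flip x (r - n * int k) * exp (- t * (of_int (r - n * int k) * x))
        = - exp (- t * (of_int r * x)) * z ^ k"
      using False x neg by (simp only: flip_def) simp
  next
    fix c assume c: "c \<in> {c. c mod n = r \<and> c < 0}"
    then have c': "c = r + n * (c div n)" by auto
    moreover have neg: "c div n < 0" using c n by (simp add: neg_imp_zdiv_neg_iff div_neg_pos_less0)
    ultimately have "(r - c) div n = - (c div n)"
      using n by (metis add_diff_cancel_left' minus_diff_eq mult_minus_right nonzero_mult_div_cancel_left less_irrefl)
    then show "r - n * int (nat ((r - c) div n)) = c" "nat ((r - c) div n) \<in> {1..}"
      using neg c' by simp_all
  qed simp_all
  also have "\<dots> \<longleftrightarrow> ((\<lambda>c. flip x c * exp (- t * (of_int c * x))) has_sum
      (- exp (- t * (of_int r * x)) * (z / (1 - z)))) {c. c mod n = r}"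
    by (rule has_sum_cong_neutral) (use False in \<open>auto simp: flip_def\<close>)
  \<comment> \<open>Here z is the reciprocal of the ratio in the closed form, and z / (1 - z) = - 1
    / (1 - 1 / z) absorbs the sign of \<open>flip\<close>.\<close>
  also have "- exp (- t * (of_int r * x)) * (z / (1 - z)) = exp (- t * (of_int r * x)) / (1 - exp (- t * (of_int n * x)))"
  proof -
    have "exp (- t * (of_int n * x)) = 1 / z" by (simp add: z_def exp_minus divide_inverse)
    moreover have "1 - 1 / z = - ((1 - z) / z)" using z by (simp add: field_simps)
    ultimately show ?thesis using z by (simp del: of_int_eq_1_iff)
  qed
  finally show ?thesis .
qed

lemma has_sum_product:
  fixes f :: "'a \<Rightarrow> real" and g :: "'b \<Rightarrow> real"
  assumes "(f has_sum a) A" "(g has_sum b) B"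
  shows "((\<lambda>(x, y). f x * g y) has_sum (a * b)) (A \<times> B)"
proof (rule has_sum_SigmaI)
  show "((\<lambda>y. case (x, y) of (x, y) \<Rightarrow> f x * g y) has_sum (f x * b)) B" for x
    using has_sum_cmult_right[OF assms(2), of "f x"] by simp
  show "((\<lambda>x. f x * b) has_sum (a * b)) A"
    using has_sum_cmult_left[OF assms(1)] .
  have abs: "(\<lambda>x. \<bar>f x\<bar>) summable_on A" "(\<lambda>y. \<bar>g y\<bar>) summable_on B"
    using summable_on_iff_abs_summable_on_real[THEN iffD1, OF has_sum_imp_summable[OF assms(1)]]
      summable_on_iff_abs_summable_on_real[THEN iffD1, OF has_sum_imp_summable[OF assms(2)]]
    by simp_all
  then obtain b' where b': "((\<lambda>y. \<bar>g y\<bar>) has_sum b') B" by (auto simp: summable_on_def)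
  have "(\<lambda>(x, y). \<bar>f x\<bar> * \<bar>g y\<bar>) summable_on (A \<times> B)"
  proof (rule summable_on_SigmaI)
    show "((\<lambda>y. case (x, y) of (x, y) \<Rightarrow> \<bar>f x\<bar> * \<bar>g y\<bar>) has_sum (\<bar>f x\<bar> * b')) B" for x
      using has_sum_cmult_right[OF b', of "\<bar>f x\<bar>"] by simp
    show "(\<lambda>x. \<bar>f x\<bar> * b') summable_on A"
      using abs(1) by (rule summable_on_cmult_left)
  qed auto
  then have "(\<lambda>z. norm (case z of (x, y) \<Rightarrow> f x * g y)) summable_on (A \<times> B)"
    by (simp add: case_prod_unfold abs_mult)
  then show "(\<lambda>(x, y). f x * g y) summable_on (A \<times> B)"
    by (rule summable_on_iff_abs_summable_on_real[THEN iffD2])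
qed

text \<open>Here i, j, k are the values of a dual lattice point on the three generators of a cone,
  and x, y, z the coordinates of the generic vector with respect to these generators.\<close>

definition cone_term :: "real \<Rightarrow> real \<Rightarrow> real \<Rightarrow> real \<Rightarrow> int \<Rightarrow> int \<Rightarrow> int \<Rightarrow> real" where
  "cone_term t x y z i j k = flip x i * flip y j * flip z k * exp (- t * (i * x + j * y + k * z))"

text \<open>The admissible triples form the sublattice k = p i + q j modulo n. It splits into n^2
  classes modulo n, and on each of them the triple series factors into geometric ones.\<close>

definition cone_sum :: "int \<Rightarrow> int \<Rightarrow> int \<Rightarrow> real \<Rightarrow> real \<Rightarrow> real \<Rightarrow> real \<Rightarrow> real" where
  "cone_sum n p q x y z t = (\<Sum>i\<in>{0..<n}. \<Sum>j\<in>{0..<n}.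
     exp (- t * (i * x)) / (1 - exp (- t * (n * x))) *
     (exp (- t * (j * y)) / (1 - exp (- t * (n * y))) *
      (exp (- t * (((p * i + q * j) mod n) * z)) / (1 - exp (- t * (n * z))))))"

lemma has_sum_cone:
  assumes "x \<noteq> 0" "y \<noteq> 0" "z \<noteq> 0" and t: "t > 0" and n: "n > 0"
  shows "((\<lambda>(i, j, k). cone_term t x y z i j k) has_sum cone_sum n p q x y z t)
           {(i, j, k). k mod n = (p * i + q * j) mod n}"
proof -
  define E where "E x r = exp (- t * (real_of_int r * x)) / (1 - exp (- t * (real_of_int n * x)))" for x r
  define R where "R r = {c. c mod n = r}" for r
  define f where "f x c = flip x c * exp (- t * (real_of_int c * x))" for x c
  have f: "(f x has_sum E x r) (R r)" if "x \<noteq> 0" "0 \<le> r" "r < n" for x r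
    unfolding f_def E_def R_def using has_sum_flip_residue[OF that(1) t n that(2,3)] .
  have "((\<lambda>(i, j, k). cone_term t x y z i j k) has_sum
          (\<Sum>(i, j)\<in>{0..<n} \<times> {0..<n}. E x i * (E y j * E z ((p * i + q * j) mod n))))
        (\<Union>(i, j)\<in>{0..<n} \<times> {0..<n}. R i \<times> (R j \<times> R ((p * i + q * j) mod n)))"
  proof (rule sum_has_sum)
    fix a assume "a \<in> {0..<n} \<times> {0..<n}"
    then obtain i j where a: "a = (i, j)" and ij: "0 \<le> i" "i < n" "0 \<le> j" "j < n" by auto
    have "((\<lambda>(i, (j, k)). f x i * (case (j, k) of (j, k) \<Rightarrow> f y j * f z k)) has_sum
        (E x i * (E y j * E z ((p * i + q * j) mod n)))) (R i \<times> (R j \<times> R ((p * i + q * j) mod n)))"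
      using has_sum_product[OF f has_sum_product[OF f f]] assms ij by (simp add: case_prod_unfold)
    moreover have "(\<lambda>(i, (j, k)). f x i * (case (j, k) of (j, k) \<Rightarrow> f y j * f z k)) = (\<lambda>(i, j, k). cone_term t x y z i j k)"
      by (auto simp: fun_eq_iff f_def cone_term_def algebra_simps simp flip: exp_add)
    ultimately show "((\<lambda>(i, j, k). cone_term t x y z i j k) has_sum
         (case a of (i, j) \<Rightarrow> E x i * (E y j * E z ((p * i + q * j) mod n))))
        (case a of (i, j) \<Rightarrow> R i \<times> (R j \<times> R ((p * i + q * j) mod n)))"
      by (simp add: a)
  qed (auto simp: R_def)
  also have "(\<Union>(i, j)\<in>{0..<n} \<times> {0..<n}. R i \<times> (R j \<times> R ((p * i + q * j) mod n)))
      = {(i, j, k). k mod n = (p * i + q * j) mod n}" (is "?L = ?R")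
  proof
    show "?L \<subseteq> ?R"
    proof clarify
      fix i j a b c assume "a \<in> R i" "b \<in> R j" "c \<in> R ((p * i + q * j) mod n)"
      then have "c mod n = (p * (a mod n) + q * (b mod n)) mod n" by (simp add: R_def)
      also have "\<dots> = (p * a + q * b) mod n" by (simp add: residue_subst)
      finally show "c mod n = (p * a + q * b) mod n" .
    qed
    show "?R \<subseteq> ?L"
    proof clarify
      fix a b c assume "c mod n = (p * a + q * b) mod n"
      then have "(a, b, c) \<in> R (a mod n) \<times> (R (b mod n) \<times> R ((p * (a mod n) + q * (b mod n)) mod n))"
        by (simp add: R_def residue_subst)
      then show "(a, b, c) \<in> ?L" using n by force
    qed
  qed
  finally show ?thesis
    by (simp add: cone_sum_def E_def sum.cartesian_product[symmetric])
qed

lemma coeff_3_cubic_product: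
  "coeff ([:1, a1, a2, a3:] * ([:1, b1, b2, b3:] * [:1, c1, c2, c3:])) 3
    = a3 + b3 + c3 + a1 * b2 + b1 * a2 + a1 * c2 + c1 * a2 + b1 * c2 + c1 * b2 + a1 * b1 * (c1 :: real)"
  by (simp add: numeral_eq_Suc algebra_simps)

section \<open>Constant coefficient of the sum over one cone\<close>

context terminal_weights
begin

text \<open>Each summand is a product of three Todd series divided by n^3 x y z t^3. After summation
  over residues the B_3 terms vanish, the mixed B_1 B_2 terms factor because two residues are
  independent, and the product of three B_1 carries the Dedekind sums, which emptiness
  determines.\<close>

lemma cone_sum_approx:
  assumes nz: "x \<noteq> 0" "y \<noteq> 0" "z \<noteq> 0"
  shows "\<exists>P. cubic_approx (\<lambda>t. t ^ 3 * cone_sum n p q x y z t) P \<and>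
     coeff P 3 = ((x + y + z) * (1 / x + 1 / y + 1 / z) / n + n - 1 / n) / 24"
proof -
  define m where "m = real_of_int n"
  have m: "m > 0" using n_pos by (simp add: m_def)
  define k where "k i j = (p * i + q * j) mod n" for i j
  define td where "td x r t = m * x * t * exp (- (r / m) * (m * x) * t) / (1 - exp (- (m * x * t)))" for x r t
  define Q where "Q x r = [:1, - bern1 (r / m) * (m * x), bern2 (r / m) / 2 * (m * x) ^ 2, - bern3 (r / m) / 6 * (m * x) ^ 3:]" for x r
  have td: "cubic_approx (td x r) (Q x r)" if "x \<noteq> 0" for x r
    unfolding td_def Q_def using that m by (intro cubic_approx_todd) auto
  define P where "P = smult (1 / (m ^ 3 * x * y * z)) (\<Sum>i\<in>{0..<n}. \<Sum>j\<in>{0..<n}. Q x i * (Q y j * Q z (k i j)))"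
  have "cubic_approx (\<lambda>t. 1 / (m ^ 3 * x * y * z) * (\<Sum>i\<in>{0..<n}. \<Sum>j\<in>{0..<n}. td x i t * (td y j t * td z (k i j) t))) P"
    unfolding P_def using nz by (intro cubic_approx_smult cubic_approx_sum cubic_approx_mult td) auto
  then have "cubic_approx (\<lambda>t. t ^ 3 * cone_sum n p q x y z t) P"
  proof (rule cubic_approx_cong)
    fix t :: real assume t: "t \<noteq> 0"
    have td': "td x r t = (m * x * t) * (exp (- t * (r * x)) / (1 - exp (- t * (m * x))))" for x r
      using m by (simp add: td_def mult.commute mult.left_commute)
    show "1 / (m ^ 3 * x * y * z) * (\<Sum>i\<in>{0..<n}. \<Sum>j\<in>{0..<n}. td x i t * (td y j t * td z (k i j) t))
        = t ^ 3 * cone_sum n p q x y z t"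
      unfolding cone_sum_def sum_distrib_left
    proof (intro sum.cong[OF refl])
      fix i j
      show "1 / (m ^ 3 * x * y * z) * (td x i t * (td y j t * td z (k i j) t)) = t ^ 3 *
        (exp (- t * (i * x)) / (1 - exp (- t * (n * x))) *
         (exp (- t * (j * y)) / (1 - exp (- t * (n * y))) *
         (exp (- t * (((p * i + q * j) mod n) * z)) / (1 - exp (- t * (n * z))))))"
        unfolding td' k_def m_def[symmetric] using m nz by (simp add: power3_eq_cube)
    qed
  qed
  moreover have "coeff P 3 = ((x + y + z) * (1 / x + 1 / y + 1 / z) / n + n - 1 / n) / 24"
  proof -
    define B1 where "B1 i = bern1 (real_of_int i / m)" for i
    define B2 where "B2 i = bern2 (real_of_int i / m)" for i
    define B3 where "B3 i = bern3 (real_of_int i / m)" for i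
    have s1: "sum B1 {0..<n} = - 1 / 2" and s2: "sum B2 {0..<n} = 1 / (6 * m)" and s3: "sum B3 {0..<n} = 0"
      using sum_bern[OF n_pos] by (simp_all add: B1_def B2_def B3_def m_def)
    have p12: "(\<Sum>i\<in>{0..<n}. \<Sum>j\<in>{0..<n}. f i * g j) = sum f {0..<n} * sum g {0..<n}" for f g :: "int \<Rightarrow> real"
      by (simp add: sum_product)
    have p13: "(\<Sum>i\<in>{0..<n}. \<Sum>j\<in>{0..<n}. f i * g (k i j)) = sum f {0..<n} * sum g {0..<n}" for f g :: "int \<Rightarrow> real"
      unfolding k_def by (rule sum_residues_13)
    have p23: "(\<Sum>i\<in>{0..<n}. \<Sum>j\<in>{0..<n}. f j * g (k i j)) = sum f {0..<n} * sum g {0..<n}" for f g :: "int \<Rightarrow> real"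
      unfolding k_def by (rule sum_residues_23)
    define X Y Z where "X = m * x" and "Y = m * y" and "Z = m * z"
    \<comment> \<open>Single B_3 terms are padded with a factor 1 and constants are moved to the
      right, so that every sum matches one of the evaluations for pairs or triples of
      residues.\<close>
    have "coeff (Q x i * (Q y j * Q z (k i j))) 3 =
       B3 i * 1 * (- (X ^ 3) / 6) + B3 j * 1 * (- (Y ^ 3) / 6) + 1 * B3 (k i j) * (- (Z ^ 3) / 6)
       + B1 i * B2 j * (- X * Y ^ 2 / 2) + B2 i * B1 j * (- Y * X ^ 2 / 2)
       + B1 i * B2 (k i j) * (- X * Z ^ 2 / 2) + B2 i * B1 (k i j) * (- Z * X ^ 2 / 2)
       + B1 j * B2 (k i j) * (- Y * Z ^ 2 / 2) + B2 j * B1 (k i j) * (- Z * Y ^ 2 / 2)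
       + B1 i * B1 j * B1 (k i j) * (- X * Y * Z)" for i j
      unfolding Q_def coeff_3_cubic_product B1_def B2_def B3_def X_def Y_def Z_def by (simp add: algebra_simps)
    then have "coeff (\<Sum>i\<in>{0..<n}. \<Sum>j\<in>{0..<n}. Q x i * (Q y j * Q z (k i j))) 3 =
       (\<Sum>i\<in>{0..<n}. \<Sum>j\<in>{0..<n}. B3 i * 1) * (- (X ^ 3) / 6)
       + (\<Sum>i\<in>{0..<n}. \<Sum>j\<in>{0..<n}. B3 j * 1) * (- (Y ^ 3) / 6)
       + (\<Sum>i\<in>{0..<n}. \<Sum>j\<in>{0..<n}. 1 * B3 (k i j)) * (- (Z ^ 3) / 6)
       + (\<Sum>i\<in>{0..<n}. \<Sum>j\<in>{0..<n}. B1 i * B2 j) * (- X * Y ^ 2 / 2)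
       + (\<Sum>i\<in>{0..<n}. \<Sum>j\<in>{0..<n}. B2 i * B1 j) * (- Y * X ^ 2 / 2)
       + (\<Sum>i\<in>{0..<n}. \<Sum>j\<in>{0..<n}. B1 i * B2 (k i j)) * (- X * Z ^ 2 / 2)
       + (\<Sum>i\<in>{0..<n}. \<Sum>j\<in>{0..<n}. B2 i * B1 (k i j)) * (- Z * X ^ 2 / 2)
       + (\<Sum>i\<in>{0..<n}. \<Sum>j\<in>{0..<n}. B1 j * B2 (k i j)) * (- Y * Z ^ 2 / 2)
       + (\<Sum>i\<in>{0..<n}. \<Sum>j\<in>{0..<n}. B2 j * B1 (k i j)) * (- Z * Y ^ 2 / 2)
       + (\<Sum>i\<in>{0..<n}. \<Sum>j\<in>{0..<n}. B1 i * B1 j * B1 (k i j)) * (- X * Y * Z)"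
      by (simp only: coeff_sum sum.distrib sum_distrib_right)
    also have "(\<Sum>i\<in>{0..<n}. \<Sum>j\<in>{0..<n}. B1 i * B1 j * B1 (k i j)) = - 1 / 8 - (m - 1) * (m - 2) / (12 * m) / 2"
      using sum_bern1_triple by (simp add: B1_def k_def m_def)
    also have "(\<Sum>i\<in>{0..<n}. \<Sum>j\<in>{0..<n}. B3 j * 1) = 0"
      by (simp add: s3)
    also have "(\<Sum>i\<in>{0..<n}. \<Sum>j\<in>{0..<n}. B3 i * 1) = 0"
      using p12[of B3 "\<lambda>_. 1"] s3 by simp
    also have "(\<Sum>i\<in>{0..<n}. \<Sum>j\<in>{0..<n}. 1 * B3 (k i j)) = 0"
      using p13[of "\<lambda>_. 1" B3] s3 by simp
    finally have "coeff P 3 = 1 / (m ^ 3 * x * y * z) *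
       (0 * (- (X ^ 3) / 6) + 0 * (- (Y ^ 3) / 6) + 0 * (- (Z ^ 3) / 6)
       + (- 1 / 2) * (1 / (6 * m)) * (- X * Y ^ 2 / 2)
       + (1 / (6 * m)) * (- 1 / 2) * (- Y * X ^ 2 / 2)
       + (- 1 / 2) * (1 / (6 * m)) * (- X * Z ^ 2 / 2)
       + (1 / (6 * m)) * (- 1 / 2) * (- Z * X ^ 2 / 2)
       + (- 1 / 2) * (1 / (6 * m)) * (- Y * Z ^ 2 / 2)
       + (1 / (6 * m)) * (- 1 / 2) * (- Z * Y ^ 2 / 2)
       + (- 1 / 8 - (m - 1) * (m - 2) / (12 * m) / 2) * (- X * Y * Z))"
      unfolding P_def coeff_smult p12 p13 p23 s1 s2 by simp
    also have "\<dots> = ((x + y + z) * (1 / x + 1 / y + 1 / z) / m + m - 1 / m) / 24"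
      unfolding X_def Y_def Z_def using nz m
      by (simp add: field_simps power2_eq_square power3_eq_cube)
    finally show ?thesis by (simp add: m_def)
  qed
  ultimately show ?thesis by blast
qed

end

section \<open>Lattices of rank three and empty simplices\<close>

text \<open>A lattice basis with its dual basis. All coordinates are taken by pairing with
  \<open>d1\<close>, \<open>d2\<close>, \<open>d3\<close>, so the lattice basis may be arbitrary and
  not just orthonormal.\<close>

locale lattice3 =
  fixes b1 b2 b3 d1 d2 d3 :: "'a::euclidean_space"
  assumes biorthogonal: "d1 \<bullet> b1 = 1" "d1 \<bullet> b2 = 0" "d1 \<bullet> b3 = 0"
      "d2 \<bullet> b1 = 0" "d2 \<bullet> b2 = 1" "d2 \<bullet> b3 = 0"
      "d3 \<bullet> b1 = 0" "d3 \<bullet> b2 = 0" "d3 \<bullet> b3 = 1"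
    and expansion: "\<And>x. x = (d1 \<bullet> x) *\<^sub>R b1 + (d2 \<bullet> x) *\<^sub>R b2 + (d3 \<bullet> x) *\<^sub>R b3"
begin

definition latt :: "'a set" where
  "latt = {x. d1 \<bullet> x \<in> \<int> \<and> d2 \<bullet> x \<in> \<int> \<and> d3 \<bullet> x \<in> \<int>}"

text \<open>The functional sending z to det (x, y, z), with the determinant normalized to 1 on the
  lattice basis. It therefore takes pairs of lattice vectors into the dual lattice, and in general
  it is not the Euclidean cross product.\<close>

definition cross :: "'a \<Rightarrow> 'a \<Rightarrow> 'a" where
  "cross x y = ((d2 \<bullet> x) * (d3 \<bullet> y) - (d3 \<bullet> x) * (d2 \<bullet> y)) *\<^sub>R d1
             + ((d3 \<bullet> x) * (d1 \<bullet> y) - (d1 \<bullet> x) * (d3 \<bullet> y)) *\<^sub>R d2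
             + ((d1 \<bullet> x) * (d2 \<bullet> y) - (d2 \<bullet> x) * (d1 \<bullet> y)) *\<^sub>R d3"

definition det3 :: "'a \<Rightarrow> 'a \<Rightarrow> 'a \<Rightarrow> real" where
  "det3 x y z = cross x y \<bullet> z"

lemma det3_coords: "det3 x y z =
    ((d2 \<bullet> x) * (d3 \<bullet> y) - (d3 \<bullet> x) * (d2 \<bullet> y)) * (d1 \<bullet> z)
  + ((d3 \<bullet> x) * (d1 \<bullet> y) - (d1 \<bullet> x) * (d3 \<bullet> y)) * (d2 \<bullet> z)
  + ((d1 \<bullet> x) * (d2 \<bullet> y) - (d2 \<bullet> x) * (d1 \<bullet> y)) * (d3 \<bullet> z)"
  by (simp add: det3_def cross_def inner_add_left)

lemma vec_eqI: "d1 \<bullet> x = d1 \<bullet> y \<Longrightarrow> d2 \<bullet> x = d2 \<bullet> y \<Longrightarrow> d3 \<bullet> x = d3 \<bullet> y \<Longrightarrow> x = y"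
  by (subst expansion[of x], subst expansion[of y]) simp

lemma det3_rotate: "det3 x y z = det3 y z x"
  by (simp add: det3_coords algebra_simps)

lemma det3_swap: "det3 y x z = - det3 x y z"
  by (simp add: det3_coords algebra_simps)

lemma det3_same [simp]: "det3 x x z = 0" "det3 x z x = 0" "det3 z x x = 0"
  by (simp_all add: det3_coords algebra_simps)

lemma det3_lin3:
  "det3 x y (u + v) = det3 x y u + det3 x y v" "det3 x y (u - v) = det3 x y u - det3 x y v"
  "det3 x y (k *\<^sub>R u) = k * det3 x y u" "det3 x y 0 = 0"
  by (simp_all add: det3_def inner_add_right inner_diff_right)

lemma det3_lin1:
  "det3 (u + v) x y = det3 u x y + det3 v x y" "det3 (u - v) x y = det3 u x y - det3 v x y"
  "det3 (k *\<^sub>R u) x y = k * det3 u x y" "det3 0 x y = 0"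
  by (simp_all add: det3_coords inner_add_right inner_diff_right algebra_simps)

lemma det3_lin2:
  "det3 x (u + v) y = det3 x u y + det3 x v y" "det3 x (u - v) y = det3 x u y - det3 x v y"
  "det3 x (k *\<^sub>R u) y = k * det3 x u y" "det3 x 0 y = 0"
  by (simp_all add: det3_coords inner_add_right inner_diff_right algebra_simps)

lemmas det3_lin = det3_lin1 det3_lin2 det3_lin3

lemma cramer: "det3 a b c *\<^sub>R x = det3 x b c *\<^sub>R a + det3 a x c *\<^sub>R b + det3 a b x *\<^sub>R c"
  by (rule vec_eqI) (simp_all add: inner_add_right det3_coords algebra_simps)

text \<open>Cramer's rule paired with y; it recovers a functional from its values on three
  vectors.\<close>

lemma cramer_dual:
  "det3 a b c *\<^sub>R y = (y \<bullet> a) *\<^sub>R cross b c + (y \<bullet> b) *\<^sub>R cross c a + (y \<bullet> c) *\<^sub>R cross a b"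
proof (rule vector_eq_rdot[THEN iffD1], rule allI)
  fix x
  have "det3 a b c * (y \<bullet> x) = y \<bullet> (det3 a b c *\<^sub>R x)" by simp
  also have "\<dots> = det3 x b c * (y \<bullet> a) + det3 a x c * (y \<bullet> b) + det3 a b x * (y \<bullet> c)"
    unfolding cramer[of a b c x] by (simp add: inner_add_right)
  finally show "(det3 a b c *\<^sub>R y) \<bullet> x
      = ((y \<bullet> a) *\<^sub>R cross b c + (y \<bullet> b) *\<^sub>R cross c a + (y \<bullet> c) *\<^sub>R cross a b) \<bullet> x"
    using det3_rotate[of x b c] det3_rotate[of a x c] det3_rotate[of x c a]
    by (simp add: inner_add_left det3_def)
qed

definition dual_fun :: "'a \<Rightarrow> 'a \<Rightarrow> 'a \<Rightarrow> real \<Rightarrow> real \<Rightarrow> real \<Rightarrow> 'a" where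
  "dual_fun a b c u v w = (1 / det3 a b c) *\<^sub>R (u *\<^sub>R cross b c + v *\<^sub>R cross c a + w *\<^sub>R cross a b)"

lemma dual_fun_inner:
  assumes "det3 a b c \<noteq> 0"
  shows "dual_fun a b c u v w \<bullet> a = u" "dual_fun a b c u v w \<bullet> b = v" "dual_fun a b c u v w \<bullet> c = w"
proof -
  have "cross b c \<bullet> a = det3 a b c" "cross c a \<bullet> b = det3 a b c" "cross a b \<bullet> c = det3 a b c"
    using det3_rotate[of a b c] det3_rotate[of c a b] by (simp_all add: det3_def)
  moreover have "cross x y \<bullet> x = 0" "cross x y \<bullet> y = 0" for x y
    by (simp_all flip: det3_def)
  ultimately show "dual_fun a b c u v w \<bullet> a = u" "dual_fun a b c u v w \<bullet> b = v" "dual_fun a b c u v w \<bullet> c = w"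
    using assms by (simp_all add: dual_fun_def inner_add_left)
qed

lemma dual_fun_unique:
  assumes "det3 a b c \<noteq> 0"
  shows "y = dual_fun a b c (y \<bullet> a) (y \<bullet> b) (y \<bullet> c)"
  unfolding dual_fun_def cramer_dual[of a b c y, symmetric] using assms by simp

lemma dual_eqI3:
  assumes "det3 a b c \<noteq> 0" "x \<bullet> a = y \<bullet> a" "x \<bullet> b = y \<bullet> b" "x \<bullet> c = y \<bullet> c"
  shows "x = y"
  using dual_fun_unique[OF assms(1), of x] dual_fun_unique[OF assms(1), of y] assms(2-) by simp

lemma orthogonal_cross:
  assumes "det3 a b c \<noteq> 0" "y \<bullet> a = 0" "y \<bullet> b = 0"
  shows "y = (y \<bullet> c / det3 a b c) *\<^sub>R cross a b"
  using dual_fun_unique[OF assms(1), of y] assms(2-) by (simp add: dual_fun_def)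

lemma coords_unique:
  assumes "det3 a b c \<noteq> 0" "u *\<^sub>R a + v *\<^sub>R b + w *\<^sub>R c = u' *\<^sub>R a + v' *\<^sub>R b + w' *\<^sub>R c"
  shows "u = u'" "v = v'" "w = w'"
proof -
  have "y \<bullet> (u *\<^sub>R a + v *\<^sub>R b + w *\<^sub>R c) = y \<bullet> (u' *\<^sub>R a + v' *\<^sub>R b + w' *\<^sub>R c)" for y
    using assms(2) by simp
  from this[of "dual_fun a b c 1 0 0"] this[of "dual_fun a b c 0 1 0"] this[of "dual_fun a b c 0 0 1"]
  show "u = u'" "v = v'" "w = w'"
    using dual_fun_inner[OF assms(1)] by (simp_all add: inner_add_right)
qed

lemma coords_of:
  assumes "det3 a b c \<noteq> 0"
  shows "x = (det3 x b c / det3 a b c) *\<^sub>R a + (det3 a x c / det3 a b c) *\<^sub>R b + (det3 a b x / det3 a b c) *\<^sub>R c"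
proof -
  have "x = (1 / det3 a b c) *\<^sub>R (det3 a b c *\<^sub>R x)" using assms by simp
  then show ?thesis unfolding cramer[of a b c x] by (simp add: scaleR_add_right)
qed

lemma latt_add [intro]: "x \<in> latt \<Longrightarrow> y \<in> latt \<Longrightarrow> x + y \<in> latt"
  by (simp add: latt_def inner_add_right)

lemma latt_diff [intro]: "x \<in> latt \<Longrightarrow> y \<in> latt \<Longrightarrow> x - y \<in> latt"
  by (simp add: latt_def inner_diff_right)

lemma latt_int_scale: "x \<in> latt \<Longrightarrow> of_int k *\<^sub>R x \<in> latt"
  by (simp add: latt_def)

lemma det3_Ints:
  assumes "x \<in> latt" "y \<in> latt" "z \<in> latt"
  shows "det3 x y z \<in> \<int>"
  using assms unfolding det3_coords latt_def by (auto intro!: Ints_mult Ints_add Ints_diff)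

lemma basis_latt: "b1 \<in> latt" "b2 \<in> latt" "b3 \<in> latt" "det3 b1 b2 b3 = 1"
  by (simp_all add: latt_def biorthogonal det3_coords)

lemma cross_dual_lattice: "x \<in> latt \<Longrightarrow> y \<in> latt \<Longrightarrow> cross x y \<in> dual_lattice latt"
  using det3_Ints by (auto simp: dual_lattice_def simp flip: det3_def)

section \<open>Empty tetrahedra and their weights\<close>

definition empty_simplex :: "'a \<Rightarrow> 'a \<Rightarrow> 'a \<Rightarrow> bool" where
  "empty_simplex a b c \<longleftrightarrow> (\<forall>u v w. 0 \<le> u \<and> 0 \<le> v \<and> 0 \<le> w \<and> u + v + w \<le> 1 \<and>
     u *\<^sub>R a + v *\<^sub>R b + w *\<^sub>R c \<in> latt \<longrightarrow> u \<in> {0, 1} \<and> v \<in> {0, 1} \<and> w \<in> {0, 1})"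

lemma empty_simplexD:
  assumes "empty_simplex a b c" "0 \<le> u" "0 \<le> v" "0 \<le> w" "u + v + w \<le> 1" "u *\<^sub>R a + v *\<^sub>R b + w *\<^sub>R c \<in> latt"
  shows "u \<in> {0, 1}" "v \<in> {0, 1}" "w \<in> {0, 1}"
  using assms unfolding empty_simplex_def by blast+

lemma empty_simplex_rotate:
  assumes "empty_simplex a b c"
  shows "empty_simplex b c a"
  unfolding empty_simplex_def
proof (intro allI impI, elim conjE)
  fix u v w :: real
  assume "0 \<le> u" "0 \<le> v" "0 \<le> w" "u + v + w \<le> 1" "u *\<^sub>R b + v *\<^sub>R c + w *\<^sub>R a \<in> latt"
  then show "u \<in> {0, 1} \<and> v \<in> {0, 1} \<and> w \<in> {0, 1}"
    using empty_simplexD[OF assms, of w u v] by (simp add: algebra_simps)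
qed

text \<open>A point of a half-open parallelogram or its reflection through the centre lies in the
  triangle below the diagonal.\<close>

lemma parallelogram_Ints:
  assumes T: "\<And>s t. 0 \<le> s \<Longrightarrow> 0 \<le> t \<Longrightarrow> s + t \<le> 1 \<Longrightarrow> s *\<^sub>R x + t *\<^sub>R y \<in> latt \<Longrightarrow> s \<in> {0, 1} \<and> t \<in> {0, 1}"
    and xy: "x \<in> latt" "y \<in> latt" and z: "s *\<^sub>R x + t *\<^sub>R y \<in> latt"
  shows "s \<in> \<int> \<and> t \<in> \<int>"
proof -
  have fr: "0 \<le> frac s" "frac s < 1" "0 \<le> frac t" "frac t < 1"
    by (simp_all add: frac_lt_1)
  have "s *\<^sub>R x + t *\<^sub>R y - (of_int \<lfloor>s\<rfloor> *\<^sub>R x + of_int \<lfloor>t\<rfloor> *\<^sub>R y) \<in> latt"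
    by (rule latt_diff[OF z]) (use xy in \<open>auto intro: latt_int_scale\<close>)
  also have "s *\<^sub>R x + t *\<^sub>R y - (of_int \<lfloor>s\<rfloor> *\<^sub>R x + of_int \<lfloor>t\<rfloor> *\<^sub>R y) = frac s *\<^sub>R x + frac t *\<^sub>R y"
    by (simp add: frac_def algebra_simps)
  finally have f: "frac s *\<^sub>R x + frac t *\<^sub>R y \<in> latt" .
  show ?thesis
  proof (cases "frac s + frac t \<le> 1")
    case True
    from T[OF _ _ True f] fr have "frac s = 0" "frac t = 0" by auto
    then show ?thesis by (simp add: frac_eq_0_iff)
  next
    case False
    have "x + y - (frac s *\<^sub>R x + frac t *\<^sub>R y) \<in> latt" using f xy by auto
    also have "x + y - (frac s *\<^sub>R x + frac t *\<^sub>R y) = (1 - frac s) *\<^sub>R x + (1 - frac t) *\<^sub>R y"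
      by (simp add: algebra_simps)
    finally have "1 - frac s \<in> {0, 1} \<and> 1 - frac t \<in> {0, 1}"
      using T[of "1 - frac s" "1 - frac t"] fr False by simp
    then show ?thesis using fr by (auto simp: frac_eq_0_iff)
  qed
qed

lemma empty_simplex_edge:
  assumes "empty_simplex a b c" "a \<in> latt" "b \<in> latt" "s *\<^sub>R a + t *\<^sub>R b \<in> latt"
  shows "s \<in> \<int> \<and> t \<in> \<int>"
proof (rule parallelogram_Ints[OF _ assms(2-)])
  show "s \<in> {0, 1} \<and> t \<in> {0, 1}" if "0 \<le> s" "0 \<le> t" "s + t \<le> 1" "s *\<^sub>R a + t *\<^sub>R b \<in> latt" for s t
    using empty_simplexD[OF assms(1), of s t 0] that by simp
qed

lemma empty_simplex_triangle:
  assumes "empty_simplex a b c" "a \<in> latt" "b \<in> latt" "c \<in> latt" "s *\<^sub>R (b - a) + t *\<^sub>R (c - a) \<in> latt"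
  shows "s \<in> \<int> \<and> t \<in> \<int>"
proof (rule parallelogram_Ints[OF _ _ _ assms(5)])
  show "s \<in> {0, 1} \<and> t \<in> {0, 1}"
    if "0 \<le> s" "0 \<le> t" "s + t \<le> 1" and l: "s *\<^sub>R (b - a) + t *\<^sub>R (c - a) \<in> latt" for s t
  proof -
    have "a + (s *\<^sub>R (b - a) + t *\<^sub>R (c - a)) \<in> latt" using l assms(2) by blast
    also have "a + (s *\<^sub>R (b - a) + t *\<^sub>R (c - a)) = (1 - s - t) *\<^sub>R a + s *\<^sub>R b + t *\<^sub>R c"
      by (simp add: algebra_simps)
    finally show ?thesis
      using empty_simplexD[OF assms(1), of "1 - s - t" s t] that by simp
  qed
qed (use assms in auto)

lemma coprimeI_dvd:
  fixes n p :: int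
  assumes "n > 0" "\<And>k. n dvd k * p \<Longrightarrow> n dvd k"
  shows "coprime p n"
proof -
  define g where "g = gcd p n"
  have g: "g > 0" "g dvd n" "g dvd p" using assms(1) by (auto simp: g_def)
  obtain m where m: "n = g * m" using g by auto
  obtain p' where p': "p = g * p'" using g by auto
  have "n dvd m * p" by (simp add: m p')
  then have "n dvd m" by (rule assms(2))
  moreover have "m > 0" using assms(1) g m by (simp add: zero_less_mult_iff)
  ultimately have "g * m \<le> m" using m zdvd_imp_le by blast
  then have "g = 1" using \<open>m > 0\<close> g by (simp add: mult_le_cancel_right1)
  then show ?thesis by (simp add: g_def coprime_iff_gcd_eq_1)
qed

text \<open>Take a lattice vector e of least positive determinant over a and b. Division with
  remainder, and emptiness of the triangle 0, a, b, show that a, b, e generate the lattice;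
  comparison with the given basis then forces the determinant to be 1.\<close>

lemma empty_simplex_complement:
  assumes E: "empty_simplex a b c" and abc: "a \<in> latt" "b \<in> latt" "c \<in> latt" and pos: "det3 a b c > 0"
  obtains e where "e \<in> latt" "det3 a b e = 1"
    "\<And>x. x \<in> latt \<Longrightarrow> \<exists>i j k :: int. x = of_int i *\<^sub>R a + of_int j *\<^sub>R b + of_int k *\<^sub>R e"
proof -
  define S where "S = {k :: nat. k > 0 \<and> (\<exists>x\<in>latt. det3 a b x = real k)}"
  obtain n where n: "det3 a b c = of_int n" using det3_Ints[OF abc] by (auto elim: Ints_cases)
  have "nat n \<in> S" using n pos abc(3) by (auto simp: S_def)
  then have "Inf S \<in> S" by (intro Inf_nat_def1) auto
  then obtain e where e: "e \<in> latt" "det3 a b e = real (Inf S)" and g: "Inf S > 0" by (auto simp: S_def)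
  define g where "g = int (Inf S)"
  have g0: "g > 0" and eg: "det3 a b e = of_int g" using e g by (simp_all add: g_def)
  have rep: "\<exists>i j k :: int. x = of_int i *\<^sub>R a + of_int j *\<^sub>R b + of_int k *\<^sub>R e" if x: "x \<in> latt" for x
  proof -
    obtain m where m: "det3 a b x = of_int m" using det3_Ints[OF abc(1,2) x] by (auto elim: Ints_cases)
    define y where "y = x - of_int (m div g) *\<^sub>R e"
    have y: "y \<in> latt" unfolding y_def using x e by (intro latt_diff latt_int_scale)
    have dy: "det3 a b y = of_int (m mod g)"
      by (simp add: y_def det3_lin m eg minus_div_mult_eq_mod[symmetric])
    have "m mod g = 0"
    proof (rule ccontr)
      assume "m mod g \<noteq> 0"
      then have mg: "0 < m mod g" "m mod g < g"
        using g0 pos_mod_sign[of g m] pos_mod_bound[of g m] by linarith+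
      then have "nat (m mod g) \<in> S" using y dy by (auto simp: S_def)
      then have "Inf S \<le> nat (m mod g)" by (intro cInf_lower) auto
      then show False using mg by (simp add: g_def)
    qed
    then have "det3 a b y = 0" by (simp add: dy)
    then have "y = (det3 y b e / det3 a b e) *\<^sub>R a + (det3 a y e / det3 a b e) *\<^sub>R b"
      using coords_of[of a b e y] eg g0 by simp
    moreover from this y have "(det3 y b e / det3 a b e) \<in> \<int> \<and> (det3 a y e / det3 a b e) \<in> \<int>"
      using empty_simplex_edge[OF E abc(1,2)] by metis
    ultimately obtain i j :: int where "y = of_int i *\<^sub>R a + of_int j *\<^sub>R b"
      by (metis Ints_cases)
    then have "x = of_int i *\<^sub>R a + of_int j *\<^sub>R b + of_int (m div g) *\<^sub>R e"
      by (simp add: y_def algebra_simps)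
    then show ?thesis by blast
  qed
  \<comment> \<open>Expressed in a, b, e, the given lattice basis has determinant an integer
    multiple of g; its determinant is 1, so g divides 1.\<close>
  obtain i1 j1 k1 i2 j2 k2 i3 j3 k3 :: int where
    e1: "b1 = of_int i1 *\<^sub>R a + of_int j1 *\<^sub>R b + of_int k1 *\<^sub>R e" and
    e2: "b2 = of_int i2 *\<^sub>R a + of_int j2 *\<^sub>R b + of_int k2 *\<^sub>R e" and
    e3: "b3 = of_int i3 *\<^sub>R a + of_int j3 *\<^sub>R b + of_int k3 *\<^sub>R e"
    using rep basis_latt by metis
  have perm: "det3 a e b = - det3 a b e" "det3 b a e = - det3 a b e" "det3 b e a = det3 a b e"
    "det3 e a b = det3 a b e" "det3 e b a = - det3 a b e"
    by (simp_all add: det3_coords algebra_simps)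
  have "det3 b1 b2 b3 = of_int (i1 * (j2 * k3 - k2 * j3) - j1 * (i2 * k3 - k2 * i3) + k1 * (i2 * j3 - j2 * i3)) * of_int g"
    unfolding eg[symmetric] by (subst e1, subst e2, subst e3) (simp add: det3_lin perm algebra_simps)
  then have "1 = (i1 * (j2 * k3 - k2 * j3) - j1 * (i2 * k3 - k2 * i3) + k1 * (i2 * j3 - j2 * i3)) * g"
    unfolding basis_latt(4) of_int_mult[symmetric] by linarith
  then have "g dvd 1" by (metis dvd_triv_right)
  then have "g = 1" using g0 by simp
  then show thesis using that e eg rep by simp
qed

text \<open>In c = p a + q b + n e the coefficient of e is the determinant. If n divides j p, j q or
  j (p + q - 1), then j e, shifted by a multiple of one vertex, lies in the plane 0 b c or 0 c a or
  is parallel to the triangle a b c, and emptiness of that face makes j / n integral.\<close>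

lemma empty_simplex_weights:
  assumes E: "empty_simplex a b c" and abc: "a \<in> latt" "b \<in> latt" "c \<in> latt"
    and n: "det3 a b c = of_int n" "n > 0"
  obtains p q e where "terminal_weights n p q" "e \<in> latt" "of_int n *\<^sub>R e = c - of_int p *\<^sub>R a - of_int q *\<^sub>R b"
    "\<And>x. x \<in> latt \<Longrightarrow> \<exists>i j k :: int. x = of_int i *\<^sub>R a + of_int j *\<^sub>R b + of_int k *\<^sub>R e"
proof -
  obtain e where e: "e \<in> latt" "det3 a b e = 1"
    and rep: "\<And>x. x \<in> latt \<Longrightarrow> \<exists>i j k :: int. x = of_int i *\<^sub>R a + of_int j *\<^sub>R b + of_int k *\<^sub>R e"
    using empty_simplex_complement[OF E abc] n by (metis of_int_0_less_iff)
  obtain p q k where c: "c = of_int p *\<^sub>R a + of_int q *\<^sub>R b + of_int k *\<^sub>R e"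
    using rep[OF abc(3)] by blast
  have "det3 a b c = of_int k"
    by (subst c) (simp add: det3_lin e)
  then have k: "k = n" using n by simp
  have ke: "of_int j *\<^sub>R e = (of_int j / of_int n) *\<^sub>R c - (of_int (j * p) / of_int n) *\<^sub>R a - (of_int (j * q) / of_int n) *\<^sub>R b" for j
    using n(2) by (subst c) (simp add: k algebra_simps)
  have lattj: "of_int j *\<^sub>R e \<in> latt" for j using e by (rule_tac latt_int_scale)
  have int: "n dvd j" if "real_of_int j / of_int n \<in> \<int>" for j
  proof -
    obtain m where "real_of_int j / of_int n = of_int m" using \<open>_ \<in> \<int>\<close> by (auto elim: Ints_cases)
    then have "real_of_int j = of_int (n * m)" using n(2) by (simp add: field_simps)
    then have "j = n * m" by linarith
    then show ?thesis by simp
  qed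
  have "terminal_weights n p q"
  proof
    show "n > 0" by fact
    show "coprime p n"
    proof (rule coprimeI_dvd[OF n(2)])
      fix j assume "n dvd j * p"
      then obtain m where m: "j * p = n * m" by auto
      have "of_int j *\<^sub>R e + of_int m *\<^sub>R a \<in> latt"
        using lattj abc e by (intro latt_add latt_int_scale)
      also have "of_int j *\<^sub>R e + of_int m *\<^sub>R a = (- of_int (j * q) / of_int n) *\<^sub>R b + (of_int j / of_int n) *\<^sub>R c"
        unfolding ke m using n(2) by simp
      finally show "n dvd j"
        using empty_simplex_edge[OF empty_simplex_rotate[OF E] abc(2,3)] int by blast
    qed
    show "coprime q n"
    proof (rule coprimeI_dvd[OF n(2)])
      fix j assume "n dvd j * q"
      then obtain m where m: "j * q = n * m" by auto
      have "of_int j *\<^sub>R e + of_int m *\<^sub>R b \<in> latt"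
        using lattj abc e by (intro latt_add latt_int_scale)
      also have "of_int j *\<^sub>R e + of_int m *\<^sub>R b = (of_int j / of_int n) *\<^sub>R c + (- of_int (j * p) / of_int n) *\<^sub>R a"
        unfolding ke m using n(2) by simp
      finally show "n dvd j"
        using empty_simplex_edge[OF empty_simplex_rotate[OF empty_simplex_rotate[OF E]] abc(3,1)] int by blast
    qed
    show "coprime (p + q - 1) n"
    proof (rule coprimeI_dvd[OF n(2)])
      fix j assume "n dvd j * (p + q - 1)"
      then obtain m where m: "j * (p + q - 1) = n * m" by auto
      have m': "of_int m = real_of_int (j * p) / of_int n + of_int (j * q) / of_int n - of_int j / of_int n"
      proof -
        have "real_of_int (j * p) + of_int (j * q) - of_int j = of_int n * of_int m"
          unfolding of_int_mult[of n m, symmetric] m[symmetric] by (simp add: algebra_simps)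
        then show ?thesis using n(2) by (simp add: field_simps)
      qed
      have "of_int j *\<^sub>R e + of_int m *\<^sub>R a \<in> latt"
        using lattj abc e by (intro latt_add latt_int_scale)
      also have "of_int j *\<^sub>R e + of_int m *\<^sub>R a = (- of_int (j * q) / of_int n) *\<^sub>R (b - a) + (of_int j / of_int n) *\<^sub>R (c - a)"
        unfolding ke m' by (simp add: algebra_simps)
      finally show "n dvd j"
        using empty_simplex_triangle[OF E abc] int by blast
    qed
    fix j assume j: "0 < j" "j < n"
    \<comment> \<open>Adding u' a + v' b moves j e into the unit box of the coordinates in a, b, c.
      With coordinate sum at most 1 it would lie in the tetrahedron although j / n is neither 0 nor
      1.\<close>
    define u where "u = (- (j * p)) mod n"
    define v where "v = (- (j * q)) mod n"
    have uv: "0 \<le> u" "0 \<le> v" using n(2) by (simp_all add: u_def v_def)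
    show "u + v + j > n"
    proof (rule ccontr)
      assume "\<not> u + v + j > n"
      then have le: "real_of_int u / of_int n + of_int v / of_int n + of_int j / of_int n \<le> 1"
        using n(2) by (simp add: add_divide_distrib[symmetric] flip: of_int_add)
      have "n dvd j * p + u" "n dvd j * q + v"
        by (simp_all add: u_def v_def mod_eq_0_iff_dvd[symmetric] mod_simps)
      then obtain u' v' where uv': "u = n * u' - j * p" "v = n * v' - j * q"
        by (metis add_diff_cancel_left' dvdE)
      have "of_int j *\<^sub>R e + of_int u' *\<^sub>R a + of_int v' *\<^sub>R b \<in> latt"
        using lattj abc e by (intro latt_add latt_int_scale)
      also have "of_int j *\<^sub>R e + of_int u' *\<^sub>R a + of_int v' *\<^sub>R b
          = (of_int u / of_int n) *\<^sub>R a + (of_int v / of_int n) *\<^sub>R b + (of_int j / of_int n) *\<^sub>R c"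
        unfolding ke uv' using n(2) by (simp add: algebra_simps diff_divide_distrib)
      finally have "of_int j / of_int n \<in> {0, 1::real}"
        using empty_simplexD(3)[OF E _ _ _ le] uv j n(2) by simp
      then show False using j by auto
    qed
  qed
  moreover have "of_int n *\<^sub>R e = c - of_int p *\<^sub>R a - of_int q *\<^sub>R b"
    by (subst c) (simp add: k)
  ultimately show thesis using that e rep by blast
qed

end

section \<open>Fans from weights\<close>

context lattice3
begin

lemma cross_zero_parallel:
  assumes "cross a b = 0" "a \<noteq> 0"
  obtains s where "b = s *\<^sub>R a"
proof -
  have z: "cross a b \<bullet> b1 = 0" "cross a b \<bullet> b2 = 0" "cross a b \<bullet> b3 = 0" using assms by simp_all
  then have m: "(d2 \<bullet> a) * (d3 \<bullet> b) = (d3 \<bullet> a) * (d2 \<bullet> b)" "(d3 \<bullet> a) * (d1 \<bullet> b) = (d1 \<bullet> a) * (d3 \<bullet> b)"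
    "(d1 \<bullet> a) * (d2 \<bullet> b) = (d2 \<bullet> a) * (d1 \<bullet> b)"
    by (simp_all add: cross_def inner_add_left biorthogonal)
  have "d1 \<bullet> a \<noteq> 0 \<or> d2 \<bullet> a \<noteq> 0 \<or> d3 \<bullet> a \<noteq> 0"
    using assms(2) vec_eqI[of a 0] by auto
  then show thesis
  proof (elim disjE)
    assume "d1 \<bullet> a \<noteq> 0"
    then show thesis using m by (intro that[of "(d1 \<bullet> b) / (d1 \<bullet> a)"] vec_eqI) (auto simp: field_simps)
  next
    assume "d2 \<bullet> a \<noteq> 0"
    then show thesis using m by (intro that[of "(d2 \<bullet> b) / (d2 \<bullet> a)"] vec_eqI) (auto simp: field_simps)
  next
    assume "d3 \<bullet> a \<noteq> 0"
    then show thesis using m by (intro that[of "(d3 \<bullet> b) / (d3 \<bullet> a)"] vec_eqI) (auto simp: field_simps)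
  qed
qed

lemma cross_nonzero: "det3 a b c \<noteq> 0 \<Longrightarrow> cross a b \<noteq> 0"
  by (auto simp: det3_def)

lemma cross_swap: "cross b a = - cross a b"
  by (simp add: cross_def algebra_simps)

lemma two_le_DIM: "DIM('a) \<ge> 2"
proof (rule ccontr)
  assume "\<not> DIM('a) \<ge> 2"
  then have "dim (UNIV :: 'a set) < 2" by simp
  moreover have "independent {b1, b2}" "b1 \<noteq> b2"
  proof -
    show ne: "b1 \<noteq> b2" using biorthogonal by auto
    show "independent {b1, b2}"
    proof (rule independent_if_scalars_zero)
      fix f x assume s: "(\<Sum>x\<in>{b1, b2}. f x *\<^sub>R x) = 0" "x \<in> {b1, b2}"
      then have "f b1 *\<^sub>R b1 + f b2 *\<^sub>R b2 = 0" using ne by simp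
      then have "d1 \<bullet> (f b1 *\<^sub>R b1 + f b2 *\<^sub>R b2) = 0" "d2 \<bullet> (f b1 *\<^sub>R b1 + f b2 *\<^sub>R b2) = 0" by simp_all
      then show "f x = 0" using s(2) by (auto simp: inner_add_right biorthogonal)
    qed simp
  qed
  ultimately show False
    using independent_card_le[of "{b1, b2}"] by simp
qed

end

text \<open>The fan consists of the cones over the boundary of the convex hull of the points p / r
  p: a functional y with y . p <= r p on \<open>A\<close> is a supporting plane of this hull.
  \<open>surround\<close> puts the origin into the interior, and \<open>generic\<close> makes all
  facets triangles.\<close>

locale weighted_fan = lattice3 b1 b2 b3 d1 d2 d3 for b1 b2 b3 d1 d2 d3 :: "'a::euclidean_space" +
  fixes A :: "'a set" and r :: "'a \<Rightarrow> real"
  assumes finite_A: "finite A"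
    and r_pos: "\<And>p. p \<in> A \<Longrightarrow> r p > 0"
    and surround: "\<And>y. y \<noteq> 0 \<Longrightarrow> \<exists>p\<in>A. y \<bullet> p < 0"
    and generic: "\<And>S y. S \<subseteq> A \<Longrightarrow> card S = 4 \<Longrightarrow> \<exists>p\<in>S. y \<bullet> p \<noteq> r p"
begin

definition supp :: "'a \<Rightarrow> 'a \<Rightarrow> 'a \<Rightarrow> 'a" where
  "supp a b c = dual_fun a b c (r a) (r b) (r c)"

text \<open>Ordered triples of positive orientation. A triangle occurs in exactly three rotations,
  so sums over \<open>facets\<close> count it three times; a triple also singles out one directed
  edge of its triangle, the one from a to b.\<close>

definition facets :: "('a \<times> 'a \<times> 'a) set" where
  "facets = {(a, b, c). a \<in> A \<and> b \<in> A \<and> c \<in> A \<and> det3 a b c > 0 \<and> (\<forall>p\<in>A. supp a b c \<bullet> p \<le> r p)}"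

lemma facetsI:
  assumes "a \<in> A" "b \<in> A" "c \<in> A" "det3 a b c > 0"
    and "y \<bullet> a = r a" "y \<bullet> b = r b" "y \<bullet> c = r c" "\<And>p. p \<in> A \<Longrightarrow> y \<bullet> p \<le> r p"
  shows "(a, b, c) \<in> facets"
proof -
  have "y = supp a b c"
    using assms dual_fun_inner[of a b c] by (intro dual_eqI3[of a b c]) (auto simp: supp_def)
  then show ?thesis using assms by (auto simp: facets_def)
qed

lemma facetsD:
  assumes "(a, b, c) \<in> facets"
  shows "a \<in> A" "b \<in> A" "c \<in> A" "det3 a b c > 0" "supp a b c \<bullet> a = r a" "supp a b c \<bullet> b = r b"
    "supp a b c \<bullet> c = r c" "\<And>p. p \<in> A \<Longrightarrow> supp a b c \<bullet> p \<le> r p"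
  using assms dual_fun_inner[of a b c] by (auto simp: facets_def supp_def)

lemma finite_facets: "finite facets"
  by (rule finite_subset[of _ "A \<times> A \<times> A"]) (auto simp: facets_def finite_A)

lemma facets_distinct:
  assumes "(a, b, c) \<in> facets"
  shows "a \<noteq> b" "b \<noteq> c" "a \<noteq> c"
  using facetsD(4)[OF assms] by auto

lemma generic4:
  assumes "{a, b, c, d} \<subseteq> A" "card {a, b, c, d} = 4"
    "y \<bullet> a = r a" "y \<bullet> b = r b" "y \<bullet> c = r c" "y \<bullet> d = r d"
  shows False
  using generic[OF assms(1,2), of y] assms(3-) by auto

lemma facets_tight:
  assumes "(a, b, c) \<in> facets" "p \<in> A" "supp a b c \<bullet> p = r p"
  shows "p \<in> {a, b, c}"
proof (rule ccontr)
  assume "p \<notin> {a, b, c}"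
  then show False
    using facetsD[OF assms(1)] facets_distinct[OF assms(1)] assms(2,3)
    by (intro generic4[of a b c p "supp a b c"]) auto
qed

lemma facets_rotate:
  assumes "(a, b, c) \<in> facets"
  shows "(b, c, a) \<in> facets"
  using facetsD[OF assms] det3_rotate[of a b c] by (intro facetsI[of _ _ _ "supp a b c"]) auto

text \<open>Pivoting: tilt the supporting plane about the edge a b, away from c, until it hits the
  next point. For uniqueness, two supporting functionals tight at a and b differ by a multiple of
  \<open>cross a b\<close>; each is bounded by the weight at the apex of the other, so they
  coincide, and genericity forbids two apexes.\<close>

lemma facets_opposite:
  assumes abc: "(a, b, c) \<in> facets"
  shows "\<exists>!c'. (b, a, c') \<in> facets"
proof -
  note D = facetsD[OF abc]
  define m where "m = cross a b"
  have m: "m \<bullet> a = 0" "m \<bullet> b = 0" "m \<bullet> c > 0" using D(4) by (simp_all add: m_def flip: det3_def)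
  define y where "y = supp a b c"
  \<comment> \<open>The amount of tilt at which p, on the far side of the edge, becomes tight; the
    least value determines the pivot.\<close>
  define f where "f p = (r p - y \<bullet> p) / (- (m \<bullet> p))" for p
  define S where "S = {p \<in> A. m \<bullet> p < 0}"
  have "m \<noteq> 0" using m by auto
  then have S: "finite S" "S \<noteq> {}" using finite_A surround by (auto simp: S_def)
  have "Min (f ` S) \<in> f ` S" using S by simp
  then obtain e where e: "e \<in> S" "f e = Min (f ` S)" by auto
  have emin: "f e \<le> f p" if "p \<in> S" for p using that S e by simp
  have eA: "e \<in> A" "m \<bullet> e < 0" using e by (auto simp: S_def)
  define y' where "y' = y - f e *\<^sub>R m"
  have y'val: "y' \<bullet> p = y \<bullet> p - f e * (m \<bullet> p)" for p by (simp add: y'_def inner_diff_left)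
  have fe: "f e \<ge> 0" unfolding f_def using eA D(8)[of e] by (intro divide_nonneg_pos) (auto simp: y_def)
  have key: "f p * (- (m \<bullet> p)) = r p - y \<bullet> p" if "m \<bullet> p < 0" for p using that by (simp add: f_def)
  have y'e: "y' \<bullet> e = r e" using key[OF eA(2)] by (simp add: y'val)
  have le: "y' \<bullet> p \<le> r p" if "p \<in> A" for p
  proof (cases "m \<bullet> p < 0")
    case True
    then have "f e * (- (m \<bullet> p)) \<le> f p * (- (m \<bullet> p))"
      using emin[of p] that by (intro mult_right_mono) (auto simp: S_def)
    then show ?thesis using key[OF True] by (simp add: y'val)
  next
    case False
    then have "f e * (m \<bullet> p) \<ge> 0" using fe by simp
    then show ?thesis using D(8)[OF that] by (simp add: y'val y_def)
  qed
  have dete: "det3 b a p = - (m \<bullet> p)" for p by (simp add: det3_def m_def cross_swap[of b a])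
  have y'ab: "y' \<bullet> a = r a" "y' \<bullet> b = r b" using D m by (simp_all add: y'val y_def)
  have bae: "(b, a, e) \<in> facets"
    using D eA y'e y'ab le dete by (intro facetsI[of _ _ _ y']) auto
  moreover have "c' = e" if c': "(b, a, c') \<in> facets" for c'
  proof (rule ccontr)
    assume ne: "c' \<noteq> e"
    note D' = facetsD[OF c']
    define z where "z = supp b a c'"
    have mc': "m \<bullet> c' < 0" using D'(4) dete by simp
    have "z - y' = ((z - y') \<bullet> e / det3 a b e) *\<^sub>R cross a b"
      using D' y'ab eA det3_swap[of a b e] dete[of e]
      by (intro orthogonal_cross) (auto simp: inner_diff_left z_def)
    then obtain s where s: "z - y' = s *\<^sub>R m" by (simp add: m_def)
    have zv: "z \<bullet> p = y' \<bullet> p + s * (m \<bullet> p)" for p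
      using arg_cong[OF s, of "\<lambda>v. v \<bullet> p"] by (simp add: inner_diff_left)
    have "s * (m \<bullet> e) \<le> 0" using zv[of e] y'e D'(8)[of e] eA by (simp add: z_def)
    then have "s \<ge> 0" using eA by (simp add: mult_le_0_iff)
    moreover have "s * (m \<bullet> c') \<ge> 0" using zv[of c'] le[of c'] D' by (simp add: z_def)
    then have "s \<le> 0" using mc' by (simp add: zero_le_mult_iff)
    ultimately have "z = y'" using s by simp
    then have "y' \<bullet> c' = r c'" using D' by (simp add: z_def)
    moreover have "card {a, b, e, c'} = 4"
      using facets_distinct[OF bae] facets_distinct[OF c'] ne by auto
    ultimately show False
      using generic4[of a b e c' y'] D D' eA y'ab y'e by auto
  qed
  ultimately show ?thesis by blast
qed

lemma sum_facets_rotate: "(\<Sum>(a, b, c)\<in>facets. f b c a) = (\<Sum>(a, b, c)\<in>facets. f a b c)"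
  by (rule sum.reindex_bij_witness[where i = "\<lambda>(a, b, c). (c, a, b)" and j = "\<lambda>(a, b, c). (b, c, a)"])
     (auto intro: facets_rotate)

definition opp :: "'a \<Rightarrow> 'a \<Rightarrow> 'a" where
  "opp a b = (THE c. (a, b, c) \<in> facets)"

lemma facets_opp: "(a, b, c) \<in> facets \<Longrightarrow> (b, a, opp b a) \<in> facets"
  unfolding opp_def by (rule theI') (rule facets_opposite)

lemma opp_eq: "(a, b, c) \<in> facets \<Longrightarrow> opp a b = c"
  using facets_opposite[OF facets_opp] facets_opp[OF facets_opp] by blast

lemma sum_facets_opp: "(\<Sum>(a, b, c)\<in>facets. f b a (opp b a)) = (\<Sum>(a, b, c)\<in>facets. f a b c)"
  by (rule sum.reindex_bij_witness[where i = "\<lambda>(a, b, c). (b, a, opp b a)" and j = "\<lambda>(a, b, c). (b, a, opp b a)"])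
     (auto simp: facets_opp opp_eq)

text \<open>Every edge is traversed once in each direction, by the two triangles that share it: a
  closed surface has no boundary.\<close>

lemma sum_facets_antisym:
  fixes g :: "'a \<Rightarrow> 'a \<Rightarrow> real"
  assumes "\<And>a b. g b a = - g a b"
  shows "(\<Sum>(a, b, c)\<in>facets. g a b + g b c + g c a) = 0"
proof -
  have "(\<Sum>(a, b, c)\<in>facets. g a b) = (\<Sum>(a, b, c)\<in>facets. g b a)"
    using sum_facets_opp[of "\<lambda>a b c. g a b"] by simp
  also have "\<dots> = (\<Sum>t\<in>facets. - (case t of (a, b, c) \<Rightarrow> g a b))"
    by (rule sum.cong[OF refl], clarify, rule assms)
  also have "\<dots> = - (\<Sum>(a, b, c)\<in>facets. g a b)"
    by (rule sum_negf)
  finally have z: "(\<Sum>(a, b, c)\<in>facets. g a b) = 0"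
    by simp
  have "(\<Sum>(a, b, c)\<in>facets. g b c) = 0"
    using z sum_facets_rotate[of "\<lambda>a b c. g a b"] by simp
  moreover have "(\<Sum>(a, b, c)\<in>facets. g c a) = 0"
    using calculation sum_facets_rotate[of "\<lambda>a b c. g b c"] by simp
  ultimately show ?thesis
    using z by (simp add: case_prod_unfold sum.distrib)
qed

section \<open>Generic vectors and the cones that contain them\<close>

definition generic_vec :: "'a \<Rightarrow> bool" where
  "generic_vec x \<longleftrightarrow> (\<forall>p\<in>A. \<forall>q\<in>A. cross p q \<noteq> 0 \<longrightarrow> det3 p q x \<noteq> 0)"

lemma not_all_parallel:
  assumes "p \<in> A" "p \<noteq> 0"
  shows "\<exists>q\<in>A. cross p q \<noteq> 0"
proof (rule ccontr)
  assume "\<not> ?thesis"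
  then have par: "\<exists>s. q = s *\<^sub>R p" if "q \<in> A" for q
    using cross_zero_parallel[OF _ assms(2)] that by metis
  obtain y where y: "y \<noteq> 0" "orthogonal p y"
    using orthogonal_to_vector_exists[OF two_le_DIM] by (metis orthogonal_commute)
  from surround[OF y(1)] obtain q where "q \<in> A" "y \<bullet> q < 0" by auto
  then show False using par[of q] y by (auto simp: orthogonal_def inner_commute)
qed

lemma negligible_non_generic: "negligible {x. \<not> generic_vec x}"
proof -
  define H where "H = (\<Union>(p, q)\<in>{(p, q) \<in> A \<times> A. cross p q \<noteq> 0}. {x. cross p q \<bullet> x = 0})"
  have "negligible H"
    unfolding H_def
  proof (rule negligible_Union)
    show "finite ((\<lambda>(p, q). {x. cross p q \<bullet> x = 0}) ` {(p, q) \<in> A \<times> A. cross p q \<noteq> 0})"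
      by (rule finite_imageI, rule finite_subset[of _ "A \<times> A"]) (auto simp: finite_A)
  qed (auto intro: negligible_hyperplane)
  moreover have "{x. \<not> generic_vec x} \<subseteq> H" by (auto simp: H_def generic_vec_def det3_def)
  ultimately show ?thesis by (rule negligible_subset)
qed

lemma exists_generic: "\<exists>x. generic_vec x"
  using negligible_subset[OF negligible_non_generic, of UNIV] non_negligible_UNIV by blast

text \<open>Otherwise a nonzero functional is nonnegative on the hull, against
  \<open>surround\<close>. The supporting hyperplane theorem concerns the relative interior, so a
  hull of lower dimension is treated separately by a hyperplane containing it.\<close>

lemma zero_interior_hull: "0 \<in> interior (convex hull ((\<lambda>p. p /\<^sub>R r p) ` A))"
proof (rule ccontr)
  define K where "K = convex hull ((\<lambda>p. p /\<^sub>R r p) ` A)"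
  assume "0 \<notin> interior (convex hull ((\<lambda>p. p /\<^sub>R r p) ` A))"
  then have ni: "0 \<notin> interior K" by (simp add: K_def)
  have K: "convex K" "closed K"
    using finite_A by (auto simp: K_def finite_imp_compact_convex_hull compact_imp_closed)
  have "\<exists>y. y \<noteq> 0 \<and> (\<forall>x\<in>K. y \<bullet> x \<ge> 0)"
  proof (cases "0 \<in> K")
    case False
    then show ?thesis using separating_hyperplane_closed_0[OF K] by (meson less_imp_le less_trans)
  next
    case True
    show ?thesis
    proof (cases "dim K < DIM('a)")
      case True
      then obtain y where y: "y \<noteq> 0" "span K \<subseteq> {x. y \<bullet> x = 0}"
        using lowdim_subset_hyperplane[of K] by blast
      then have "y \<bullet> x = 0" if "x \<in> K" for x
        using that by (auto dest: span_base)
      then show ?thesis using y(1) by (intro exI[of _ y]) auto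
    next
      case False
      then have "dim K = DIM('a)" using dim_subset_UNIV[of K] by simp
      then have "aff_dim K = DIM('a)"
        using True by (simp add: aff_dim_zero hull_inc)
      then have "0 \<notin> rel_interior K" using ni by (simp add: interior_rel_interior_gen)
      from supporting_hyperplane_rel_boundary[OF K(1) True this]
      show ?thesis by (metis inner_zero_right)
    qed
  qed
  then obtain y where y: "y \<noteq> 0" "\<And>x. x \<in> K \<Longrightarrow> y \<bullet> x \<ge> 0" by blast
  obtain p where p: "p \<in> A" "y \<bullet> p < 0" using surround[OF y(1)] by auto
  then have "p /\<^sub>R r p \<in> K" by (auto simp: K_def hull_inc)
  then have "y \<bullet> (p /\<^sub>R r p) \<ge> 0" by (rule y(2))
  then show False using p r_pos[OF p(1)] by (simp add: zero_le_mult_iff)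
qed

text \<open>The ray through a vector leaves the hull of the points \<open>p / r p\<close> in a face; by genericity
  this face is a triangle.\<close>

lemma exists_tight_representation:
  assumes "x \<noteq> 0"
  obtains S c y where "S \<subseteq> A" "card S \<le> 3" "\<And>p. p \<in> S \<Longrightarrow> y \<bullet> p = r p" "\<And>p. p \<in> A \<Longrightarrow> y \<bullet> p \<le> r p"
    "\<And>p. p \<in> S \<Longrightarrow> c p \<ge> 0" "x = (\<Sum>p\<in>S. c p *\<^sub>R p)"
proof -
  define f where "f p = p /\<^sub>R r p" for p
  define Q where "Q = f ` A"
  define K where "K = convex hull Q"
  have Q: "finite Q" using finite_A by (simp add: Q_def)
  have K: "convex K" "compact K" "closed K"
    using Q by (auto simp: K_def finite_imp_compact_convex_hull compact_imp_closed)
  have int0: "0 \<in> interior K" using zero_interior_hull by (simp add: K_def Q_def f_def)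
  obtain d where d: "d > 0" "0 + d *\<^sub>R x \<in> frontier K"
    using ray_to_frontier[OF compact_imp_bounded[OF K(2)] int0 assms] by metis
  have ri: "rel_interior K = interior K" using int0 by (intro rel_interior_nonempty_interior) auto
  have dK: "d *\<^sub>R x \<in> K" "d *\<^sub>R x \<notin> rel_interior K"
    using d(2) K(3) by (auto simp: frontier_def ri)
  obtain a where a: "a \<noteq> 0" "\<And>z. z \<in> K \<Longrightarrow> a \<bullet> (d *\<^sub>R x) \<le> a \<bullet> z"
    "\<And>z. z \<in> rel_interior K \<Longrightarrow> a \<bullet> (d *\<^sub>R x) < a \<bullet> z"
    using supporting_hyperplane_rel_boundary[OF K(1) dK] by metis
  have neg: "a \<bullet> (d *\<^sub>R x) < 0" using a(3)[of 0] int0 ri by simp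
  \<comment> \<open>Rescaled to take the value 1 at the exit point. The original functional is
    negative there, so the scaling reverses the inequality into y . z <= 1 on the hull.\<close>
  define y where "y = (1 / (a \<bullet> (d *\<^sub>R x))) *\<^sub>R a"
  have yx: "y \<bullet> (d *\<^sub>R x) = 1" unfolding y_def inner_scaleR_left[of _ a]
    using less_imp_neq[OF neg] by (metis divide_self times_divide_eq_left mult_1)
  have yK: "y \<bullet> z \<le> 1" if "z \<in> K" for z
    using a(2)[OF that] neg unfolding y_def inner_scaleR_left by (simp add: divide_le_eq_1_neg)
  obtain u where u: "\<And>q. q \<in> Q \<Longrightarrow> u q \<ge> 0" "sum u Q = 1" "(\<Sum>q\<in>Q. u q *\<^sub>R q) = d *\<^sub>R x"
    using dK(1) convex_hull_finite[OF Q] unfolding K_def by blast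
  have yQ: "y \<bullet> q \<le> 1" if "q \<in> Q" for q using yK that by (simp add: K_def hull_inc)
  \<comment> \<open>Complementary slackness: the weighted sum of the nonnegative slacks is 0, so
    only points on the supporting plane carry weight.\<close>
  have "(\<Sum>q\<in>Q. u q * (1 - y \<bullet> q)) = sum u Q - y \<bullet> (\<Sum>q\<in>Q. u q *\<^sub>R q)"
    by (simp add: inner_sum_right sum_subtractf algebra_simps)
  also have "\<dots> = 0" using u yx by simp
  finally have "\<forall>q\<in>Q. u q * (1 - y \<bullet> q) = 0"
    using u(1) yQ by (subst (asm) sum_nonneg_eq_0_iff[OF Q]) auto
  then have u0: "u q = 0" if "q \<in> Q" "y \<bullet> q \<noteq> 1" for q using that by auto
  define T where "T = {q \<in> Q. y \<bullet> q = 1}"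
  \<comment> \<open>Two points of \<open>A\<close> on one ray may have the same quotient p / r p, so
    one preimage of each quotient is chosen.\<close>
  define g where "g = inv_into A f"
  have g: "g q \<in> A" "f (g q) = q" if "q \<in> Q" for q
    using that unfolding g_def Q_def by (auto simp: inv_into_into f_inv_into_f)
  have gr: "r (g q) > 0" "g q = r (g q) *\<^sub>R q" if "q \<in> Q" for q
  proof -
    show pos: "r (g q) > 0" using g[OF that] r_pos by blast
    have "r (g q) *\<^sub>R f (g q) = g q" using pos by (simp add: f_def)
    then show "g q = r (g q) *\<^sub>R q" using g(2)[OF that] by simp
  qed
  have inj: "inj_on g T" unfolding T_def using g by (intro inj_onI) (metis (no_types, lifting) mem_Collect_eq)
  have finT: "finite T" using Q by (simp add: T_def)
  have tight: "y \<bullet> g q = r (g q)" if "q \<in> T" for q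
  proof -
    have q: "q \<in> Q" "y \<bullet> q = 1" using that by (simp_all add: T_def)
    have "y \<bullet> g q = y \<bullet> (r (g q) *\<^sub>R q)"
      by (rule arg_cong[OF gr(2)[OF q(1)]])
    then show ?thesis using q(2) by simp
  qed
  have leA: "y \<bullet> p \<le> r p" if "p \<in> A" for p
  proof -
    have "y \<bullet> f p \<le> 1" using that yQ by (simp add: Q_def)
    then show ?thesis using r_pos[OF that] by (simp add: f_def field_simps)
  qed
  have gT: "g ` T \<subseteq> A" using g by (auto simp: T_def)
  have card: "card (g ` T) \<le> 3"
  proof (rule ccontr)
    assume "\<not> card (g ` T) \<le> 3"
    then obtain S where S: "S \<subseteq> g ` T" "card S = 4"
      using obtain_subset_with_card_n[of 4 "g ` T"] by auto
    then show False using generic[of S y] gT tight by blast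
  qed
  define c where "c p = u (f p) / (d * r p)" for p
  have "x = (1 / d) *\<^sub>R (\<Sum>q\<in>Q. u q *\<^sub>R q)" using u(3) d(1) by simp
  also have "(\<Sum>q\<in>Q. u q *\<^sub>R q) = (\<Sum>q\<in>T. u q *\<^sub>R q)"
    using u0 Q by (intro sum.mono_neutral_right) (auto simp: T_def)
  also have "(1 / d) *\<^sub>R \<dots> = (\<Sum>q\<in>T. c (g q) *\<^sub>R g q)"
    unfolding scaleR_sum_right
  proof (rule sum.cong[OF refl])
    fix q assume "q \<in> T"
    then have q: "q \<in> Q" by (simp add: T_def)
    have "c (g q) *\<^sub>R g q = (c (g q) * r (g q)) *\<^sub>R q" by (subst (2) gr(2)[OF q]) simp
    then show "(1 / d) *\<^sub>R u q *\<^sub>R q = c (g q) *\<^sub>R g q"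
      using gr(1)[OF q] by (simp add: c_def g[OF q])
  qed
  also have "\<dots> = (\<Sum>p\<in>g ` T. c p *\<^sub>R p)" using inj by (simp add: sum.reindex)
  finally have "x = (\<Sum>p\<in>g ` T. c p *\<^sub>R p)" .
  moreover have "c p \<ge> 0" if "p \<in> g ` T" for p
    using that d(1) u(1) gr(1) g(2) by (auto simp: c_def T_def less_imp_le)
  ultimately show thesis using that[of "g ` T" y c] gT card tight leA by blast
qed

lemma generic_not_parallel:
  assumes "generic_vec x" "p \<in> A"
  shows "x \<noteq> s *\<^sub>R p"
proof (cases "p = 0")
  case True
  have "b1 \<noteq> 0" using biorthogonal by auto
  obtain p1 where p1: "p1 \<in> A" "b1 \<bullet> p1 < 0" using surround[OF \<open>b1 \<noteq> 0\<close>] by auto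
  then have "p1 \<noteq> 0" by auto
  then obtain q where "q \<in> A" "cross p1 q \<noteq> 0" using not_all_parallel p1 by blast
  then have "det3 p1 q x \<noteq> 0" using assms p1 by (auto simp: generic_vec_def)
  then show ?thesis using True by (auto simp: det3_lin)
next
  case False
  then obtain q where "q \<in> A" "cross p q \<noteq> 0" using not_all_parallel assms by blast
  then have "det3 p q x \<noteq> 0" using assms by (auto simp: generic_vec_def)
  then show ?thesis by (auto simp: det3_lin)
qed

lemma generic_nonzero: "generic_vec x \<Longrightarrow> x \<noteq> 0"
proof -
  assume x: "generic_vec x"
  have "b1 \<noteq> 0" using biorthogonal by auto
  then obtain p where "p \<in> A" using surround by blast
  then show "x \<noteq> 0" using generic_not_parallel[OF x, of p 0] by simp
qed

definition in_cone :: "'a \<Rightarrow> 'a \<Rightarrow> 'a \<Rightarrow> 'a \<Rightarrow> bool" where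
  "in_cone a b c x \<longleftrightarrow> det3 x b c > 0 \<and> det3 a x c > 0 \<and> det3 a b x > 0"

text \<open>A generic x avoids every plane through the origin and two points of \<open>A\<close>, so
  three independent tight points with positive coefficients are needed. The sign of their
  determinant decides which order belongs to \<open>facets\<close>.\<close>

lemma exists_facet:
  assumes x: "generic_vec x"
  shows "\<exists>a b c. (a, b, c) \<in> facets \<and> in_cone a b c x"
proof -
  obtain S c y where S: "S \<subseteq> A" "card S \<le> 3" and tight: "\<And>p. p \<in> S \<Longrightarrow> y \<bullet> p = r p"
    and le: "\<And>p. p \<in> A \<Longrightarrow> y \<bullet> p \<le> r p" and c0: "\<And>p. p \<in> S \<Longrightarrow> c p \<ge> 0"
    and xs: "x = (\<Sum>p\<in>S. c p *\<^sub>R p)"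
    by (rule exists_tight_representation[OF generic_nonzero[OF x]]) (rule that)
  have np: "x \<noteq> s *\<^sub>R p" if "p \<in> A" for s p using generic_not_parallel[OF x that] .
  have finS: "finite S" using S finite_A finite_subset by blast
  have np2: "x \<noteq> s *\<^sub>R p + t *\<^sub>R q" if "p \<in> A" "q \<in> A" for p q s t
  proof (cases "p = 0 \<or> cross p q \<noteq> 0")
    case True
    then show ?thesis
    proof
      assume "p = 0"
      then show ?thesis using np[OF that(2)] by simp
    next
      assume "cross p q \<noteq> 0"
      then have "det3 p q x \<noteq> 0" using x that by (simp add: generic_vec_def)
      then show ?thesis by (auto simp: det3_lin)
    qed
  next
    case False
    then obtain k where "q = k *\<^sub>R p" using cross_zero_parallel by metis
    then show ?thesis using np[OF that(1), of "s + t * k"] by (simp add: scaleR_add_left)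
  qed
  consider "card S = 0" | "card S = 1" | "card S = 2" | "card S = 3" using S(2) by linarith
  then show ?thesis
  proof cases
    case 1
    then have "S = {}" using finS by simp
    then show ?thesis using xs generic_nonzero[OF x] by simp
  next
    case 2
    then obtain p where "S = {p}" by (rule card_1_singletonE)
    then show ?thesis using xs np[of p "c p"] S by auto
  next
    case 3
    then obtain p q where "S = {p, q}" "p \<noteq> q" by (auto simp: card_2_iff)
    then show ?thesis using xs np2[of p q "c p" "c q"] S by auto
  next
    case 4
    then obtain u v w where uvw: "S = {u, v, w}" "u \<noteq> v" "v \<noteq> w" "u \<noteq> w" by (auto simp: card_3_iff)
    have A: "u \<in> A" "v \<in> A" "w \<in> A" using S uvw by auto
    have xe: "x = c u *\<^sub>R u + c v *\<^sub>R v + c w *\<^sub>R w" using xs uvw by (simp add: add.assoc)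
    have cpos: "c u > 0" "c v > 0" "c w > 0"
    proof -
      have "c u \<noteq> 0" using xe np2[of v w "c v" "c w"] A by auto
      moreover have "c v \<noteq> 0" using xe np2[of u w "c u" "c w"] A by auto
      moreover have "c w \<noteq> 0" using xe np2[of u v "c u" "c v"] A by auto
      ultimately show "c u > 0" "c v > 0" "c w > 0" using c0[of u] c0[of v] c0[of w] uvw by simp_all
    qed
    have dn: "det3 u v w \<noteq> 0"
    proof
      assume d: "det3 u v w = 0"
      have d': "det3 u w v = 0" using d by (simp add: det3_coords algebra_simps)
      have "u \<noteq> 0" using tight[of u] uvw r_pos[OF A(1)] by auto
      have "det3 u v x = 0" "det3 u w x = 0" by (simp_all add: xe det3_lin d d')
      then have "cross u v = 0" "cross u w = 0" using x A by (auto simp: generic_vec_def)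
      then obtain s t where "v = s *\<^sub>R u" "w = t *\<^sub>R u" using cross_zero_parallel[OF _ \<open>u \<noteq> 0\<close>] by metis
      then have "x = (c u + c v * s + c w * t) *\<^sub>R u" using xe by (simp add: scaleR_add_left)
      then show False using np[OF A(1)] by blast
    qed
    have dets: "det3 x v w = c u * det3 u v w" "det3 u x w = c v * det3 u v w" "det3 u v x = c w * det3 u v w"
      by (simp_all add: xe det3_lin)
    show ?thesis
    proof (cases "det3 u v w > 0")
      case True
      have "(u, v, w) \<in> facets"
        using A True tight uvw le by (intro facetsI[of _ _ _ y]) auto
      moreover have "in_cone u v w x" using True cpos by (simp add: in_cone_def dets)
      ultimately show ?thesis by blast
    next
      case False
      then have neg: "det3 u v w < 0" using dn by simp
      have sw: "det3 v u w = - det3 u v w" "det3 x u w = - det3 u x w" "det3 v x w = - det3 x v w" "det3 v u x = - det3 u v x"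
        by (simp_all add: det3_coords algebra_simps)
      have "(v, u, w) \<in> facets"
        using A neg tight uvw le sw by (intro facetsI[of _ _ _ y]) auto
      moreover have "in_cone v u w x"
        using neg cpos by (simp add: in_cone_def sw dets mult_pos_neg)
      ultimately show ?thesis by blast
    qed
  qed
qed

text \<open>Evaluate both supporting functionals at x. Each is exact on its own triangle and at most
  \<open>r\<close> on the other one, so the values agree and every vertex with positive coefficient
  is tight for both. This is the fan property: two cones meet in a common face.\<close>

lemma facet_cone_unique:
  assumes abc: "(a, b, c) \<in> facets" and abc': "(a', b', c') \<in> facets"
    and x: "x = u *\<^sub>R a + v *\<^sub>R b + w *\<^sub>R c" "u \<ge> 0" "v \<ge> 0" "w \<ge> 0"
    and x': "x = u' *\<^sub>R a' + v' *\<^sub>R b' + w' *\<^sub>R c'" "u' \<ge> 0" "v' \<ge> 0" "w' \<ge> 0"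
  shows "u > 0 \<longrightarrow> a \<in> {a', b', c'}" "v > 0 \<longrightarrow> b \<in> {a', b', c'}" "w > 0 \<longrightarrow> c \<in> {a', b', c'}"
proof -
  define y y' where "y = supp a b c" and "y' = supp a' b' c'"
  note D = facetsD[OF abc] and D' = facetsD[OF abc']
  have "y \<bullet> x = u * r a + v * r b + w * r c"
    using D by (simp add: x(1) inner_add_right y_def)
  moreover have "y \<bullet> x \<le> u' * r a' + v' * r b' + w' * r c'"
    unfolding x'(1) inner_add_right inner_scaleR_right y_def
    using D(8) D'(1-3) x' by (intro add_mono mult_left_mono) auto
  moreover have "y' \<bullet> x = u' * r a' + v' * r b' + w' * r c'"
    using D' by (simp add: x'(1) inner_add_right y'_def)
  ultimately have "u * r a + v * r b + w * r c \<le> u * (y' \<bullet> a) + v * (y' \<bullet> b) + w * (y' \<bullet> c)"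
    by (simp add: x(1) inner_add_right)
  moreover have le: "y' \<bullet> a \<le> r a" "y' \<bullet> b \<le> r b" "y' \<bullet> c \<le> r c"
    using D'(8) D(1-3) by (auto simp: y'_def)
  then have "u * (r a - y' \<bullet> a) \<ge> 0" "v * (r b - y' \<bullet> b) \<ge> 0" "w * (r c - y' \<bullet> c) \<ge> 0"
    using x by simp_all
  ultimately have "u * (r a - y' \<bullet> a) = 0 \<and> v * (r b - y' \<bullet> b) = 0 \<and> w * (r c - y' \<bullet> c) = 0"
    unfolding right_diff_distrib by linarith
  then show "u > 0 \<longrightarrow> a \<in> {a', b', c'}" "v > 0 \<longrightarrow> b \<in> {a', b', c'}" "w > 0 \<longrightarrow> c \<in> {a', b', c'}"
    using facets_tight[OF abc' D(1)] facets_tight[OF abc' D(2)] facets_tight[OF abc' D(3)]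
    unfolding y'_def by (metis eq_iff_diff_eq_0 mult_eq_0_iff less_irrefl)+
qed

lemma in_cone_coords:
  assumes "(a, b, c) \<in> facets" "in_cone a b c x"
  obtains u v w where "x = u *\<^sub>R a + v *\<^sub>R b + w *\<^sub>R c" "u > 0" "v > 0" "w > 0"
  using coords_of[of a b c x] facetsD(4)[OF assms(1)] assms(2)
  by (intro that[of "det3 x b c / det3 a b c" "det3 a x c / det3 a b c" "det3 a b x / det3 a b c"])
     (auto simp: in_cone_def)

lemma in_cone_same:
  assumes "(a, b, c) \<in> facets" "in_cone a b c x" "(a', b', c') \<in> facets" "in_cone a' b' c' x"
  shows "{a', b', c'} = {a, b, c}"
proof -
  obtain u v w where 1: "x = u *\<^sub>R a + v *\<^sub>R b + w *\<^sub>R c" "u > 0" "v > 0" "w > 0"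
    using in_cone_coords[OF assms(1,2)] .
  obtain u' v' w' where 2: "x = u' *\<^sub>R a' + v' *\<^sub>R b' + w' *\<^sub>R c'" "u' > 0" "v' > 0" "w' > 0"
    using in_cone_coords[OF assms(3,4)] .
  have "{a, b, c} \<subseteq> {a', b', c'}" "{a', b', c'} \<subseteq> {a, b, c}"
    using facet_cone_unique[OF assms(1,3) 1(1) _ _ _ 2(1)] facet_cone_unique[OF assms(3,1) 2(1) _ _ _ 1(1)] 1 2
    by (simp_all add: less_imp_le)
  then show ?thesis by blast
qed

lemma facets_same_set:
  assumes "(a, b, c) \<in> facets" "(a', b', c') \<in> facets" "{a', b', c'} = {a, b, c}"
  shows "(a', b', c') \<in> {(a, b, c), (b, c, a), (c, a, b)}"
proof -
  have perms: "det3 a c b = - det3 a b c" "det3 c b a = - det3 a b c" "det3 b a c = - det3 a b c"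
    by (simp_all add: det3_coords algebra_simps)
  have d: "det3 a' b' c' > 0" "det3 a b c > 0" using facetsD(4) assms by auto
  have "a' \<in> {a, b, c}" "b' \<in> {a, b, c}" "c' \<in> {a, b, c}" using assms(3) by blast+
  then show ?thesis using d perms by auto
qed

lemma card_facets_perm:
  assumes "(a, b, c) \<in> facets"
  shows "card {(a, b, c), (b, c, a), (c, a, b)} = 3"
  using facets_distinct[OF assms] by auto

lemma sum_in_cone:
  assumes x: "generic_vec x"
  shows "(\<Sum>(a, b, c)\<in>facets. of_bool (in_cone a b c x)) = (3 :: real)"
proof -
  obtain a b c where abc: "(a, b, c) \<in> facets" "in_cone a b c x" using exists_facet[OF x] by blast
  have rot: "in_cone b c a x" if "in_cone a b c x" for a b c
    using that det3_rotate[of x b c] det3_rotate[of b c x] det3_rotate[of a x c] det3_rotate[of x c a] det3_rotate[of a b x] det3_rotate[of b x a]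
    by (simp add: in_cone_def)
  have "{t \<in> facets. case t of (a', b', c') \<Rightarrow> in_cone a' b' c' x} = {(a, b, c), (b, c, a), (c, a, b)}"
  proof
    show "{t \<in> facets. case t of (a', b', c') \<Rightarrow> in_cone a' b' c' x} \<subseteq> {(a, b, c), (b, c, a), (c, a, b)}"
      using in_cone_same[OF abc] facets_same_set[OF abc(1)] by blast
    show "{(a, b, c), (b, c, a), (c, a, b)} \<subseteq> {t \<in> facets. case t of (a', b', c') \<Rightarrow> in_cone a' b' c' x}"
      using abc facets_rotate[OF abc(1)] facets_rotate[OF facets_rotate[OF abc(1)]] rot[OF abc(2)] rot[OF rot[OF abc(2)]] by auto
  qed
  then have "real (card {t \<in> facets. case t of (a', b', c') \<Rightarrow> in_cone a' b' c' x}) = 3"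
    using card_facets_perm[OF abc(1)] by simp
  moreover have "(\<Sum>(a, b, c)\<in>facets. of_bool (in_cone a b c x)) = (\<Sum>t\<in>{t \<in> facets. case t of (a', b', c') \<Rightarrow> in_cone a' b' c' x}. 1 :: real)"
    using finite_facets by (subst sum.inter_filter) (auto simp: case_prod_unfold of_bool_def intro!: sum.cong)
  ultimately show ?thesis by simp
qed

end

section \<open>The signed count of dual lattice points\<close>

lemma has_sum_sum:
  fixes f :: "'i \<Rightarrow> 'b \<Rightarrow> real"
  assumes "finite I" "\<And>i. i \<in> I \<Longrightarrow> (f i has_sum s i) A"
  shows "((\<lambda>x. \<Sum>i\<in>I. f i x) has_sum (\<Sum>i\<in>I. s i)) A"
  using assms by (induction I rule: finite_induct) (auto intro: has_sum_add)

text \<open>Signed crossing of the segment from a point to another with the ray in direction \<open>h\<close>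
  in the quotient by \<open>x\<close>.  The arguments are the determinants of \<open>x\<close> with \<open>h\<close> and the two
  points, and of \<open>x\<close> with the two points.\<close>

definition crossing :: "real \<Rightarrow> real \<Rightarrow> real \<Rightarrow> real" where
  "crossing u v w = (if u < 0 \<and> v > 0 \<and> w > 0 then 1 else if v < 0 \<and> u > 0 \<and> w < 0 then - 1 else 0)"

lemma crossing_swap: "crossing v u (- w) = - crossing u v w"
  by (auto simp: crossing_def)

text \<open>The signed number of crossings of a closed triangle with a ray is its winding number
  about the origin. The Pluecker relation between the ray and the three vertices excludes the sign
  patterns that no plane configuration realizes; a finite check remains.\<close>

lemma crossing_triangle:
  assumes "u \<noteq> 0" "v \<noteq> 0" "w \<noteq> 0" "x \<noteq> 0" "y \<noteq> 0" "z \<noteq> 0"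
    and plucker: "u * x + v * y + w * z = 0"
  shows "crossing u v z + crossing v w x + crossing w u y
     = (if x > 0 \<and> y > 0 \<and> z > 0 then 1 else if x < 0 \<and> y < 0 \<and> z < 0 then - 1 else 0)"
proof -
  have "\<not> (u * x > 0 \<and> v * y > 0 \<and> w * z > 0)" "\<not> (u * x < 0 \<and> v * y < 0 \<and> w * z < 0)"
    using plucker by linarith+
  then show ?thesis
    using assms(1-6) unfolding zero_less_mult_iff mult_less_0_iff crossing_def
    by (cases "u > 0"; cases "v > 0"; cases "w > 0"; cases "x > 0"; cases "y > 0"; cases "z > 0")
       (auto simp: not_less le_less)
qed

context weighted_fan
begin

text \<open>The sign with which m enters the series of a cone. The floor only supplies the integer
  that \<open>flip\<close> expects and does not change its sign test, so the identities below hold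
  for every vector m, integral or not.\<close>

definition kappa :: "'a \<Rightarrow> 'a \<Rightarrow> 'a \<Rightarrow> 'a \<Rightarrow> 'a \<Rightarrow> real" where
  "kappa x m a b c = flip (det3 x b c) \<lfloor>m \<bullet> a\<rfloor> * flip (det3 a x c) \<lfloor>m \<bullet> b\<rfloor> * flip (det3 a b x) \<lfloor>m \<bullet> c\<rfloor>"

lemma flip_floor: "flip x \<lfloor>s\<rfloor> = (if x > 0 \<and> s \<ge> 0 then 1 else if x < 0 \<and> s < 0 then - 1 else 0)"
  by (simp add: flip_def)

lemma inner_coords:
  assumes "det3 a b c > 0"
  shows "det3 a b c * (m \<bullet> x) = det3 x b c * (m \<bullet> a) + det3 a x c * (m \<bullet> b) + det3 a b x * (m \<bullet> c)"
proof -
  have "det3 a b c * (m \<bullet> x) = m \<bullet> (det3 a b c *\<^sub>R x)" by simp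
  then show ?thesis unfolding cramer[of a b c x] by (simp add: inner_add_right)
qed

text \<open>Where \<open>kappa\<close> is nonzero, each coordinate of x and the value of m on the
  same generator have compatible signs, so m . x is, up to a positive factor, a sum of nonnegative
  terms.\<close>

lemma kappa_neg:
  assumes "det3 a b c > 0" "m \<bullet> x < 0"
  shows "kappa x m a b c = 0"
proof (rule ccontr)
  assume "kappa x m a b c \<noteq> 0"
  then have "flip (det3 x b c) \<lfloor>m \<bullet> a\<rfloor> \<noteq> 0" "flip (det3 a x c) \<lfloor>m \<bullet> b\<rfloor> \<noteq> 0" "flip (det3 a b x) \<lfloor>m \<bullet> c\<rfloor> \<noteq> 0"
    by (auto simp: kappa_def)
  then have "det3 x b c * (m \<bullet> a) \<ge> 0" "det3 a x c * (m \<bullet> b) \<ge> 0" "det3 a b x * (m \<bullet> c) \<ge> 0"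
    by (auto simp: flip_floor zero_le_mult_iff split: if_splits)
  then show False
    using inner_coords[OF assms(1), of m x] mult_pos_neg[OF assms] by linarith
qed

lemma facet_generic:
  assumes "(a, b, c) \<in> facets" "generic_vec x"
  shows "det3 x b c \<noteq> 0" "det3 a x c \<noteq> 0" "det3 a b x \<noteq> 0"
proof -
  have d: "det3 a b c \<noteq> 0" "det3 b c a \<noteq> 0" "det3 c a b \<noteq> 0"
    using facetsD(4)[OF assms(1)] det3_rotate[of a b c] det3_rotate[of b c a] by simp_all
  have "det3 a b x \<noteq> 0" "det3 b c x \<noteq> 0" "det3 c a x \<noteq> 0"
    using assms(2) facetsD(1-3)[OF assms(1)] d[THEN cross_nonzero] by (auto simp: generic_vec_def)
  then show "det3 x b c \<noteq> 0" "det3 a x c \<noteq> 0" "det3 a b x \<noteq> 0"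
    using det3_rotate[of x b c] det3_rotate[of a x c] det3_rotate[of x c a] by simp_all
qed

text \<open>Gives 0 the sign 1, in accordance with the condition c >= 0 in
  \<open>flip\<close>.\<close>

definition sgn0 :: "real \<Rightarrow> real" where "sgn0 s = (if s \<ge> 0 then 1 else - 1)"

lemma exists_ray:
  assumes x: "generic_vec x"
  obtains h where "\<And>p. p \<in> A \<Longrightarrow> p \<noteq> 0 \<Longrightarrow> det3 x h p \<noteq> 0"
proof -
  define H where "H = (\<Union>p\<in>A - {0}. {h. cross p x \<bullet> h = 0})"
  have "cross p x \<noteq> 0" if p: "p \<in> A" "p \<noteq> 0" for p
  proof
    assume "cross p x = 0"
    then obtain s where "x = s *\<^sub>R p" using cross_zero_parallel p by metis
    then show False using generic_not_parallel[OF x p(1)] by simp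
  qed
  then have "negligible H"
    unfolding H_def using finite_A by (intro negligible_Union finite_imageI) (auto intro: negligible_hyperplane)
  then have "H \<noteq> UNIV" using non_negligible_UNIV by metis
  then obtain h where h: "h \<notin> H" by auto
  have "det3 x h p \<noteq> 0" if "p \<in> A" "p \<noteq> 0" for p
    using h that det3_rotate[of p x h] by (auto simp: H_def det3_def)
  then show thesis using that by blast
qed

text \<open>Replacing each point by its negative when \<open>m\<close> is negative on it turns \<open>kappa\<close> into the
  winding number of a triangle around the origin of the quotient by \<open>x\<close>.\<close>

lemma sum_kappa:
  assumes x: "generic_vec x"
  shows "(\<Sum>(a, b, c)\<in>facets. kappa x m a b c) = (if m = 0 then 3 else 0)"
proof -
  \<comment> \<open>The case m . x < 0 is split off because the reflection argument uses m . x >= 0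
    to exclude triangles on which all three signs are reversed.\<close>
  consider "m = 0" | "m \<bullet> x < 0" "m \<noteq> 0" | "m \<bullet> x \<ge> 0" "m \<noteq> 0" by linarith
  then show ?thesis
  proof cases
    case 1
    have "kappa x m a b c = of_bool (in_cone a b c x)" if "(a, b, c) \<in> facets" for a b c
      using 1 by (auto simp: kappa_def flip_def in_cone_def)
    then have "(\<Sum>(a, b, c)\<in>facets. kappa x m a b c) = (\<Sum>(a, b, c)\<in>facets. of_bool (in_cone a b c x))"
      by (intro sum.cong) auto
    then show ?thesis using 1 sum_in_cone[OF x] by simp
  next
    case 2
    then have "(\<Sum>(a, b, c)\<in>facets. kappa x m a b c) = 0"
      using kappa_neg facetsD(4) by (intro sum.neutral) auto
    then show ?thesis using 2 by simp
  next
    case 3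
    obtain h where h: "\<And>p. p \<in> A \<Longrightarrow> p \<noteq> 0 \<Longrightarrow> det3 x h p \<noteq> 0"
      using exists_ray[OF x] by blast
    define s where "s p = sgn0 (m \<bullet> p)" for p
    define g where "g a b = crossing (s a * det3 x h a) (s b * det3 x h b) (s a * s b * det3 x a b)" for a b
    have "g b a = - g a b" for a b
    proof -
      have "s b * s a * det3 x b a = - (s a * s b * det3 x a b)"
        by (simp add: det3_coords algebra_simps)
      then show ?thesis unfolding g_def by (metis crossing_swap)
    qed
    then have g0: "(\<Sum>(a, b, c)\<in>facets. g a b + g b c + g c a) = 0" by (rule sum_facets_antisym)
    have gk: "g a b + g b c + g c a = kappa x m a b c" if f: "(a, b, c) \<in> facets" for a b c
    proof -
      note D = facetsD[OF f]
      have ne: "a \<noteq> 0" "b \<noteq> 0" "c \<noteq> 0" using D(4) by (auto simp: det3_lin)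
      have s1: "s p = 1 \<or> s p = - 1" for p by (simp add: s_def sgn0_def)
      have s0: "s p \<noteq> 0" for p using s1[of p] by auto
      define X Y Z where "X = det3 x b c" and "Y = det3 a x c" and "Z = det3 a b x"
      have XYZ: "X \<noteq> 0" "Y \<noteq> 0" "Z \<noteq> 0" using facet_generic[OF f x] by (simp_all add: X_def Y_def Z_def)
      have dd: "det3 x b c = X" "det3 x c a = Y" "det3 x a b = Z"
        using det3_rotate[of a x c] det3_rotate[of x a b] det3_rotate[of a b x] by (simp_all add: X_def Y_def Z_def)
      have ss: "s p * s p = 1" for p using s1[of p] by auto
      have pl: "s a * det3 x h a * (s b * s c * X) + s b * det3 x h b * (s c * s a * Y) + s c * det3 x h c * (s a * s b * Z) = 0"
      proof -
        have "det3 x h a * det3 x b c + det3 x h b * det3 x c a + det3 x h c * det3 x a b = 0"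
          by (simp add: det3_coords algebra_simps)
        then have "s a * s b * s c * (det3 x h a * X + det3 x h b * Y + det3 x h c * Z) = 0"
          by (simp add: dd)
        then show ?thesis by (simp add: algebra_simps)
      qed
      have W: "g a b + g b c + g c a =
        (if s b * s c * X > 0 \<and> s c * s a * Y > 0 \<and> s a * s b * Z > 0 then 1
         else if s b * s c * X < 0 \<and> s c * s a * Y < 0 \<and> s a * s b * Z < 0 then - 1 else 0)"
        unfolding g_def dd using s0 XYZ h D(1-3) ne by (intro crossing_triangle pl) auto
      \<comment> \<open>Were all three terms of m . x nonpositive, they would be 0 and so would m.
        This removes the pattern in which the reflected triangle winds around the origin while
        \<open>kappa\<close> is 0.\<close>
      have nn: "\<not> (X * (m \<bullet> a) \<le> 0 \<and> Y * (m \<bullet> b) \<le> 0 \<and> Z * (m \<bullet> c) \<le> 0)"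
      proof
        assume le: "X * (m \<bullet> a) \<le> 0 \<and> Y * (m \<bullet> b) \<le> 0 \<and> Z * (m \<bullet> c) \<le> 0"
        have "det3 a b c * (m \<bullet> x) \<ge> 0" using D(4) 3 by simp
        then have "X * (m \<bullet> a) = 0" "Y * (m \<bullet> b) = 0" "Z * (m \<bullet> c) = 0"
          using le inner_coords[OF D(4), of m x] unfolding X_def Y_def Z_def by linarith+
        then have "m \<bullet> a = 0" "m \<bullet> b = 0" "m \<bullet> c = 0" using XYZ by simp_all
        then have "m = 0" using D(4) by (intro dual_eqI3[of a b c]) auto
        then show False using 3 by simp
      qed
      \<comment> \<open>Reflecting the vertices multiplies the three areas by products of two signs.
        Factoring out the total sign P leaves s a X, s b Y, s c Z, from which \<open>kappa\<close>
        and the winding number can both be read off.\<close>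
      define P where "P = s a * s b * s c"
      have P: "P = 1 \<or> P = - 1" using s1[of a] s1[of b] s1[of c] by (auto simp: P_def)
      have fl: "flip d \<lfloor>m \<bullet> p\<rfloor> = (if s p * d > 0 then s p else 0)" if "d \<noteq> 0" for d p
        using that by (auto simp: flip_floor s_def sgn0_def)
      define U V W' where "U = s a * X" and "V = s b * Y" and "W' = s c * Z"
      have k: "kappa x m a b c = (if U > 0 \<and> V > 0 \<and> W' > 0 then P else 0)"
        unfolding kappa_def X_def[symmetric] Y_def[symmetric] Z_def[symmetric] fl[OF XYZ(1)] fl[OF XYZ(2)] fl[OF XYZ(3)]
          P_def U_def V_def W'_def by simp
      have not_neg: "\<not> (U < 0 \<and> V < 0 \<and> W' < 0)"
      proof -
        have "d * (m \<bullet> p) \<le> 0" if "s p * d < 0" for d p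
          using that by (auto simp: s_def sgn0_def mult_le_0_iff split: if_splits)
        then show ?thesis using nn unfolding U_def V_def W'_def by blast
      qed
      have eqs: "s b * s c * X = P * U" "s c * s a * Y = P * V" "s a * s b * Z = P * W'"
        using ss[of a] ss[of b] ss[of c] by (simp_all add: P_def U_def V_def W'_def algebra_simps)
      have "kappa x m a b c = (if P * U > 0 \<and> P * V > 0 \<and> P * W' > 0 then 1
         else if P * U < 0 \<and> P * V < 0 \<and> P * W' < 0 then - 1 else 0)"
        unfolding k using P not_neg by (elim disjE) simp_all
      then have "kappa x m a b c = (if s b * s c * X > 0 \<and> s c * s a * Y > 0 \<and> s a * s b * Z > 0 then 1
         else if s b * s c * X < 0 \<and> s c * s a * Y < 0 \<and> s a * s b * Z < 0 then - 1 else 0)"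
        unfolding eqs .
      then show ?thesis using W by simp
    qed
    have "(\<Sum>(a, b, c)\<in>facets. kappa x m a b c) = (\<Sum>(a, b, c)\<in>facets. g a b + g b c + g c a)"
      by (rule sum.cong[OF refl], clarify, rule gk[symmetric])
    then have "(\<Sum>(a, b, c)\<in>facets. kappa x m a b c) = 0"
      using g0 by simp
    then show ?thesis using 3 by simp
  qed
qed

end

section \<open>Summation of the contributions of all cones\<close>

locale empty_fan = weighted_fan +
  assumes A_latt: "A \<subseteq> latt"
    and facets_empty: "\<And>a b c. (a, b, c) \<in> facets \<Longrightarrow> empty_simplex a b c"
begin

text \<open>Evaluation at a, b, c maps the dual lattice bijectively onto the triples with k = p i +
  q j modulo n, because integrality on e, where n e = c - p a - q b, is exactly this congruence. The
  series thereby becomes \<open>cone_sum\<close>.\<close>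

lemma facet_contribution:
  assumes f: "(a, b, c) \<in> facets" and x: "generic_vec x"
  defines "u \<equiv> det3 x b c / det3 a b c" and "v \<equiv> det3 a x c / det3 a b c" and "w \<equiv> det3 a b x / det3 a b c"
  shows "\<exists>S P. (\<forall>t>0. ((\<lambda>m. kappa x m a b c * exp (- t * (m \<bullet> x))) has_sum S t) (dual_lattice latt)) \<and>
     cubic_approx (\<lambda>t. t ^ 3 * S t) P \<and>
     coeff P 3 = ((u + v + w) * (1 / u + 1 / v + 1 / w) / det3 a b c + det3 a b c - 1 / det3 a b c) / 24"
proof -
  note D = facetsD[OF f]
  have l: "a \<in> latt" "b \<in> latt" "c \<in> latt" using D A_latt by auto
  obtain n where n: "det3 a b c = of_int n" using det3_Ints[OF l] by (auto elim: Ints_cases)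
  then have n0: "n > 0" using D(4) by simp
  obtain p q e where tw: "terminal_weights n p q" and e: "e \<in> latt" "of_int n *\<^sub>R e = c - of_int p *\<^sub>R a - of_int q *\<^sub>R b"
    and rep: "\<And>y. y \<in> latt \<Longrightarrow> \<exists>i j k :: int. y = of_int i *\<^sub>R a + of_int j *\<^sub>R b + of_int k *\<^sub>R e"
    using empty_simplex_weights[OF facets_empty[OF f] l n n0] by metis
  interpret terminal_weights n p q by fact
  have uvw: "u \<noteq> 0" "v \<noteq> 0" "w \<noteq> 0" using facet_generic[OF f x] D(4) by (simp_all add: u_def v_def w_def)
  define C where "C = {(i, j, k). k mod n = (p * i + q * j) mod n}"
  define \<phi> where "\<phi> m = (\<lfloor>m \<bullet> a\<rfloor>, \<lfloor>m \<bullet> b\<rfloor>, \<lfloor>m \<bullet> c\<rfloor>)" for m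
  have val: "real_of_int \<lfloor>m \<bullet> y\<rfloor> = m \<bullet> y" if "m \<in> dual_lattice latt" "y \<in> latt" for m y
    using that by (auto simp: dual_lattice_def)
  have bij: "bij_betw \<phi> (dual_lattice latt) C"
    unfolding bij_betw_def
  proof
    show "inj_on \<phi> (dual_lattice latt)"
    proof (rule inj_onI)
      fix m m' assume m: "m \<in> dual_lattice latt" "m' \<in> dual_lattice latt" "\<phi> m = \<phi> m'"
      then have "m \<bullet> a = m' \<bullet> a" "m \<bullet> b = m' \<bullet> b" "m \<bullet> c = m' \<bullet> c"
        using val l unfolding \<phi>_def by (metis Pair_inject)+
      then show "m = m'" using D(4) by (intro dual_eqI3[of a b c]) auto
    qed
    show "\<phi> ` dual_lattice latt = C"
    proof (intro equalityI subsetI)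
      fix z assume "z \<in> \<phi> ` dual_lattice latt"
      then obtain m where m: "m \<in> dual_lattice latt" "z = \<phi> m" by auto
      have "m \<bullet> c = m \<bullet> (of_int n *\<^sub>R e + of_int p *\<^sub>R a + of_int q *\<^sub>R b)" unfolding e(2) by simp
      also have "\<dots> = of_int n * (m \<bullet> e) + of_int p * (m \<bullet> a) + of_int q * (m \<bullet> b)"
        by (simp add: inner_add_right)
      finally have mc: "m \<bullet> c = of_int n * (m \<bullet> e) + of_int p * (m \<bullet> a) + of_int q * (m \<bullet> b)" .
      have "real_of_int \<lfloor>m \<bullet> c\<rfloor> = of_int (n * \<lfloor>m \<bullet> e\<rfloor> + p * \<lfloor>m \<bullet> a\<rfloor> + q * \<lfloor>m \<bullet> b\<rfloor>)"
        unfolding of_int_add of_int_mult val[OF m(1) e(1)] val[OF m(1) l(1)] val[OF m(1) l(2)] val[OF m(1) l(3)]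
        by (rule mc)
      then have "\<lfloor>m \<bullet> c\<rfloor> = n * \<lfloor>m \<bullet> e\<rfloor> + (p * \<lfloor>m \<bullet> a\<rfloor> + q * \<lfloor>m \<bullet> b\<rfloor>)" by linarith
      then have "\<lfloor>m \<bullet> c\<rfloor> mod n = (p * \<lfloor>m \<bullet> a\<rfloor> + q * \<lfloor>m \<bullet> b\<rfloor>) mod n" by simp
      then show "z \<in> C" by (simp add: m(2) \<phi>_def C_def)
    next
      fix z assume "z \<in> C"
      then obtain i j k where z: "z = (i, j, k)" "k mod n = (p * i + q * j) mod n" by (auto simp: C_def)
      then obtain k' where k': "k = p * i + q * j + n * k'" by (metis mod_eqE mult.commute)
      define m where "m = dual_fun a b c (of_int i) (of_int j) (of_int k)"
      have mv: "m \<bullet> a = of_int i" "m \<bullet> b = of_int j" "m \<bullet> c = of_int k"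
        using D(4) by (simp_all add: m_def dual_fun_inner)
      have "of_int n * (m \<bullet> e) = m \<bullet> (c - of_int p *\<^sub>R a - of_int q *\<^sub>R b)"
        unfolding e(2)[symmetric] by simp
      also have "\<dots> = of_int n * of_int k'" by (simp add: inner_diff_right mv k')
      finally have me: "m \<bullet> e = of_int k'" using n0 by simp
      have "m \<in> dual_lattice latt"
        unfolding dual_lattice_def
      proof (intro CollectI ballI)
        fix y assume "y \<in> latt"
        then obtain i' j' k'' :: int where "y = of_int i' *\<^sub>R a + of_int j' *\<^sub>R b + of_int k'' *\<^sub>R e" using rep by metis
        then show "m \<bullet> y \<in> \<int>" by (simp add: inner_add_right mv me)
      qed
      moreover have "\<phi> m = z" by (simp add: \<phi>_def mv z)
      ultimately show "z \<in> \<phi> ` dual_lattice latt" by blast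
    qed
  qed
  define S where "S t = cone_sum n p q u v w t" for t
  have "((\<lambda>m. kappa x m a b c * exp (- t * (m \<bullet> x))) has_sum S t) (dual_lattice latt)" if t: "t > 0" for t
  proof -
    have "((\<lambda>(i, j, k). cone_term t u v w i j k) has_sum S t) C"
      unfolding S_def C_def using has_sum_cone[OF uvw t n0] .
    then have "((\<lambda>m. (\<lambda>(i, j, k). cone_term t u v w i j k) (\<phi> m)) has_sum S t) (dual_lattice latt)"
      by (subst has_sum_reindex_bij_betw[OF bij])
    moreover have "(\<lambda>(i, j, k). cone_term t u v w i j k) (\<phi> m) = kappa x m a b c * exp (- t * (m \<bullet> x))"
      if m: "m \<in> dual_lattice latt" for m
    proof -
      have fl: "flip (d / det3 a b c) i = flip d i" for d i
        using D(4) by (simp add: flip_def zero_less_divide_iff divide_less_0_iff)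
      have "m \<bullet> x = (m \<bullet> a) * u + (m \<bullet> b) * v + (m \<bullet> c) * w"
        using inner_coords[OF D(4), of m x] D(4) by (simp add: u_def v_def w_def field_simps)
      then show ?thesis
        by (simp add: \<phi>_def cone_term_def kappa_def val[OF m] l u_def[symmetric] v_def[symmetric] w_def[symmetric])
           (simp add: u_def v_def w_def fl)
    qed
    ultimately show ?thesis by (simp cong: has_sum_cong)
  qed
  moreover obtain P where "cubic_approx (\<lambda>t. t ^ 3 * S t) P"
    "coeff P 3 = ((u + v + w) * (1 / u + 1 / v + 1 / w) / n + n - 1 / n) / 24"
    using cone_sum_approx[OF uvw] unfolding S_def by blast
  ultimately show ?thesis unfolding n by blast
qed

text \<open>For every t > 0 only m = 0 survives in the total, which is 3. Comparing coefficients of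
  t^3, after multiplication by t^3 to clear the pole, equates 3 with a 24th of the sum.\<close>

lemma sum_contributions:
  assumes x: "generic_vec x"
  shows "(\<Sum>(a, b, c)\<in>facets. (det3 x b c + det3 a x c + det3 a b x) *
     (1 / det3 x b c + 1 / det3 a x c + 1 / det3 a b x) / det3 a b c + det3 a b c - 1 / det3 a b c) = 72"
proof -
  define Q where "Q T = (case T of (a, b, c) \<Rightarrow> (det3 x b c + det3 a x c + det3 a b x) *
     (1 / det3 x b c + 1 / det3 a x c + 1 / det3 a b x) / det3 a b c + det3 a b c - 1 / det3 a b c)" for T
  have ex: "\<exists>S P. (\<forall>t>0. ((\<lambda>m. (case T of (a, b, c) \<Rightarrow> kappa x m a b c) * exp (- t * (m \<bullet> x))) has_sum S t) (dual_lattice latt)) \<and>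
     cubic_approx (\<lambda>t. t ^ 3 * S t) P \<and> coeff P 3 = Q T / 24" if T: "T \<in> facets" for T
  proof -
    obtain a b c where abc: "T = (a, b, c)" by (cases T)
    define N where "N = det3 a b c"
    have N: "N \<noteq> 0" using facetsD(4) T abc by (force simp: N_def)
    \<comment> \<open>The product of the two sums is homogeneous of degree 0, so bare determinants
      may stand for the coordinates.\<close>
    have key: "(X / N + Y / N + Z / N) * (1 / (X / N) + 1 / (Y / N) + 1 / (Z / N)) / N = (X + Y + Z) * (1 / X + 1 / Y + 1 / Z) / N" for X Y Z
      using N by (simp add: add_divide_distrib[symmetric] distrib_left[symmetric])
        (simp add: algebra_simps add_divide_distrib)
    have "(a, b, c) \<in> facets" using T abc by simp
    from facet_contribution[OF this x, folded N_def, unfolded key] show ?thesis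
      unfolding abc Q_def prod.case N_def[symmetric] .
  qed
  have "\<forall>T\<in>facets. \<exists>z. (\<forall>t>0. ((\<lambda>m. (case T of (a, b, c) \<Rightarrow> kappa x m a b c) * exp (- t * (m \<bullet> x))) has_sum fst z t) (dual_lattice latt)) \<and>
     cubic_approx (\<lambda>t. t ^ 3 * fst z t) (snd z) \<and> coeff (snd z) 3 = Q T / 24"
    using ex by fastforce
  from bchoice[OF this] obtain z where z: "\<forall>T\<in>facets. (\<forall>t>0. ((\<lambda>m. (case T of (a, b, c) \<Rightarrow> kappa x m a b c) * exp (- t * (m \<bullet> x))) has_sum fst (z T) t) (dual_lattice latt)) \<and>
     cubic_approx (\<lambda>t. t ^ 3 * fst (z T) t) (snd (z T)) \<and> coeff (snd (z T)) 3 = Q T / 24" ..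
  define S where "S T = fst (z T)" for T
  define P where "P T = snd (z T)" for T
  have SP: "\<And>T t. T \<in> facets \<Longrightarrow> t > 0 \<Longrightarrow>
      ((\<lambda>m. (case T of (a, b, c) \<Rightarrow> kappa x m a b c) * exp (- t * (m \<bullet> x))) has_sum S T t) (dual_lattice latt)"
    "\<And>T. T \<in> facets \<Longrightarrow> cubic_approx (\<lambda>t. t ^ 3 * S T t) (P T)"
    "\<And>T. T \<in> facets \<Longrightarrow> coeff (P T) 3 = Q T / 24"
    using z unfolding S_def P_def by blast+
  have tot: "(\<Sum>T\<in>facets. S T t) = 3" if t: "t > 0" for t
  proof -
    have "((\<lambda>m. \<Sum>T\<in>facets. (case T of (a, b, c) \<Rightarrow> kappa x m a b c) * exp (- t * (m \<bullet> x))) has_sum (\<Sum>T\<in>facets. S T t)) (dual_lattice latt)"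
      by (rule has_sum_sum[OF finite_facets SP(1)[OF _ t]])
    moreover have "(\<Sum>T\<in>facets. (case T of (a, b, c) \<Rightarrow> kappa x m a b c) * exp (- t * (m \<bullet> x))) = (if m = 0 then 3 else 0)" for m
      unfolding sum_distrib_right[symmetric] sum_kappa[OF x] by simp
    moreover have "((\<lambda>m. if m = 0 then 3 else 0 :: real) has_sum 3) (dual_lattice latt)"
    proof -
      have "0 \<in> dual_lattice latt" by (simp add: dual_lattice_def)
      then show ?thesis
        by (intro has_sum_finite_neutralI[of "{0}"]) auto
    qed
    ultimately show ?thesis using has_sum_unique by fastforce
  qed
  have "cubic_approx (\<lambda>t. \<Sum>T\<in>facets. t ^ 3 * S T t) (\<Sum>T\<in>facets. P T)"
    by (rule cubic_approx_sum[OF finite_facets SP(2)])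
  then have "coeff (\<Sum>T\<in>facets. P T) 3 = 3"
    by (rule cubic_approx_coeff) (simp add: sum_distrib_left[symmetric] tot)
  then have "(\<Sum>T\<in>facets. Q T / 24) = 3" using SP(3) by (simp add: coeff_sum)
  then have "(\<Sum>T\<in>facets. Q T) = 72" by (simp add: sum_divide_distrib[symmetric])
  then show ?thesis by (simp add: Q_def[abs_def])
qed

section \<open>Regrouping along edges\<close>

definition level :: "'a \<Rightarrow> 'a \<Rightarrow> 'a \<Rightarrow> 'a" where
  "level a b c = dual_fun a b c 1 1 1"

lemma level_inner:
  assumes "(a, b, c) \<in> facets"
  shows "level a b c \<bullet> a = 1" "level a b c \<bullet> b = 1" "level a b c \<bullet> c = 1"
  using dual_fun_inner[of a b c] facetsD(4)[OF assms] by (simp_all add: level_def)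

lemma level_rotate: "(a, b, c) \<in> facets \<Longrightarrow> level b c a = level a b c"
  using level_inner[of a b c] level_inner[of b c a] facetsD(4)[of a b c]
  by (intro dual_eqI3[of a b c]) (auto intro: facets_rotate)

text \<open>The bend across the edge a b of the piecewise linear function with pieces
  \<open>level\<close>, measured in multiples of \<open>cross a b\<close>. It vanishes when the two
  triangles at the edge lie in one plane.\<close>

definition kink :: "'a \<Rightarrow> 'a \<Rightarrow> 'a \<Rightarrow> real" where
  "kink a b c = (1 - level b a (opp b a) \<bullet> c) / det3 a b c"

lemma level_diff_kink:
  assumes f: "(a, b, c) \<in> facets"
  shows "level a b c - level b a (opp b a) = kink a b c *\<^sub>R cross a b"
proof -
  have "level a b c - level b a (opp b a) = ((level a b c - level b a (opp b a)) \<bullet> c / det3 a b c) *\<^sub>R cross a b"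
    using level_inner[OF f] level_inner[OF facets_opp[OF f]] facetsD(4)[OF f]
    by (intro orthogonal_cross) (auto simp: inner_diff_left)
  then show ?thesis using level_inner[OF f] by (simp add: kink_def inner_diff_left)
qed

text \<open>The sum of the three determinants divided by det (a, b, c) is the level at x, so the
  part depending on x splits into one term per edge. The two triangles at an edge see opposite signs
  of det (a, b, x), and the difference of their levels at x is a multiple of this determinant: x
  cancels. The factor 3 / 2 stems from three edges per triangle and two triangles per edge.\<close>

lemma sum_kinks: "(\<Sum>(a, b, c)\<in>facets. 3 / 2 * kink a b c + det3 a b c - 1 / det3 a b c) = 72"
proof -
  obtain x where x: "generic_vec x" using exists_generic by blast
  define g where "g a b c = level a b c \<bullet> x / det3 a b x" for a b c
  have "(det3 x b c + det3 a x c + det3 a b x) * (1 / det3 x b c + 1 / det3 a x c + 1 / det3 a b x) / det3 a b c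
      = g a b c + g b c a + g c a b" if f: "(a, b, c) \<in> facets" for a b c
  proof -
    have "level a b c \<bullet> x = (det3 x b c + det3 a x c + det3 a b x) / det3 a b c"
      using inner_coords[OF facetsD(4)[OF f], of "level a b c" x] level_inner[OF f] facetsD(4)[OF f]
      by (simp add: field_simps)
    moreover have "det3 b c x = det3 x b c" "det3 c a x = det3 a x c"
      using det3_rotate[of x b c] det3_rotate[of a x c] det3_rotate[of x c a] by simp_all
    ultimately show ?thesis
      using level_rotate[OF f] level_rotate[OF facets_rotate[OF f]]
      by (simp add: g_def add_divide_distrib algebra_simps)
  qed
  then have "(\<Sum>(a, b, c)\<in>facets. g a b c + g b c a + g c a b + det3 a b c - 1 / det3 a b c) = 72"
    using sum_contributions[OF x] by (simp add: case_prod_unfold cong: sum.cong)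
  moreover have "(\<Sum>(a, b, c)\<in>facets. g b c a) = (\<Sum>(a, b, c)\<in>facets. g a b c)"
    by (rule sum_facets_rotate)
  moreover have "(\<Sum>(a, b, c)\<in>facets. g c a b) = (\<Sum>(a, b, c)\<in>facets. g a b c)"
    using sum_facets_rotate[of "\<lambda>a b c. g b c a"] sum_facets_rotate[of g] by simp
  moreover have "(\<Sum>(a, b, c)\<in>facets. g a b c) = (\<Sum>(a, b, c)\<in>facets. kink a b c / 2)"
  proof -
    have "(\<Sum>(a, b, c)\<in>facets. g a b c + g b a (opp b a)) = (\<Sum>(a, b, c)\<in>facets. kink a b c)"
    proof (rule sum.cong[OF refl], clarify)
      fix a b c assume f: "(a, b, c) \<in> facets"
      have sw: "det3 b a x = - det3 a b x" by (rule det3_swap)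
      have "g a b c + g b a (opp b a) = (level a b c - level b a (opp b a)) \<bullet> x / det3 a b x"
        by (simp add: g_def sw inner_diff_left diff_divide_distrib)
      also have "\<dots> = kink a b c"
        unfolding level_diff_kink[OF f] using facet_generic(3)[OF f x] by (simp add: det3_def)
      finally show "g a b c + g b a (opp b a) = kink a b c" .
    qed
    then show ?thesis
      using sum_facets_opp[of g] by (simp add: case_prod_unfold sum.distrib sum_divide_distrib[symmetric])
  qed
  ultimately show ?thesis
    by (simp add: case_prod_unfold sum.distrib sum_subtractf sum_divide_distrib[symmetric] sum_distrib_left[symmetric])
qed

end

section \<open>Generic weights\<close>

context lattice3
begin

lemma DIM_le_3: "DIM('a) \<le> 3"
proof -
  have "x \<in> span {b1, b2, b3}" for x
    by (subst expansion[of x]) (intro span_add span_scale; auto intro: span_base)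
  then have "dim (UNIV :: 'a set) \<le> card {b1, b2, b3}"
    by (intro dim_le_card) auto
  also have "\<dots> \<le> 3" by (simp add: card_insert_if)
  finally show ?thesis by simp
qed

lemma eventually_poly_nonzero:
  fixes P :: "real poly"
  assumes "P \<noteq> 0"
  shows "\<forall>\<^sub>F s in at_right 0. poly P s \<noteq> 0"
proof -
  have "finite ({s. poly P s = 0} - {0})" using poly_roots_finite[OF assms] by simp
  then have "open (- ({s. poly P s = 0} - {0}))" by (intro open_Compl finite_imp_closed)
  then show ?thesis
    unfolding eventually_at_topological by (intro exI[of _ "- ({s. poly P s = 0} - {0})"]) auto
qed

text \<open>Strict convexity of the squared norm: the difference of the two sides is the weighted
  mean of the squared distances from q.\<close>

lemma weighted_norm_less:
  fixes a b c :: "'b::real_inner"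
  assumes "e \<ge> 0" "f \<ge> 0" "g \<ge> 0" "e + f + g = 1"
    and q: "q = e *\<^sub>R a + f *\<^sub>R b + g *\<^sub>R c" "q \<notin> {a, b, c}"
  shows "q \<bullet> q < e * (a \<bullet> a) + f * (b \<bullet> b) + g * (c \<bullet> c)"
proof -
  have "e * ((a - q) \<bullet> (a - q)) + f * ((b - q) \<bullet> (b - q)) + g * ((c - q) \<bullet> (c - q))
      = e * (a \<bullet> a) + f * (b \<bullet> b) + g * (c \<bullet> c) - 2 * ((e *\<^sub>R a + f *\<^sub>R b + g *\<^sub>R c) \<bullet> q) + (e + f + g) * (q \<bullet> q)"
    by (simp add: inner_diff_left inner_diff_right inner_add_left inner_commute algebra_simps)
  also have "\<dots> = e * (a \<bullet> a) + f * (b \<bullet> b) + g * (c \<bullet> c) - q \<bullet> q"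
    unfolding q(1)[symmetric] assms(4) by simp
  finally have eq: "e * ((a - q) \<bullet> (a - q)) + f * ((b - q) \<bullet> (b - q)) + g * ((c - q) \<bullet> (c - q))
      = e * (a \<bullet> a) + f * (b \<bullet> b) + g * (c \<bullet> c) - q \<bullet> q" .
  have pos: "(a - q) \<bullet> (a - q) > 0" "(b - q) \<bullet> (b - q) > 0" "(c - q) \<bullet> (c - q) > 0"
    using q(2) by auto
  have "e > 0 \<or> f > 0 \<or> g > 0" using assms(1-4) by linarith
  have "e * ((a - q) \<bullet> (a - q)) + f * ((b - q) \<bullet> (b - q)) + g * ((c - q) \<bullet> (c - q)) > 0"
  proof -
    have nn: "0 \<le> e * ((a - q) \<bullet> (a - q))" "0 \<le> f * ((b - q) \<bullet> (b - q))" "0 \<le> g * ((c - q) \<bullet> (c - q))"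
      using assms(1-3) by (intro mult_nonneg_nonneg inner_ge_zero; simp)+
    from \<open>e > 0 \<or> f > 0 \<or> g > 0\<close>
    have "0 < e * ((a - q) \<bullet> (a - q)) \<or> 0 < f * ((b - q) \<bullet> (b - q)) \<or> 0 < g * ((c - q) \<bullet> (c - q))"
      using pos by (blast intro: mult_pos_pos)
    then show ?thesis using nn by linarith
  qed
  then show ?thesis using eq by linarith
qed

text \<open>The quadratic term makes the induced subdivision Delaunay-like, so that it uses every point;
  the small powers \<open>s ^ k p\<close> with distinct exponents break ties.\<close>

lemma exists_weights:
  assumes A: "finite A" and sur: "\<And>y. y \<noteq> 0 \<Longrightarrow> \<exists>p\<in>A. y \<bullet> p < 0"
  obtains r where "weighted_fan b1 b2 b3 d1 d2 d3 A r"
    "\<And>a b c p e f g. a \<in> A \<Longrightarrow> b \<in> A \<Longrightarrow> c \<in> A \<Longrightarrow> p \<in> A \<Longrightarrow> det3 a b c \<noteq> 0 \<Longrightarrow>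
       p = e *\<^sub>R a + f *\<^sub>R b + g *\<^sub>R c \<Longrightarrow> e * r a + f * r b + g * r c \<le> r p \<Longrightarrow>
       e + f + g \<le> 1 \<and> (e \<ge> 0 \<and> f \<ge> 0 \<and> g \<ge> 0 \<and> e + f + g = 1 \<longrightarrow> p \<in> {a, b, c})"
proof -
  obtain k0 :: "'a \<Rightarrow> nat" where k0: "inj_on k0 A"
    using finite_imp_inj_to_nat_seg[OF A] by metis
  define k where "k p = Suc (k0 p)" for p
  have k: "inj_on k A" "\<And>p. k p > 0" using k0 by (auto simp: k_def inj_on_def)
  define E F G where "E = (\<lambda>(a, b, c, p). det3 p b c / det3 a b c)"
    and "F = (\<lambda>(a, b, c, p). det3 a p c / det3 a b c)" and "G = (\<lambda>(a, b, c, p). det3 a b p / det3 a b c)"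
  define gap where "gap r T = (case T of (a, b, c, p) \<Rightarrow> E T * r a + F T * r b + G T * r c - r p)" for r T
  \<comment> \<open>Triples a b c that must not become a facet on account of p: p lies beyond their
    plane, or in their triangle without being a vertex. A positive \<open>gap\<close> makes p
    violate the supporting functional of the triple.\<close>
  define Bad where "Bad = {T \<in> A \<times> A \<times> A \<times> A. (case T of (a, b, c, p) \<Rightarrow> det3 a b c \<noteq> 0 \<and>
     (E T + F T + G T > 1 \<or> (E T + F T + G T = 1 \<and> E T \<ge> 0 \<and> F T \<ge> 0 \<and> G T \<ge> 0 \<and> p \<notin> {a, b, c})))}"
  have finBad: "finite Bad" unfolding Bad_def using A by simp
  have rep: "p = E (a, b, c, p) *\<^sub>R a + F (a, b, c, p) *\<^sub>R b + G (a, b, c, p) *\<^sub>R c" if "det3 a b c \<noteq> 0" for a b c p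
    using coords_of[OF that] by (simp add: E_def F_def G_def)
  have "\<forall>\<^sub>F \<epsilon> in at_right 0. \<forall>T\<in>Bad. gap (\<lambda>p. 1 + \<epsilon> * (p \<bullet> p)) T > 0"
  proof (rule eventually_ball_finite[OF finBad], rule ballI)
    fix T assume T: "T \<in> Bad"
    obtain a b c p where abcp: "T = (a, b, c, p)" by (metis surj_pair)
    define K where "K = E T * (a \<bullet> a) + F T * (b \<bullet> b) + G T * (c \<bullet> c) - p \<bullet> p"
    have gap: "gap (\<lambda>p. 1 + \<epsilon> * (p \<bullet> p)) T = (E T + F T + G T - 1) + \<epsilon> * K" for \<epsilon>
      by (simp add: gap_def K_def abcp algebra_simps)
    \<comment> \<open>In the first case the constant part of the weights decides for small
      \<open>\<epsilon>\<close>; in the second it cancels, and strict convexity of the squared norm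
      decides for every positive \<open>\<epsilon>\<close>.\<close>
    from T consider "E T + F T + G T > 1" | "E T + F T + G T = 1" "E T \<ge> 0" "F T \<ge> 0" "G T \<ge> 0" "p \<notin> {a, b, c}"
      by (auto simp: Bad_def abcp)
    then show "\<forall>\<^sub>F \<epsilon> in at_right 0. gap (\<lambda>p. 1 + \<epsilon> * (p \<bullet> p)) T > 0"
    proof cases
      case 1
      have "((\<lambda>\<epsilon>. (E T + F T + G T - 1) + \<epsilon> * K) \<longlongrightarrow> (E T + F T + G T - 1) + 0 * K) (at_right 0)"
        by (intro tendsto_intros)
      then show ?thesis unfolding gap using 1 by (intro order_tendstoD(1)) auto
    next
      case 2
      have "det3 a b c \<noteq> 0" using T by (auto simp: Bad_def abcp)
      then have "K > 0"
        using weighted_norm_less[OF 2(2,3,4,1) _ 2(5)] rep[of a b c p] by (simp add: K_def abcp)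
      then have "gap (\<lambda>p. 1 + \<epsilon> * (p \<bullet> p)) T > 0" if "\<epsilon> > 0" for \<epsilon>
        using that 2(1) by (simp add: gap)
      then show ?thesis by (auto simp: eventually_at_filter)
    qed
  qed
  moreover have "\<forall>\<^sub>F \<epsilon> in at_right (0::real). \<epsilon> > 0" by (simp add: eventually_at_filter)
  ultimately have "\<forall>\<^sub>F \<epsilon> in at_right 0. \<epsilon> > 0 \<and> (\<forall>T\<in>Bad. gap (\<lambda>p. 1 + \<epsilon> * (p \<bullet> p)) T > 0)"
    by eventually_elim auto
  then obtain \<epsilon> where \<epsilon>: "\<epsilon> > 0" "\<And>T. T \<in> Bad \<Longrightarrow> gap (\<lambda>p. 1 + \<epsilon> * (p \<bullet> p)) T > 0"
    using eventually_happens'[OF trivial_limit_at_right_real] by blast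
  define w where "w s p = 1 + \<epsilon> * (p \<bullet> p) + s ^ k p" for s p
  have "\<forall>\<^sub>F s in at_right 0. \<forall>T\<in>Bad. gap (w s) T > 0"
  proof (rule eventually_ball_finite[OF finBad], rule ballI)
    fix T assume T: "T \<in> Bad"
    obtain a b c p where abcp: "T = (a, b, c, p)" by (metis surj_pair)
    have w0: "((\<lambda>s. w s q) \<longlongrightarrow> 1 + \<epsilon> * (q \<bullet> q)) (at_right 0)" for q
    proof -
      have "((\<lambda>s. w s q) \<longlongrightarrow> 1 + \<epsilon> * (q \<bullet> q) + 0 ^ k q) (at_right 0)"
        unfolding w_def by (intro tendsto_intros)
      then show ?thesis using k(2)[of q] by (simp add: power_0_left)
    qed
    have "((\<lambda>s. gap (w s) T) \<longlongrightarrow> gap (\<lambda>p. 1 + \<epsilon> * (p \<bullet> p)) T) (at_right 0)"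
      unfolding gap_def abcp prod.case by (intro tendsto_intros w0)
    then show "\<forall>\<^sub>F s in at_right 0. gap (w s) T > 0"
      using \<epsilon>(2)[OF T] by (rule order_tendstoD)
  qed
  moreover have "\<forall>\<^sub>F s in at_right 0. \<forall>S\<in>{S. S \<subseteq> A \<and> card S = 4}. \<forall>y. \<exists>p\<in>S. y \<bullet> p \<noteq> w s p"
  proof (rule eventually_ball_finite)
    show "finite {S. S \<subseteq> A \<and> card S = 4}" by (rule finite_subset[of _ "Pow A"]) (auto simp: A)
    show "\<forall>S\<in>{S. S \<subseteq> A \<and> card S = 4}. \<forall>\<^sub>F s in at_right 0. \<forall>y. \<exists>p\<in>S. y \<bullet> p \<noteq> w s p"
    proof
      fix S assume "S \<in> {S. S \<subseteq> A \<and> card S = 4}"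
      then have S: "S \<subseteq> A" "card S = 4" "finite S" using A by (auto intro: finite_subset)
      \<comment> \<open>Four vectors in dimension at most three satisfy a linear relation, and a
        functional that fits all four weights transfers it to the weights. As a polynomial in s it
        is nonzero, the exponents being distinct and positive.\<close>
      have "dependent S" using S DIM_le_3 by (intro dependent_biggerset) auto
      then obtain u v where u: "v \<in> S" "u v \<noteq> 0" "(\<Sum>p\<in>S. u p *\<^sub>R p) = 0"
        using dependent_finite[OF S(3)] by auto
      define P where "P = (\<Sum>p\<in>S. monom (u p * (1 + \<epsilon> * (p \<bullet> p))) 0 + monom (u p) (k p))"
      have "coeff P (k v) = (\<Sum>p\<in>S. if p = v then u p else 0)"
        unfolding P_def coeff_sum coeff_add coeff_monom
      proof (rule sum.cong[OF refl])
        fix p assume "p \<in> S"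
        then have "k p = k v \<longleftrightarrow> p = v" using k(1) S(1) u(1) by (auto dest: inj_onD)
        then show "(if 0 = k v then u p * (1 + \<epsilon> * (p \<bullet> p)) else 0) + (if k p = k v then u p else 0) = (if p = v then u p else 0)"
          using k(2)[of v] by simp
      qed
      also have "\<dots> = u v" using S(3) u(1) by simp
      finally have "P \<noteq> 0" using u(2) by auto
      from eventually_poly_nonzero[OF this]
      show "\<forall>\<^sub>F s in at_right 0. \<forall>y. \<exists>p\<in>S. y \<bullet> p \<noteq> w s p"
      proof eventually_elim
        fix s assume nz: "poly P s \<noteq> 0"
        show "\<forall>y. \<exists>p\<in>S. y \<bullet> p \<noteq> w s p"
        proof (rule allI, rule ccontr)
          fix y assume "\<not> (\<exists>p\<in>S. y \<bullet> p \<noteq> w s p)"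
          then have y: "y \<bullet> p = w s p" if "p \<in> S" for p using that by auto
          have "poly P s = (\<Sum>p\<in>S. u p * w s p)"
            unfolding P_def poly_sum by (intro sum.cong) (auto simp: poly_monom w_def algebra_simps)
          also have "\<dots> = (\<Sum>p\<in>S. u p * (y \<bullet> p))" using y by simp
          also have "\<dots> = y \<bullet> (\<Sum>p\<in>S. u p *\<^sub>R p)" by (simp add: inner_sum_right)
          finally show False using nz u(3) by simp
        qed
      qed
    qed
  qed
  moreover have "\<forall>\<^sub>F s in at_right (0::real). s > 0" by (simp add: eventually_at_filter)
  ultimately have "\<forall>\<^sub>F s in at_right 0. s > 0 \<and> (\<forall>T\<in>Bad. gap (w s) T > 0) \<and>
      (\<forall>S\<in>{S. S \<subseteq> A \<and> card S = 4}. \<forall>y. \<exists>p\<in>S. y \<bullet> p \<noteq> w s p)"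
    by eventually_elim auto
  from eventually_happens'[OF trivial_limit_at_right_real this]
  obtain s where s': "s > 0 \<and> (\<forall>T\<in>Bad. gap (w s) T > 0) \<and>
      (\<forall>S\<in>{S. S \<subseteq> A \<and> card S = 4}. \<forall>y. \<exists>p\<in>S. y \<bullet> p \<noteq> w s p)" by (rule exE)
  have s: "s > 0" "\<And>T. T \<in> Bad \<Longrightarrow> gap (w s) T > 0"
    using s' by simp_all
  have s3: "\<exists>p\<in>S. y \<bullet> p \<noteq> w s p" if "S \<subseteq> A" "card S = 4" for S y
    using s' that by simp
  have pos: "w s p > 0" for p
    unfolding w_def using \<epsilon>(1) s(1) by (intro add_pos_pos add_pos_nonneg) auto
  show thesis
  proof (rule that[of "w s"])
    show "weighted_fan b1 b2 b3 d1 d2 d3 A (w s)"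
      by unfold_locales (simp_all add: A pos sur s3)
    fix a b c p e f g
    assume abc: "a \<in> A" "b \<in> A" "c \<in> A" "p \<in> A" "det3 a b c \<noteq> 0"
      and p: "p = e *\<^sub>R a + f *\<^sub>R b + g *\<^sub>R c" and le: "e * w s a + f * w s b + g * w s c \<le> w s p"
    define T where "T = (a, b, c, p)"
    have efg: "E T = e" "F T = f" "G T = g"
      using coords_unique[OF abc(5)] rep[OF abc(5), of p] p unfolding T_def by metis+
    have "T \<notin> Bad" using s(2)[of T] le by (auto simp: gap_def T_def[symmetric] efg) (simp add: T_def)
    then show "e + f + g \<le> 1 \<and> (e \<ge> 0 \<and> f \<ge> 0 \<and> g \<ge> 0 \<and> e + f + g = 1 \<longrightarrow> p \<in> {a, b, c})"
      using abc efg by (auto simp: Bad_def T_def)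
  qed
qed

end

section \<open>Volume in lattice coordinates\<close>

text \<open>Lattice coordinates indexed by a finite type instead of by the basis set, so that
  Lebesgue measure on \<open>real ^ 'n\<close> and its volume formulas for simplices apply.\<close>

definition coord_map :: "'a \<Rightarrow> ('n::finite \<Rightarrow> 'a) \<Rightarrow> real ^ 'n \<Rightarrow> 'a::euclidean_space" where
  "coord_map p f x = p + (\<Sum>i\<in>UNIV. x $ i *\<^sub>R f i)"

lemma linear_coord_sum: "linear (\<lambda>x :: real ^ 'n::finite. \<Sum>i\<in>UNIV. x $ i *\<^sub>R (f i :: 'a::euclidean_space))"
  by (intro linear_compose_sum ballI) (auto intro!: linearI simp: scaleR_add_left)

lemma continuous_coord_map: "continuous_on UNIV (coord_map p f)"
  unfolding coord_map_def by (intro continuous_intros)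

lemma closed_vimage_coord_map: "closed \<theta> \<Longrightarrow> closed (coord_map p f -` \<theta>)"
  using continuous_closed_vimage[of \<theta> "coord_map p f"] continuous_coord_map[of p f]
  by (simp add: continuous_on_eq_continuous_at)

lemma compact_vimage_coord_map:
  fixes f :: "'n::finite \<Rightarrow> 'a::euclidean_space"
  assumes ind: "\<And>x :: real ^ 'n. (\<Sum>i\<in>UNIV. x $ i *\<^sub>R f i) = 0 \<Longrightarrow> x = 0" and "compact \<theta>"
  shows "compact (coord_map p f -` \<theta>)"
proof -
  define h where "h x = (\<Sum>i\<in>UNIV. x $ i *\<^sub>R f i)" for x :: "real ^ 'n"
  have lin: "linear h" unfolding h_def by (rule linear_coord_sum)
  have "inj h" using ind linear_injective_0[OF lin] by (auto simp: h_def)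
  then obtain B where B: "B > 0" "\<And>x. B * norm x \<le> norm (h x)"
    using linear_inj_bounded_below_pos[OF lin] by metis
  obtain C where C: "\<And>y. y \<in> \<theta> \<Longrightarrow> norm y \<le> C"
    using compact_imp_bounded[OF assms(2)] by (auto simp: bounded_iff)
  have "bounded (coord_map p f -` \<theta>)"
    unfolding bounded_iff
  proof (intro exI ballI)
    fix x assume "x \<in> coord_map p f -` \<theta>"
    then have "norm (p + h x) \<le> C" using C by (simp add: coord_map_def h_def)
    then have "norm (h x) \<le> C + norm p"
      using norm_triangle_ineq4[of "p + h x" p] by simp
    then have "B * norm x \<le> C + norm p" using B(2)[of x] by simp
    then show "norm x \<le> (C + norm p) / B" using B(1) by (simp add: field_simps)
  qed
  then show ?thesis
    using closed_vimage_coord_map[OF compact_imp_closed[OF assms(2)]] by (simp add: compact_eq_bounded_closed)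
qed

lemma measurable_vec_reindex:
  fixes f :: "'n::finite \<Rightarrow> 'b"
  assumes fB: "\<And>i. f i \<in> B"
  shows "(\<lambda>c. \<chi> i. c (f i)) \<in> borel_measurable (Pi\<^sub>M B (\<lambda>_. lborel :: real measure))"
proof (subst borel_measurable_euclidean_space, rule ballI)
  fix e :: "real ^ 'n" assume "e \<in> Basis"
  then obtain i where e: "e = axis i 1" by (auto simp: Basis_vec_def)
  have "(\<lambda>c. c (f i)) \<in> measurable (Pi\<^sub>M B (\<lambda>_. lborel :: real measure)) lborel"
    by (rule measurable_component_singleton[OF fB])
  then show "(\<lambda>c. (\<chi> i. c (f i)) \<bullet> e) \<in> borel_measurable (Pi\<^sub>M B (\<lambda>_. lborel :: real measure))"
    by (simp add: e inner_axis)
qed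

text \<open>Both measures assign to a box the product of its side lengths, which characterizes
  Lebesgue measure.\<close>

lemma lborel_vec_distr:
  fixes f :: "'n::finite \<Rightarrow> 'b"
  assumes bij: "bij_betw f UNIV B"
  shows "distr (Pi\<^sub>M B (\<lambda>_. lborel)) borel (\<lambda>c. \<chi> i. c (f i)) = (lborel :: (real ^ 'n) measure)"
proof (rule lborel_eqI[symmetric])
  interpret product_sigma_finite "\<lambda>_::'b. lborel :: real measure" by standard
  have finB: "finite B" using bij_betw_finite[OF bij] by simp
  have fB: "f i \<in> B" for i using bij by (auto simp: bij_betw_def)
  have inv: "inv f (f i) = i" for i using bij by (simp add: bij_betw_def)
  note meas [measurable] = measurable_vec_reindex[of f B, OF fB]
  fix l u :: "real ^ 'n" assume lu: "\<And>b. b \<in> Basis \<Longrightarrow> l \<bullet> b \<le> u \<bullet> b"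
  then have lu': "l $ i \<le> u $ i" for i
    using lu[of "axis i 1"] by (simp add: inner_axis)
  have pre: "(\<lambda>c. \<chi> i. c (f i)) -` box l u \<inter> space (Pi\<^sub>M B (\<lambda>_. lborel :: real measure))
      = (\<Pi>\<^sub>E b\<in>B. {l $ inv f b <..< u $ inv f b})" (is "?L = ?R")
  proof
    show "?L \<subseteq> ?R"
    proof
      fix c assume c: "c \<in> ?L"
      have "c (f i) \<in> {l $ i <..< u $ i}" for i using c by (auto simp: mem_box_cart)
      then have "c b \<in> {l $ inv f b <..< u $ inv f b}" if "b \<in> B" for b
        using that bij inv unfolding bij_betw_def by force
      then show "c \<in> ?R" using c by (auto simp: space_PiM PiE_iff)
    qed
    show "?R \<subseteq> ?L"
      using fB by (fastforce simp: mem_box_cart space_PiM PiE_iff inv)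
  qed
  have "emeasure (distr (Pi\<^sub>M B (\<lambda>_. lborel)) borel (\<lambda>c. \<chi> i. c (f i))) (box l u)
      = emeasure (Pi\<^sub>M B (\<lambda>_. lborel)) (\<Pi>\<^sub>E b\<in>B. {l $ inv f b <..< u $ inv f b})"
    by (subst emeasure_distr[OF meas]) (simp_all add: pre)
  also have "\<dots> = (\<Prod>b\<in>B. emeasure lborel {l $ inv f b <..< u $ inv f b})"
    using finB by (intro emeasure_PiM) auto
  also have "\<dots> = (\<Prod>b\<in>B. ennreal (u $ inv f b - l $ inv f b))"
    using lu' by simp
  also have "\<dots> = (\<Prod>i\<in>UNIV. ennreal (u $ i - l $ i))"
    using prod.reindex_bij_betw[OF bij, of "\<lambda>b. ennreal (u $ inv f b - l $ inv f b)"] by (simp add: inv)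
  also have "\<dots> = ennreal (\<Prod>i\<in>UNIV. (u - l) $ i)"
    using lu' by (simp add: prod_ennreal)
  also have "(\<Prod>i\<in>UNIV. (u - l) $ i) = (\<Prod>b\<in>Basis. (u - l) \<bullet> b)"
  proof -
    have eq: "(Basis :: (real ^ 'n) set) = range (\<lambda>i. axis i 1)" by (auto simp: Basis_vec_def)
    have inj: "inj (\<lambda>i. axis i (1::real) :: real ^ 'n)" by (simp add: inj_def axis_eq_axis)
    have "(\<Prod>b\<in>Basis. (u - l) \<bullet> b) = (\<Prod>b\<in>range (\<lambda>i. axis i 1). (u - l) \<bullet> b)"
      by (subst eq) (rule refl)
    also have "\<dots> = (\<Prod>i\<in>UNIV. (u - l) \<bullet> axis i 1)"
      by (subst prod.reindex[OF inj]) (simp add: o_def)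
    also have "\<dots> = (\<Prod>i\<in>UNIV. (u - l) $ i)"
      by (simp add: inner_axis)
    finally show ?thesis by (rule sym)
  qed
  finally show "emeasure (distr (Pi\<^sub>M B (\<lambda>_. lborel)) borel (\<lambda>c. \<chi> i. c (f i))) (box l u)
      = ennreal (\<Prod>b\<in>Basis. (u - l) \<bullet> b)" .
qed simp

lemma measure_PiM_coord_map:
  fixes f :: "'n::finite \<Rightarrow> 'a::euclidean_space"
  assumes bij: "bij_betw f UNIV B" and "closed \<theta>"
  shows "measure (Pi\<^sub>M B (\<lambda>_. lborel)) {c \<in> B \<rightarrow>\<^sub>E UNIV. p + (\<Sum>v\<in>B. c v *\<^sub>R v) \<in> \<theta>}
      = measure lborel (coord_map p f -` \<theta>)"
proof -
  have fB: "f i \<in> B" for i using bij by (auto simp: bij_betw_def)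
  note meas = measurable_vec_reindex[of f B, OF fB]
  have "(\<Sum>v\<in>B. c v *\<^sub>R v) = (\<Sum>i\<in>UNIV. c (f i) *\<^sub>R f i)" for c :: "'a \<Rightarrow> real"
    using sum.reindex_bij_betw[OF bij, of "\<lambda>v. c v *\<^sub>R v"] by simp
  then have eq: "{c \<in> B \<rightarrow>\<^sub>E UNIV. p + (\<Sum>v\<in>B. c v *\<^sub>R v) \<in> \<theta>}
      = (\<lambda>c. \<chi> i. c (f i)) -` (coord_map p f -` \<theta>) \<inter> space (Pi\<^sub>M B (\<lambda>_. lborel :: real measure))"
    by (auto simp: coord_map_def space_PiM)
  have "closed (coord_map p f -` \<theta>)" using closed_vimage_coord_map[OF assms(2)] .
  then have "measure (distr (Pi\<^sub>M B (\<lambda>_. lborel)) borel (\<lambda>c. \<chi> i. c (f i))) (coord_map p f -` \<theta>)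
      = measure (Pi\<^sub>M B (\<lambda>_. lborel)) {c \<in> B \<rightarrow>\<^sub>E UNIV. p + (\<Sum>v\<in>B. c v *\<^sub>R v) \<in> \<theta>}"
    unfolding eq by (intro measure_distr[OF meas]) auto
  then show ?thesis unfolding lborel_vec_distr[OF bij] by simp
qed

lemma span_int_span:
  assumes fin: "finite B"
  shows "span (int_span B) = span B"
proof
  show "span (int_span B) \<subseteq> span B"
    by (rule span_minimal) (auto simp: int_span_def intro: span_sum span_scale span_base)
  show "span B \<subseteq> span (int_span B)"
  proof (rule span_mono, rule subsetI)
    fix b assume b: "b \<in> B"
    have "(\<Sum>v\<in>B. of_int (if v = b then 1 else 0) *\<^sub>R v) = (\<Sum>v\<in>B. if v = b then v else 0)"
      by (intro sum.cong) auto
    also have "\<dots> = b" using fin b by simp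
    finally have eq: "(\<Sum>v\<in>B. of_int (if v = b then 1 else 0) *\<^sub>R v) = b" .
    show "b \<in> int_span B"
      unfolding int_span_def
      by (rule CollectI, rule exI[of _ "\<lambda>v. if v = b then 1 else 0"]) (simp only: eq simp_thms)
  qed
qed

lemma int_span_range:
  fixes f :: "'n::finite \<Rightarrow> 'a::euclidean_space"
  assumes "inj f"
  shows "int_span (range f) = {\<Sum>i\<in>UNIV. of_int (c i) *\<^sub>R f i | c :: 'n \<Rightarrow> int. True}"
proof -
  have 1: "(\<Sum>v\<in>range f. of_int (c v) *\<^sub>R v) = (\<Sum>i\<in>UNIV. of_int (c (f i)) *\<^sub>R f i)" for c :: "'a \<Rightarrow> int"
    using assms by (simp add: sum.reindex)
  have 2: "(\<Sum>v\<in>range f. of_int ((c \<circ> inv f) v) *\<^sub>R v) = (\<Sum>i\<in>UNIV. of_int (c i) *\<^sub>R f i)" for c :: "'n \<Rightarrow> int"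
    unfolding 1 using assms by simp
  show ?thesis
    unfolding int_span_def
  proof (intro equalityI subsetI)
    fix x assume "x \<in> {\<Sum>v\<in>range f. of_int (c v) *\<^sub>R v | c :: 'a \<Rightarrow> int. True}"
    then obtain c :: "'a \<Rightarrow> int" where "x = (\<Sum>v\<in>range f. of_int (c v) *\<^sub>R v)" by blast
    then show "x \<in> {\<Sum>i\<in>UNIV. of_int (c i) *\<^sub>R f i | c :: 'n \<Rightarrow> int. True}"
      unfolding 1 by (intro CollectI exI[of _ "\<lambda>i. c (f i)"] conjI TrueI)
  next
    fix x assume "x \<in> {\<Sum>i\<in>UNIV. of_int (c i) *\<^sub>R f i | c :: 'n \<Rightarrow> int. True}"
    then obtain c :: "'n \<Rightarrow> int" where "x = (\<Sum>i\<in>UNIV. of_int (c i) *\<^sub>R f i)" by blast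
    then show "x \<in> {\<Sum>v\<in>range f. of_int (c v) *\<^sub>R v | c :: 'a \<Rightarrow> int. True}"
      unfolding 2[symmetric] by (intro CollectI exI[of _ "c \<circ> inv f"] conjI TrueI)
  qed
qed

lemma mem_int_span_range:
  fixes f :: "'n::finite \<Rightarrow> 'a::euclidean_space"
  assumes "inj f"
  shows "f i \<in> int_span (range f)"
proof -
  have "(\<Sum>j\<in>UNIV. of_int (if j = i then 1 else 0) *\<^sub>R f j) = (\<Sum>j\<in>UNIV. if j = i then f j else 0)"
    by (intro sum.cong) auto
  also have "\<dots> = f i" by simp
  finally show ?thesis
    unfolding int_span_range[OF assms] by (intro CollectI exI[of _ "\<lambda>j. if j = i then 1 else 0"] conjI TrueI) simp
qed

text \<open>The basis and base point chosen inside \<open>lattice_vol\<close> are opaque; they are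
  handed out as some \<open>f\<close> and \<open>p\<close> with their defining properties. All bases
  of the parallel lattice have the same size, so any known basis fixes the index type.\<close>

lemma lattice_vol_eq:
  fixes L \<theta> B0 :: "'a::euclidean_space set"
  assumes B0: "lattice_basis (parallel_lattice L \<theta>) B0" "card B0 = CARD('n::finite)" "closed \<theta>" "\<theta> \<noteq> {}"
  obtains f :: "'n::finite \<Rightarrow> 'a" and p where "inj f" "lattice_basis (parallel_lattice L \<theta>) (range f)" "p \<in> \<theta>"
    "lattice_vol L \<theta> = measure lborel (coord_map p f -` \<theta>)"
proof -
  define B where "B = (SOME B. lattice_basis (parallel_lattice L \<theta>) B)"
  define p where "p = (SOME p. p \<in> \<theta>)"
  have B: "lattice_basis (parallel_lattice L \<theta>) B" unfolding B_def using B0(1) by (rule someI)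
  have p: "p \<in> \<theta>" unfolding p_def using assms(4) by (simp add: some_in_eq)
  have ind: "independent B" "independent B0" and int: "int_span B = int_span B0"
    using B B0(1) by (auto simp: lattice_basis_def)
  have fin: "finite B" "finite B0" using ind by (auto intro: independent_imp_finite)
  have "span B = span B0" using span_int_span[OF fin(1)] span_int_span[OF fin(2)] int by simp
  then have "dim B = dim B0" by (metis dim_span)
  then have "card B = card B0" using ind by (simp add: dim_eq_card_independent)
  then obtain f :: "'n \<Rightarrow> 'a" where f: "bij_betw f UNIV B"
    using finite_same_card_bij[of "UNIV :: 'n set" B] fin B0(2) by auto
  then have "inj f" "range f = B" by (auto simp: bij_betw_def)
  moreover have "lattice_vol L \<theta> = measure lborel (coord_map p f -` \<theta>)"
    unfolding lattice_vol_def Let_def B_def[symmetric] p_def[symmetric]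
    using measure_PiM_coord_map[OF f assms(3)] by simp
  ultimately show thesis using that B p by blast
qed

lemma independent_range_coords:
  fixes f :: "'n::finite \<Rightarrow> 'a::euclidean_space" and x :: "real ^ 'n"
  assumes "inj f" "independent (range f)" "(\<Sum>i\<in>UNIV. x $ i *\<^sub>R f i) = 0"
  shows "x = 0"
proof -
  have "(\<Sum>v\<in>range f. x $ (inv f v) *\<^sub>R v) = 0"
    using assms(1,3) by (simp add: sum.reindex)
  then have "x $ inv f v = 0" if "v \<in> range f" for v
    using assms(2) that independentD[of "range f" "range f" "\<lambda>v. x $ inv f v"] by simp
  then have "x $ i = 0" for i using assms(1) by (metis inv_f_f rangeI)
  then show ?thesis by (simp add: vec_eq_iff)
qed

text \<open>In coordinates the set is given by one affine equation, and a single point violating it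
  shows that the set is a hyperplane or empty.\<close>

lemma negligible_vimage_coord_map:
  fixes f :: "'n::finite \<Rightarrow> 'a::euclidean_space"
  assumes "m \<bullet> coord_map p f x \<noteq> 0"
  shows "negligible (coord_map p f -` {y. m \<bullet> y = 0})"
proof -
  have eq: "coord_map p f -` {y. m \<bullet> y = 0} = {x. (\<chi> i. m \<bullet> f i) \<bullet> x = - (m \<bullet> p)}"
    by (auto simp: coord_map_def inner_add_right inner_sum_right inner_vec_def mult.commute add_eq_0_iff2)
  show ?thesis
  proof (cases "(\<chi> i. m \<bullet> f i) = (0 :: real ^ 'n)")
    case True
    then have "m \<bullet> f i = 0" for i by (simp add: vec_eq_iff)
    then have "m \<bullet> p \<noteq> 0" using assms by (simp add: coord_map_def inner_add_right inner_sum_right)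
    then show ?thesis unfolding eq True by simp
  next
    case False
    then show ?thesis unfolding eq by (intro negligible_hyperplane) auto
  qed
qed

text \<open>Additivity of volume without an analysis of how the pieces intersect: covering and
  disjointness are demanded only off finitely many linear hyperplanes, whose traces in coordinates
  are null sets.\<close>

lemma measure_coord_map_cover:
  fixes f :: "'n::finite \<Rightarrow> 'a::euclidean_space" and \<tau> :: "'i \<Rightarrow> 'a set"
  assumes ind: "\<And>x :: real ^ 'n. (\<Sum>i\<in>UNIV. x $ i *\<^sub>R f i) = 0 \<Longrightarrow> x = 0"
    and I: "finite I" "\<And>j. j \<in> I \<Longrightarrow> compact (\<tau> j)" "\<And>j. j \<in> I \<Longrightarrow> \<tau> j \<subseteq> \<theta>" and \<theta>: "compact \<theta>"
    and M: "finite M" "\<And>m. m \<in> M \<Longrightarrow> \<exists>x. m \<bullet> coord_map p f x \<noteq> 0"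
    and cover: "\<And>y. y \<in> \<theta> \<Longrightarrow> (\<forall>m\<in>M. m \<bullet> y \<noteq> 0) \<Longrightarrow> \<exists>j\<in>I. y \<in> \<tau> j"
    and disj: "\<And>y j k. j \<in> I \<Longrightarrow> k \<in> I \<Longrightarrow> y \<in> \<tau> j \<Longrightarrow> y \<in> \<tau> k \<Longrightarrow> (\<forall>m\<in>M. m \<bullet> y \<noteq> 0) \<Longrightarrow> j = k"
  shows "measure lborel (coord_map p f -` \<theta>) = (\<Sum>j\<in>I. measure lborel (coord_map p f -` \<tau> j))"
proof -
  define E where "E = (\<Union>m\<in>M. coord_map p f -` {y. m \<bullet> y = 0})"
  have E: "negligible E"
    unfolding E_def
  proof (rule negligible_Union)
    show "finite ((\<lambda>m. coord_map p f -` {y. m \<bullet> y = 0}) ` M)" using M(1) by simp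
    fix S assume "S \<in> (\<lambda>m. coord_map p f -` {y. m \<bullet> y = 0}) ` M"
    then obtain m where m: "m \<in> M" "S = coord_map p f -` {y. m \<bullet> y = 0}" by blast
    then obtain x where "m \<bullet> coord_map p f x \<noteq> 0" using M(2) by blast
    then show "negligible S" unfolding m(2) by (rule negligible_vimage_coord_map)
  qed
  have comp: "compact (coord_map p f -` K)" if "compact K" for K
    using compact_vimage_coord_map[OF ind that] .
  have leb: "measure lborel (coord_map p f -` K) = measure lebesgue (coord_map p f -` K)" if "compact K" for K
    using comp[OF that] by (intro measure_completion[symmetric]) (auto dest: compact_imp_closed)
  have "measure lebesgue (\<Union>j\<in>I. coord_map p f -` \<tau> j) = (\<Sum>j\<in>I. measure lebesgue (coord_map p f -` \<tau> j))"
  proof (rule measure_negligible_finite_Union_image[OF I(1)])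
    show "coord_map p f -` \<tau> j \<in> lmeasurable" if "j \<in> I" for j
      using comp[OF I(2)[OF that]] by (rule lmeasurable_compact)
    show "pairwise (\<lambda>j k. negligible (coord_map p f -` \<tau> j \<inter> coord_map p f -` \<tau> k)) I"
    proof (rule pairwiseI)
      fix j k assume "j \<in> I" "k \<in> I" "j \<noteq> k"
      then have "coord_map p f -` \<tau> j \<inter> coord_map p f -` \<tau> k \<subseteq> E"
        using disj[of j k] by (auto simp: E_def)
      then show "negligible (coord_map p f -` \<tau> j \<inter> coord_map p f -` \<tau> k)"
        using negligible_subset[OF E] by blast
    qed
  qed
  moreover have "measure lebesgue (\<Union>j\<in>I. coord_map p f -` \<tau> j) = measure lebesgue (coord_map p f -` \<theta>)"
  proof (rule measure_negligible_symdiff)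
    show "coord_map p f -` \<theta> \<in> lmeasurable" using comp[OF \<theta>] by (rule lmeasurable_compact)
    have "coord_map p f -` \<theta> - (\<Union>j\<in>I. coord_map p f -` \<tau> j) \<union> ((\<Union>j\<in>I. coord_map p f -` \<tau> j) - coord_map p f -` \<theta>) \<subseteq> E"
      using cover I(3) by (fastforce simp: E_def)
    then show "negligible (coord_map p f -` \<theta> - (\<Union>j\<in>I. coord_map p f -` \<tau> j) \<union> ((\<Union>j\<in>I. coord_map p f -` \<tau> j) - coord_map p f -` \<theta>))"
      using negligible_subset[OF E] by blast
  qed
  ultimately show ?thesis using leb \<theta> I(2) by simp
qed

lemma coord_map_affine_hull:
  fixes f :: "'n::finite \<Rightarrow> 'a::euclidean_space"
  assumes ind: "\<And>x :: real ^ 'n. (\<Sum>i\<in>UNIV. x $ i *\<^sub>R f i) = 0 \<Longrightarrow> x = 0"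
  shows "coord_map p f -` (convex hull (coord_map p f ` X)) = convex hull X"
proof -
  define h where "h x = (\<Sum>i\<in>UNIV. x $ i *\<^sub>R f i)" for x :: "real ^ 'n"
  have lin: "linear h" unfolding h_def by (rule linear_coord_sum)
  have cm: "coord_map p f = (\<lambda>x. p + h x)" by (simp add: coord_map_def h_def fun_eq_iff)
  have "inj h" using ind linear_injective_0[OF lin] by (auto simp: h_def)
  then have inj: "inj (coord_map p f)" by (auto simp: cm inj_def)
  have "coord_map p f ` X = (+) p ` (h ` X)" by (auto simp: cm)
  then have "convex hull (coord_map p f ` X) = (+) p ` (convex hull (h ` X))"
    using convex_hull_translation[of p "h ` X"] by simp
  also have "convex hull (h ` X) = h ` (convex hull X)"
    using convex_hull_linear_image[OF lin] by simp
  also have "(+) p ` (h ` (convex hull X)) = coord_map p f ` (convex hull X)" by (auto simp: cm)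
  finally show ?thesis using inj by (simp add: inj_vimage_image_eq)
qed

lemma measure_coord_map_triangle:
  fixes f :: "2 \<Rightarrow> 'a::euclidean_space"
  assumes ind: "\<And>x :: real ^ 2. (\<Sum>i\<in>UNIV. x $ i *\<^sub>R f i) = 0 \<Longrightarrow> x = 0"
    and "b - a = u *\<^sub>R f 1 + v *\<^sub>R f 2" "c - a = u' *\<^sub>R f 1 + v' *\<^sub>R f 2" "a = coord_map p f x"
  shows "measure lborel (coord_map p f -` (convex hull {a, b, c})) = \<bar>u * v' - v * u'\<bar> / 2"
proof -
  define y z where "y = x + vector [u, v]" and "z = x + vector [u', v']"
  have a: "a = p + x $ 1 *\<^sub>R f 1 + x $ 2 *\<^sub>R f 2" using assms(4) by (simp add: coord_map_def sum_2)
  have "b = a + (u *\<^sub>R f 1 + v *\<^sub>R f 2)" "c = a + (u' *\<^sub>R f 1 + v' *\<^sub>R f 2)"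
    unfolding assms(2,3)[symmetric] by simp_all
  then have "b = coord_map p f y" "c = coord_map p f z"
    unfolding a by (simp_all add: coord_map_def sum_2 y_def z_def vector_2 algebra_simps)
  then have eq: "{a, b, c} = coord_map p f ` {x, y, z}" using assms(4) by simp
  have "coord_map p f -` (convex hull {a, b, c}) = convex hull {x, y, z}"
    unfolding eq by (rule coord_map_affine_hull[where f = f, OF ind])
  then show ?thesis
    by (simp add: content_triangle y_def z_def vector_2 abs_minus_commute mult.commute)
qed

lemma measure_coord_map_tetrahedron:
  fixes f :: "3 \<Rightarrow> 'a::euclidean_space"
  assumes ind: "\<And>x :: real ^ 3. (\<Sum>i\<in>UNIV. x $ i *\<^sub>R f i) = 0 \<Longrightarrow> x = 0"
    and abc: "a = coord_map p f (x + A)" "b = coord_map p f (x + B)" "c = coord_map p f (x + C)" "z = coord_map p f x"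
    and dist: "A \<noteq> 0" "B \<noteq> 0" "C \<noteq> 0" "A \<noteq> B" "B \<noteq> C" "A \<noteq> C"
  shows "measure lborel (coord_map p f -` (convex hull {z, a, b, c})) =
    \<bar>A$1 * B$2 * C$3 + B$1 * C$2 * A$3 + C$1 * A$2 * B$3 - A$1 * C$2 * B$3 - B$1 * A$2 * C$3 - C$1 * B$2 * A$3\<bar> / 6"
proof -
  define g :: "3 \<Rightarrow> real ^ 3" where "g i = (if i = 1 then x + A else if i = 2 then x + B else x + C)" for i
  have ne: "(2::3) \<noteq> 1" "(3::3) \<noteq> 1" "(3::3) \<noteq> 2" by auto
  have rg: "range g = {x + A, x + B, x + C}"
  proof -
    have "range g = {g 1, g 2, g 3}" by (simp add: UNIV_3)
    also have "\<dots> = {x + A, x + B, x + C}" using ne by (simp add: g_def)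
    finally show ?thesis .
  qed
  have "inj g"
    unfolding inj_def using dist ne by (auto simp: forall_3 g_def)
  moreover have "range g = {x, x + A, x + B, x + C} - {x}" using rg dist by auto
  ultimately have bij: "bij_betw g UNIV ({x, x + A, x + B, x + C} - {x})" by (simp add: bij_betw_def)
  have card: "card {x, x + A, x + B, x + C} = Suc CARD(3)" using dist by auto
  have eq: "{z, a, b, c} = coord_map p f ` {x, x + A, x + B, x + C}" using abc by simp
  have "coord_map p f -` (convex hull {z, a, b, c}) = convex hull {x, x + A, x + B, x + C}"
    unfolding eq by (rule coord_map_affine_hull[where f = f, OF ind])
  moreover have "measure lborel (convex hull {x, x + A, x + B, x + C}) = \<bar>det (\<chi> i j. g j $ i - x $ i)\<bar> / fact CARD(3)"
    by (rule content_simplex[OF _ card _ bij]) auto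
  moreover have "det (\<chi> i j. g j $ i - x $ i) =
    A$1 * B$2 * C$3 + B$1 * C$2 * A$3 + C$1 * A$2 * B$3 - A$1 * C$2 * B$3 - B$1 * A$2 * C$3 - C$1 * B$2 * A$3"
    using ne by (simp add: det_3 g_def algebra_simps)
  ultimately show ?thesis by (simp add: fact_numeral)
qed

lemma measure_hull_real1:
  fixes x y :: "real ^ 1"
  shows "measure lborel (convex hull {x, y}) = \<bar>y $ 1 - x $ 1\<bar>"
proof -
  have le: "measure lborel (convex hull {X, Y}) = Y $ 1 - X $ 1" if XY: "X $ 1 \<le> Y $ 1" for X Y :: "real ^ 1"
  proof -
    define t where "t = Y $ 1 - X $ 1"
    have "convex hull {X, Y} = cbox X Y"
    proof (intro equalityI subsetI)
      fix z assume "z \<in> convex hull {X, Y}"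
      then obtain u where u: "0 \<le> u" "u \<le> 1" "z = (1 - u) *\<^sub>R X + u *\<^sub>R Y"
        by (auto simp: segment_convex_hull[symmetric] closed_segment_def)
      have "z $ 1 = (1 - u) * X $ 1 + u * Y $ 1" unfolding u(3) by simp
      then have "z $ 1 = X $ 1 + u * t" by (simp add: t_def algebra_simps)
      moreover have "0 \<le> u * t" "u * t \<le> t" using u XY by (simp_all add: t_def mult_left_le_one_le)
      ultimately show "z \<in> cbox X Y" by (simp add: mem_box_cart forall_1 t_def)
    next
      fix z assume "z \<in> cbox X Y"
      then have z: "X $ 1 \<le> z $ 1" "z $ 1 \<le> Y $ 1" by (simp_all add: mem_box_cart forall_1)
      define u where "u = (z $ 1 - X $ 1) / t"
      have "t = 0 \<or> t > 0" using XY by (auto simp: t_def)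
      then have "0 \<le> u" "u \<le> 1" using z by (auto simp: u_def) (simp_all add: t_def)
      moreover have "z = (1 - u) *\<^sub>R X + u *\<^sub>R Y"
      proof -
        have "u * t = z $ 1 - X $ 1" using z by (cases "t = 0") (simp_all add: u_def t_def)
        then have "z $ 1 = (1 - u) * X $ 1 + u * Y $ 1" by (simp add: t_def algebra_simps)
        then show ?thesis by (simp add: vec_eq_iff forall_1)
      qed
      ultimately show "z \<in> convex hull {X, Y}"
        by (auto simp: segment_convex_hull[symmetric] closed_segment_def)
    qed
    then show ?thesis
      using XY by (simp add: content_cbox_cart interval_eq_empty_cart forall_1)
  qed
  show ?thesis
    using le[of x y] le[of y x] by (cases "x $ 1 \<le> y $ 1") (simp_all add: insert_commute)
qed

text \<open>The generator chosen inside \<open>lattice_vol\<close> can only be m or - m, so in its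
  coordinate the segment has length t.\<close>

lemma lattice_vol_segment:
  fixes P m :: "'a::euclidean_space"
  assumes m: "m \<noteq> 0" and t: "t > 0" and L: "parallel_lattice L (closed_segment P (P + t *\<^sub>R m)) = range (\<lambda>k::int. of_int k *\<^sub>R m)"
  shows "lattice_vol L (closed_segment P (P + t *\<^sub>R m)) = t"
proof -
  define \<theta> where "\<theta> = closed_segment P (P + t *\<^sub>R m)"
  have "int_span {m} = range (\<lambda>k::int. of_int k *\<^sub>R m)"
    by (auto simp: int_span_def)
  then have B0: "lattice_basis (parallel_lattice L \<theta>) {m}"
    using m L by (simp add: lattice_basis_def \<theta>_def)
  obtain f :: "1 \<Rightarrow> 'a" and p where f: "inj f" "lattice_basis (parallel_lattice L \<theta>) (range f)" "p \<in> \<theta>"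
    "lattice_vol L \<theta> = measure lborel (coord_map p f -` \<theta>)"
    by (rule lattice_vol_eq[OF B0, where 'n = 1]) (auto simp: \<theta>_def)
  define g where "g = f 1"
  have rf: "range f = {g}" by (auto simp: g_def)
  have "int_span {g} = range (\<lambda>k::int. of_int k *\<^sub>R m)"
    using f(2) L by (simp add: lattice_basis_def rf \<theta>_def g_def)
  moreover have "m \<in> range (\<lambda>k::int. of_int k *\<^sub>R m)"
    by (rule range_eqI[of _ _ 1]) simp
  moreover have "g \<in> int_span {g}"
    by (auto simp: int_span_def intro!: exI[of _ "\<lambda>_. 1"])
  ultimately have "m \<in> int_span {g}" "g \<in> range (\<lambda>k::int. of_int k *\<^sub>R m)"
    by simp_all
  then obtain j k :: int where jk: "m = of_int j *\<^sub>R g" "g = of_int k *\<^sub>R m"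
    by (auto simp: int_span_def)
  then have "m = of_int (j * k) *\<^sub>R m" by (metis of_int_mult scaleR_scaleR)
  then have "j * k = 1" using m by (metis of_int_eq_1_iff scaleR_one scaleR_right_imp_eq)
  then have j: "j = 1 \<or> j = - 1" by (auto simp: zmult_eq_1_iff)
  obtain s where s: "p = P + (s * t) *\<^sub>R m" "0 \<le> s" "s \<le> 1"
    using f(3) unfolding \<theta>_def closed_segment_def by (auto simp: algebra_simps)
  have gne: "g \<noteq> 0" using jk m by auto
  have cm: "coord_map p f x = p + x $ 1 *\<^sub>R g" for x
    by (simp add: coord_map_def g_def UNIV_1 sum_1)
  have ind: "x = 0" if "(\<Sum>i\<in>UNIV. x $ i *\<^sub>R f i) = 0" for x :: "real ^ 1"
    using that gne by (simp add: sum_1 g_def vec_eq_iff)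
  define x y :: "real ^ 1" where "x = (\<chi> i. - (s * t) * j)" and "y = (\<chi> i. (t - s * t) * j)"
  have jj: "real_of_int j * real_of_int j = 1" using j by auto
  have gm: "g = of_int j *\<^sub>R m" using jk(1) jj by simp
  have "P = coord_map p f x" "P + t *\<^sub>R m = coord_map p f y"
  proof -
    have "x $ 1 *\<^sub>R g = (- (s * t)) *\<^sub>R m" "y $ 1 *\<^sub>R g = (t - s * t) *\<^sub>R m"
      unfolding gm scaleR_scaleR by (simp_all add: x_def y_def mult.assoc jj)
    then have "coord_map p f x = p + (- (s * t)) *\<^sub>R m" "coord_map p f y = p + (t - s * t) *\<^sub>R m"
      unfolding cm by simp_all
    then show "P = coord_map p f x" "P + t *\<^sub>R m = coord_map p f y"
      unfolding s(1) by (simp_all add: algebra_simps)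
  qed
  then have eq: "\<theta> = convex hull (coord_map p f ` {x, y})"
    by (simp add: \<theta>_def segment_convex_hull)
  have "coord_map p f -` \<theta> = convex hull {x, y}"
    unfolding eq by (rule coord_map_affine_hull[where f = f, OF ind])
  moreover have "measure lborel (convex hull {x, y}) = t"
    using j t by (auto simp: measure_hull_real1 x_def y_def algebra_simps)
  ultimately show ?thesis using f(4) by (simp add: \<theta>_def)
qed

section \<open>The triangulated boundary\<close>

context weighted_fan
begin

text \<open>The union of the closed cones is closed and contains all generic vectors; its complement
  is open and null, hence empty.\<close>

lemma cover:
  obtains a b c u v w where "(a, b, c) \<in> facets" "x = u *\<^sub>R a + v *\<^sub>R b + w *\<^sub>R c" "u \<ge> 0" "v \<ge> 0" "w \<ge> 0"
proof -
  define U where "U = (\<Union>(a, b, c)\<in>facets. {x. det3 x b c \<ge> 0 \<and> det3 a x c \<ge> 0 \<and> det3 a b x \<ge> 0})"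
  have cont: "continuous_on UNIV (\<lambda>x. det3 x b c)" "continuous_on UNIV (\<lambda>x. det3 a x c)" "continuous_on UNIV (\<lambda>x. det3 a b x)" for a b c
    unfolding det3_coords by (intro continuous_intros)+
  have "closed {x. det3 x b c \<ge> 0 \<and> det3 a x c \<ge> 0 \<and> det3 a b x \<ge> 0}" for a b c
    by (intro closed_Collect_conj closed_Collect_le continuous_on_const cont)
  then have "closed U"
    unfolding U_def using finite_facets by (intro closed_UN) auto
  moreover have "- U \<subseteq> {x. \<not> generic_vec x}"
    using exists_facet by (fastforce simp: U_def in_cone_def less_imp_le)
  then have "negligible (- U)" using negligible_subset[OF negligible_non_generic] by blast
  ultimately have "- U = {}" using open_not_negligible by (metis open_Compl)
  then have "x \<in> U" by blast
  then obtain a b c where f: "(a, b, c) \<in> facets" and d: "det3 x b c \<ge> 0" "det3 a x c \<ge> 0" "det3 a b x \<ge> 0"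
    by (auto simp: U_def)
  have "det3 a b c > 0" using facetsD(4)[OF f] .
  then show thesis
    using coords_of[of a b c x] d
    by (intro that[OF f, of "det3 x b c / det3 a b c" "det3 a x c / det3 a b c" "det3 a b x / det3 a b c"]) auto
qed

lemma sum_facet_sets:
  fixes h :: "'a set \<Rightarrow> real"
  assumes "\<T> \<subseteq> facets" "\<And>a b c. (a, b, c) \<in> \<T> \<Longrightarrow> (b, c, a) \<in> \<T>"
  shows "(\<Sum>(a, b, c)\<in>\<T>. h {a, b, c}) = 3 * sum h ((\<lambda>(a, b, c). {a, b, c}) ` \<T>)"
proof -
  have fin: "finite \<T>" using assms(1) finite_facets finite_subset by blast
  have "(\<Sum>(a, b, c)\<in>\<T>. h {a, b, c})
      = (\<Sum>S\<in>(\<lambda>(a, b, c). {a, b, c}) ` \<T>. \<Sum>t\<in>{t \<in> \<T>. (case t of (a, b, c) \<Rightarrow> {a, b, c}) = S}. case t of (a, b, c) \<Rightarrow> h {a, b, c})"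
    by (rule sum.image_gen[OF fin])
  also have "\<dots> = (\<Sum>S\<in>(\<lambda>(a, b, c). {a, b, c}) ` \<T>. 3 * h S)"
  proof (rule sum.cong[OF refl])
    fix S assume "S \<in> (\<lambda>(a, b, c). {a, b, c}) ` \<T>"
    then obtain a b c where abc: "(a, b, c) \<in> \<T>" "S = {a, b, c}" by auto
    then have f: "(a, b, c) \<in> facets" using assms(1) by blast
    have eq: "{t \<in> \<T>. (case t of (a, b, c) \<Rightarrow> {a, b, c}) = S} = {(a, b, c), (b, c, a), (c, a, b)}"
      using facets_same_set[OF f] assms abc by (auto; blast)
    have "(\<Sum>t\<in>{t \<in> \<T>. (case t of (a, b, c) \<Rightarrow> {a, b, c}) = S}. case t of (a, b, c) \<Rightarrow> h {a, b, c})
        = (\<Sum>t\<in>{t \<in> \<T>. (case t of (a, b, c) \<Rightarrow> {a, b, c}) = S}. h S)"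
      by (intro sum.cong) auto
    also have "\<dots> = 3 * h S"
      unfolding eq using card_facets_perm[OF f] by simp
    finally show "(\<Sum>t\<in>{t \<in> \<T>. (case t of (a, b, c) \<Rightarrow> {a, b, c}) = S}. case t of (a, b, c) \<Rightarrow> h {a, b, c}) = 3 * h S" .
  qed
  finally show ?thesis by (simp add: sum_distrib_left)
qed

text \<open>An edge accounts for two triples, one for each direction and thus for each adjacent
  triangle.\<close>

lemma sum_edge_sets:
  assumes "\<T> \<subseteq> facets" "\<And>a b c. (a, b, c) \<in> \<T> \<Longrightarrow> (b, a, opp b a) \<in> \<T>"
  shows "card \<T> = 2 * card ((\<lambda>(a, b, c). {a, b}) ` \<T>)"
proof -
  have fin: "finite \<T>" using assms(1) finite_facets finite_subset by blast
  have "card \<T> = (\<Sum>t\<in>\<T>. 1)" by simp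
  also have "\<dots> = (\<Sum>S\<in>(\<lambda>(a, b, c). {a, b}) ` \<T>. \<Sum>t\<in>{t \<in> \<T>. (case t of (a, b, c) \<Rightarrow> {a, b}) = S}. 1)"
    by (rule sum.image_gen[OF fin])
  also have "\<dots> = (\<Sum>S\<in>(\<lambda>(a, b, c). {a, b}) ` \<T>. 2)"
  proof (rule sum.cong[OF refl])
    fix S assume "S \<in> (\<lambda>(a, b, c). {a, b}) ` \<T>"
    then obtain a b c where abc: "(a, b, c) \<in> \<T>" "S = {a, b}" by auto
    then have f: "(a, b, c) \<in> facets" using assms(1) by blast
    have "(a', b', c') \<in> {(a, b, c), (b, a, opp b a)}" if "(a', b', c') \<in> \<T>" "{a', b'} = S" for a' b' c'
    proof -
      have f': "(a', b', c') \<in> facets" using that assms(1) by blast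
      have "(a' = a \<and> b' = b) \<or> (a' = b \<and> b' = a)"
        using that(2) abc(2) by (auto simp: doubleton_eq_iff)
      then show ?thesis using opp_eq[OF f] opp_eq[OF f'] by auto
    qed
    then have "{t \<in> \<T>. (case t of (a, b, c) \<Rightarrow> {a, b}) = S} = {(a, b, c), (b, a, opp b a)}"
      using abc assms(2)[OF abc(1)] by (auto; blast)
    then show "(\<Sum>t\<in>{t \<in> \<T>. (case t of (a, b, c) \<Rightarrow> {a, b}) = S}. 1) = 2"
      using facets_distinct[OF f] by simp
  qed
  finally show ?thesis by simp
qed

end

section \<open>Lattice points and supporting functionals of the polytope\<close>

locale canonical_polytope = lattice3 b1 b2 b3 d1 d2 d3 for b1 b2 b3 d1 d2 d3 :: "'a::euclidean_space" +
  fixes \<Delta> :: "'a set"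
  assumes dim3: "DIM('a) = 3"
    and polytope: "polytope \<Delta>"
    and zero_interior: "0 \<in> interior \<Delta>"
    and vertices: "\<And>x. x extreme_point_of \<Delta> \<Longrightarrow> x \<in> latt"
    and canonical: "\<And>x s. x \<in> \<Delta> \<Longrightarrow> 0 \<le> s \<Longrightarrow> s < 1 \<Longrightarrow> s *\<^sub>R x \<in> latt \<Longrightarrow> s *\<^sub>R x = 0"
begin

definition pts :: "'a set" where
  "pts = {x \<in> latt \<inter> \<Delta>. x \<noteq> 0}"

lemma \<Delta>: "convex \<Delta>" "compact \<Delta>" "polyhedron \<Delta>" "0 \<in> \<Delta>"
  using polytope zero_interior interior_subset
  by (auto simp: polytope_imp_convex polytope_imp_compact polytope_imp_polyhedron)

lemma aff_dim_\<Delta>: "aff_dim \<Delta> = 3"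
proof -
  have "interior \<Delta> \<noteq> {}" using zero_interior by blast
  then show ?thesis using dim3 by (metis aff_dim_nonempty_interior of_nat_numeral)
qed

lemma finite_pts: "finite pts"
proof -
  obtain C where C: "\<And>x. x \<in> \<Delta> \<Longrightarrow> norm x \<le> C"
    using compact_imp_bounded[OF \<Delta>(2)] by (auto simp: bounded_iff)
  define K where "K = (norm d1 + norm d2 + norm d3) * C"
  have C0: "0 \<le> C" using C[OF \<Delta>(4)] by simp
  define F where "F x = (\<lfloor>d1 \<bullet> x\<rfloor>, \<lfloor>d2 \<bullet> x\<rfloor>, \<lfloor>d3 \<bullet> x\<rfloor>)" for x
  have bd: "\<bar>d \<bullet> x\<bar> \<le> K" if "x \<in> \<Delta>" "d \<in> {d1, d2, d3}" for x d
  proof -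
    have "\<bar>d \<bullet> x\<bar> \<le> norm d * norm x" by (rule Cauchy_Schwarz_ineq2)
    also have "\<dots> \<le> (norm d1 + norm d2 + norm d3) * C"
      using C[OF that(1)] that(2) by (intro mult_mono) auto
    finally show ?thesis by (simp add: K_def)
  qed
  have fl: "\<lfloor>d \<bullet> x\<rfloor> \<in> {\<lfloor>- K\<rfloor>..\<lceil>K\<rceil>}" if "x \<in> \<Delta>" "d \<in> {d1, d2, d3}" for x d
    using bd[OF that] by (auto intro!: floor_mono simp: floor_le_iff) linarith+
  have "F ` pts \<subseteq> {\<lfloor>- K\<rfloor>..\<lceil>K\<rceil>} \<times> {\<lfloor>- K\<rfloor>..\<lceil>K\<rceil>} \<times> {\<lfloor>- K\<rfloor>..\<lceil>K\<rceil>}"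
    using fl by (auto simp: F_def pts_def)
  then have "finite (F ` pts)" by (rule finite_subset) auto
  moreover have "inj_on F pts"
  proof (rule inj_onI)
    fix x y assume xy: "x \<in> pts" "y \<in> pts" "F x = F y"
    have v: "real_of_int \<lfloor>d1 \<bullet> z\<rfloor> = d1 \<bullet> z" "real_of_int \<lfloor>d2 \<bullet> z\<rfloor> = d2 \<bullet> z" "real_of_int \<lfloor>d3 \<bullet> z\<rfloor> = d3 \<bullet> z" if "z \<in> pts" for z
      using that by (auto simp: pts_def latt_def)
    have "d1 \<bullet> x = d1 \<bullet> y" "d2 \<bullet> x = d2 \<bullet> y" "d3 \<bullet> x = d3 \<bullet> y"
      using v[OF xy(1)] v[OF xy(2)] xy(3) unfolding F_def by (metis Pair_inject)+
    then show "x = y" by (rule vec_eqI)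
  qed
  ultimately show ?thesis by (rule finite_imageD)
qed

lemma extreme_pts: "x extreme_point_of \<Delta> \<Longrightarrow> x \<in> pts"
  using vertices extreme_point_not_in_interior[of x \<Delta>] zero_interior
  by (auto simp: pts_def extreme_point_of_def)

lemma hull_pts: "\<Delta> = convex hull pts"
proof
  have "\<Delta> = convex hull {x. x extreme_point_of \<Delta>}"
    using Krein_Milman_Minkowski \<Delta> by blast
  also have "\<dots> \<subseteq> convex hull pts" using extreme_pts by (intro hull_mono) auto
  finally show "\<Delta> \<subseteq> convex hull pts" .
  show "convex hull pts \<subseteq> \<Delta>" using \<Delta>(1) by (intro hull_minimal) (auto simp: pts_def)
qed

lemma le_on_\<Delta>:
  assumes "\<And>p. p \<in> pts \<Longrightarrow> y \<bullet> p \<le> c" "x \<in> \<Delta>"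
  shows "y \<bullet> x \<le> c"
proof -
  have "convex hull pts \<subseteq> {x. y \<bullet> x \<le> c}"
    using assms(1) by (intro hull_minimal) (auto simp: convex_halfspace_le)
  then show ?thesis using assms(2) hull_pts by auto
qed

lemma le_zero_imp_zero:
  assumes "\<And>x. x \<in> \<Delta> \<Longrightarrow> y \<bullet> x \<le> 0"
  shows "y = 0"
proof (rule ccontr)
  assume "y \<noteq> 0"
  obtain e where e: "e > 0" "cball 0 e \<subseteq> \<Delta>"
    using zero_interior mem_interior_cball by blast
  define x where "x = (e / norm y) *\<^sub>R y"
  have "norm x \<le> e" using \<open>y \<noteq> 0\<close> e by (simp add: x_def)
  then have "x \<in> \<Delta>" using e by auto
  moreover have "y \<bullet> x > 0" using \<open>y \<noteq> 0\<close> e by (simp add: x_def)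
  ultimately show False using assms by fastforce
qed

lemma surround_pts:
  assumes "y \<noteq> 0"
  shows "\<exists>p\<in>pts. y \<bullet> p < 0"
proof (rule ccontr)
  assume "\<not> ?thesis"
  then have "(- y) \<bullet> p \<le> 0" if "p \<in> pts" for p using that by (auto simp: not_less)
  then have "- y = 0" using le_on_\<Delta>[of "- y" 0] by (intro le_zero_imp_zero) auto
  then show False using assms by simp
qed

text \<open>An exposing functional attains a positive maximum because the origin is an interior
  point, so it can be normalized to 1.\<close>

lemma face_functional:
  assumes "\<theta> face_of \<Delta>" "\<theta> \<noteq> {}" "\<theta> \<noteq> \<Delta>"
  obtains y where "\<And>x. x \<in> \<Delta> \<Longrightarrow> y \<bullet> x \<le> 1" "\<theta> = \<Delta> \<inter> {x. y \<bullet> x = 1}"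
proof -
  have "\<theta> exposed_face_of \<Delta>" using assms(1) exposed_face_of_polyhedron[OF \<Delta>(3)] by simp
  then obtain a \<beta> where a: "a \<noteq> 0" "\<Delta> \<subseteq> {x. a \<bullet> x \<le> \<beta>}" "\<theta> = \<Delta> \<inter> {x. a \<bullet> x = \<beta>}"
    using assms unfolding exposed_face_of by blast
  have "\<beta> \<ge> 0" using a(2) \<Delta>(4) by auto
  moreover have "\<beta> \<noteq> 0" using a(1,2) le_zero_imp_zero[of a] by auto
  ultimately have \<beta>: "\<beta> > 0" by simp
  show thesis
    using a(2,3) \<beta> by (intro that[of "(1 / \<beta>) *\<^sub>R a"]) (auto simp: field_simps)
qed

end

text \<open>\<open>weights\<close> records what the lifting achieves when the functional of a triple
  respects the weight of p: p is not beyond the plane of a, b, c, so the triangles lie on the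
  boundary, and p is no additional point of the triangle, so the triangles are empty.\<close>

locale fan_polytope = canonical_polytope b1 b2 b3 d1 d2 d3 \<Delta>
  for b1 b2 b3 d1 d2 d3 :: "'a::euclidean_space" and \<Delta> +
  fixes r :: "'a \<Rightarrow> real"
  assumes wf: "weighted_fan b1 b2 b3 d1 d2 d3 pts r"
    and weights: "\<And>a b c p e f g. a \<in> pts \<Longrightarrow> b \<in> pts \<Longrightarrow> c \<in> pts \<Longrightarrow> p \<in> pts \<Longrightarrow> det3 a b c \<noteq> 0 \<Longrightarrow>
       p = e *\<^sub>R a + f *\<^sub>R b + g *\<^sub>R c \<Longrightarrow> e * r a + f * r b + g * r c \<le> r p \<Longrightarrow>
       e + f + g \<le> 1 \<and> (e \<ge> 0 \<and> f \<ge> 0 \<and> g \<ge> 0 \<and> e + f + g = 1 \<longrightarrow> p \<in> {a, b, c})"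

sublocale fan_polytope \<subseteq> weighted_fan b1 b2 b3 d1 d2 d3 pts r
  by (rule wf)

context fan_polytope
begin

lemma facet_weights:
  assumes f: "(a, b, c) \<in> facets" and p: "p \<in> pts" "p = e *\<^sub>R a + f *\<^sub>R b + g *\<^sub>R c"
  shows "e + f + g \<le> 1 \<and> (e \<ge> 0 \<and> f \<ge> 0 \<and> g \<ge> 0 \<and> e + f + g = 1 \<longrightarrow> p \<in> {a, b, c})"
proof -
  note D = facetsD[OF f]
  have "e * r a + f * r b + g * r c = supp a b c \<bullet> p"
    using D(5-7) by (simp add: p(2) inner_add_right)
  also have "\<dots> \<le> r p" using D(8) p(1) by blast
  finally show ?thesis using weights[OF D(1-3) p(1) _ p(2)] D(4) by simp
qed

text \<open>A lattice point below the triangle is a contraction of a point of the polytope, hence 0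
  by \<open>canonical\<close>; one on the triangle is a vertex by the choice of weights.\<close>

lemma facet_empty_simplex:
  assumes f: "(a, b, c) \<in> facets"
  shows "empty_simplex a b c"
  unfolding empty_simplex_def
proof (intro allI impI, elim conjE)
  fix u v w :: real
  assume uvw: "0 \<le> u" "0 \<le> v" "0 \<le> w" "u + v + w \<le> 1" and l: "u *\<^sub>R a + v *\<^sub>R b + w *\<^sub>R c \<in> latt"
  define z where "z = u *\<^sub>R a + v *\<^sub>R b + w *\<^sub>R c"
  note D = facetsD[OF f]
  have abc: "a \<in> \<Delta>" "b \<in> \<Delta>" "c \<in> \<Delta>" using D by (auto simp: pts_def)
  have d: "det3 a b c \<noteq> 0" using D(4) by simp
  show "u \<in> {0, 1} \<and> v \<in> {0, 1} \<and> w \<in> {0, 1}"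
  proof (cases "u + v + w < 1")
    case True
    have "z = 0"
    proof (cases "u + v + w = 0")
      case True
      then have "u = 0" "v = 0" "w = 0" using uvw by linarith+
      then show ?thesis by (simp add: z_def)
    next
      case False
      define s where "s = u + v + w"
      have s: "s > 0" "s < 1" using False True uvw by (auto simp: s_def)
      have "(u / s) *\<^sub>R a + (v / s) *\<^sub>R b + (w / s) *\<^sub>R c \<in> convex hull {a, b, c}"
        unfolding convex_hull_3 using s uvw
        by (intro CollectI exI[of _ "u / s"] exI[of _ "v / s"] exI[of _ "w / s"])
           (auto simp: add_divide_distrib[symmetric] s_def)
      also have "\<dots> \<subseteq> \<Delta>" using abc \<Delta>(1) by (intro hull_minimal) auto
      finally have "(u / s) *\<^sub>R a + (v / s) *\<^sub>R b + (w / s) *\<^sub>R c \<in> \<Delta>" .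
      moreover have zs: "s *\<^sub>R ((u / s) *\<^sub>R a + (v / s) *\<^sub>R b + (w / s) *\<^sub>R c) = z"
        using s by (simp add: z_def scaleR_add_right)
      ultimately show ?thesis
        using canonical[of "(u / s) *\<^sub>R a + (v / s) *\<^sub>R b + (w / s) *\<^sub>R c" s] s l by (simp add: z_def)
    qed
    then have "u = 0" "v = 0" "w = 0"
      using coords_unique[OF d, of u v w 0 0 0] by (simp_all add: z_def)
    then show ?thesis by simp
  next
    case False
    then have s: "u + v + w = 1" using uvw by simp
    have "z \<in> convex hull {a, b, c}"
      unfolding convex_hull_3 z_def using s uvw by blast
    also have "\<dots> \<subseteq> \<Delta>" using abc \<Delta>(1) by (intro hull_minimal) auto
    finally have "z \<in> \<Delta>" .
    moreover have "z \<noteq> 0"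
      using coords_unique[OF d, of u v w 0 0 0] s by (auto simp: z_def)
    ultimately have "z \<in> pts" using l by (simp add: pts_def z_def)
    from facet_weights[OF f this z_def] have "z \<in> {a, b, c}" using uvw s by blast
    then show ?thesis
      using coords_unique[OF d, of u v w 1 0 0] coords_unique[OF d, of u v w 0 1 0] coords_unique[OF d, of u v w 0 0 1]
      by (auto simp: z_def)
  qed
qed

end

sublocale fan_polytope \<subseteq> empty_fan b1 b2 b3 d1 d2 d3 pts r
  by unfold_locales (auto simp: pts_def facet_empty_simplex)

context fan_polytope
begin

lemma level_le:
  assumes f: "(a, b, c) \<in> facets" and x: "x \<in> \<Delta>"
  shows "level a b c \<bullet> x \<le> 1"
proof (rule le_on_\<Delta>[OF _ x])
  fix p assume p: "p \<in> pts"
  have "det3 a b c \<noteq> 0" using facetsD(4)[OF f] by simp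
  from facet_weights[OF f p coords_of[OF this, of p]]
  have "level a b c \<bullet> ((det3 p b c / det3 a b c) *\<^sub>R a + (det3 a p c / det3 a b c) *\<^sub>R b + (det3 a b p / det3 a b c) *\<^sub>R c) \<le> 1"
    by (simp add: inner_add_right level_inner[OF f])
  then show "level a b c \<bullet> p \<le> 1" using coords_of[OF \<open>det3 a b c \<noteq> 0\<close>, of p] by simp
qed

section \<open>Two-dimensional faces and their lattice distances\<close>

definition fac :: "'a \<Rightarrow> 'a \<Rightarrow> 'a \<Rightarrow> 'a set" where
  "fac a b c = \<Delta> \<inter> {x. level a b c \<bullet> x = 1}"

lemma facet_in_\<Delta>: "(a, b, c) \<in> facets \<Longrightarrow> a \<in> \<Delta> \<and> b \<in> \<Delta> \<and> c \<in> \<Delta>"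
  using facetsD(1-3)[of a b c] by (auto simp: pts_def)

lemma facet_latt: "(a, b, c) \<in> facets \<Longrightarrow> a \<in> latt \<and> b \<in> latt \<and> c \<in> latt"
  using facetsD(1-3)[of a b c] by (auto simp: pts_def)

lemma fac_face: "(a, b, c) \<in> facets \<Longrightarrow> fac a b c face_of \<Delta>"
  unfolding fac_def using level_le \<Delta>(1) by (intro face_of_Int_supporting_hyperplane_le) auto

lemma in_fac: "(a, b, c) \<in> facets \<Longrightarrow> a \<in> fac a b c \<and> b \<in> fac a b c \<and> c \<in> fac a b c"
  using facet_in_\<Delta> level_inner by (auto simp: fac_def)

lemma aff_dim_triangle:
  assumes "det3 a b c \<noteq> 0"
  shows "aff_dim {a, b, c} = 2"
proof -
  have "a \<noteq> b" using assms by auto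
  moreover have "c \<notin> affine hull {a, b}"
    using assms by (auto simp: affine_hull_2 det3_lin)
  moreover have "{a, b, c} = insert c {a, b}" by auto
  ultimately show ?thesis by (simp only: aff_dim_insert[of c] aff_dim_2) simp
qed

lemma aff_dim_fac:
  assumes f: "(a, b, c) \<in> facets"
  shows "aff_dim (fac a b c) = 2"
proof -
  have "aff_dim {a, b, c} \<le> aff_dim (fac a b c)" using in_fac[OF f] by (intro aff_dim_subset) auto
  moreover have "0 \<notin> fac a b c" by (simp add: fac_def)
  then have "fac a b c \<noteq> \<Delta>" using \<Delta>(4) by auto
  then have "aff_dim (fac a b c) < aff_dim \<Delta>"
    using face_of_aff_dim_lt[OF \<Delta>(1) fac_face[OF f]] by simp
  ultimately show ?thesis using aff_dim_triangle[of a b c] facetsD(4)[OF f] aff_dim_\<Delta> by simp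
qed

text \<open>The coefficients add up to at most 1 by \<open>level_le\<close>, while y is 1 at x and
  at most 1 at the vertices; both bounds must be sharp. So the vertices that are really used to
  represent a point of a face belong to that face.\<close>

lemma face_coords:
  assumes y: "\<And>x. x \<in> \<Delta> \<Longrightarrow> y \<bullet> x \<le> 1" and x: "x \<in> \<Delta>" "y \<bullet> x = 1"
    and f: "(a, b, c) \<in> facets" and xe: "x = u *\<^sub>R a + v *\<^sub>R b + w *\<^sub>R c" "u \<ge> 0" "v \<ge> 0" "w \<ge> 0"
  shows "u + v + w = 1" "u > 0 \<longrightarrow> y \<bullet> a = 1" "v > 0 \<longrightarrow> y \<bullet> b = 1" "w > 0 \<longrightarrow> y \<bullet> c = 1"
proof -
  have "u + v + w \<le> 1"
    using level_le[OF f x(1)] by (simp add: xe(1) inner_add_right level_inner[OF f])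
  moreover have "u * (y \<bullet> a) + v * (y \<bullet> b) + w * (y \<bullet> c) = 1"
    using x(2) by (simp add: xe(1) inner_add_right)
  moreover have nn: "0 \<le> u * (1 - y \<bullet> a)" "0 \<le> v * (1 - y \<bullet> b)" "0 \<le> w * (1 - y \<bullet> c)"
    using y facet_in_\<Delta>[OF f] xe by simp_all
  moreover have "u * (1 - y \<bullet> a) + v * (1 - y \<bullet> b) + w * (1 - y \<bullet> c) = u + v + w - (u * (y \<bullet> a) + v * (y \<bullet> b) + w * (y \<bullet> c))"
    by (simp add: algebra_simps)
  ultimately have "u + v + w = 1" "u * (1 - y \<bullet> a) = 0" "v * (1 - y \<bullet> b) = 0" "w * (1 - y \<bullet> c) = 0"
    by linarith+
  then show "u + v + w = 1" "u > 0 \<longrightarrow> y \<bullet> a = 1" "v > 0 \<longrightarrow> y \<bullet> b = 1" "w > 0 \<longrightarrow> y \<bullet> c = 1"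
    by auto
qed

lemma facet_face_eq:
  assumes \<theta>: "\<theta> face_of \<Delta>" "\<theta> \<noteq> \<Delta>" and f: "(a, b, c) \<in> facets" and abc: "a \<in> \<theta>" "b \<in> \<theta>" "c \<in> \<theta>"
  shows "\<theta> = fac a b c"
proof -
  obtain y where y: "\<And>x. x \<in> \<Delta> \<Longrightarrow> y \<bullet> x \<le> 1" "\<theta> = \<Delta> \<inter> {x. y \<bullet> x = 1}"
    using face_functional[OF \<theta>(1) _ \<theta>(2)] abc by blast
  have "y = level a b c"
    using abc level_inner[OF f] facetsD(4)[OF f] by (intro dual_eqI3[of a b c]) (auto simp: y(2))
  then show ?thesis using y(2) by (simp add: fac_def)
qed

text \<open>The pyramid over the face with apex 0 has interior points and hence contains a generic
  vector; all vertices of the triangle whose cone contains it lie in the face.\<close>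

lemma face_contains_facet:
  assumes \<theta>: "\<theta> face_of \<Delta>" "aff_dim \<theta> = 2"
  obtains a b c where "(a, b, c) \<in> facets" "\<theta> = fac a b c"
proof -
  have "\<theta> \<noteq> \<Delta>" "\<theta> \<noteq> {}" using \<theta>(2) aff_dim_\<Delta> by auto
  then obtain y where y: "\<And>x. x \<in> \<Delta> \<Longrightarrow> y \<bullet> x \<le> 1" "\<theta> = \<Delta> \<inter> {x. y \<bullet> x = 1}"
    using face_functional[OF \<theta>(1)] by blast
  define K where "K = convex hull (insert 0 \<theta>)"
  have "affine hull \<theta> \<subseteq> {x. y \<bullet> x = 1}"
    by (intro hull_minimal) (auto simp: y(2) affine_hyperplane)
  then have "0 \<notin> affine hull \<theta>" by auto
  then have "aff_dim K = 3" using \<theta>(2) by (simp add: K_def aff_dim_convex_hull aff_dim_insert)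
  then have "aff_dim K = DIM('a)" using dim3 by simp
  moreover have "rel_interior K \<noteq> {}" by (simp add: K_def rel_interior_eq_empty)
  ultimately have "interior K \<noteq> {}" by (simp add: interior_rel_interior_gen)
  then have "\<not> negligible K" using negligible_convex_interior[of K] by (simp add: K_def)
  then obtain z where z: "z \<in> K" "generic_vec z"
    using negligible_subset[OF negligible_non_generic, of K] by blast
  have conv\<theta>: "convex \<theta>" using face_of_imp_convex[OF \<theta>(1)] .
  obtain x s where x: "x \<in> \<theta>" "0 \<le> s" "z = s *\<^sub>R x"
  proof -
    have "z \<in> (\<Union>x\<in>\<theta>. closed_segment 0 x)"
      using z(1) \<open>\<theta> \<noteq> {}\<close> conv\<theta> by (auto simp: K_def convex_hull_insert_segments hull_same)
    then show thesis using that by (auto simp: closed_segment_def)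
  qed
  have "s \<noteq> 0" using generic_nonzero[OF z(2)] x(3) by auto
  then have s: "s > 0" using x(2) by simp
  obtain a b c where f: "(a, b, c) \<in> facets" "in_cone a b c z" using exists_facet[OF z(2)] by blast
  obtain u v w where uvw: "z = u *\<^sub>R a + v *\<^sub>R b + w *\<^sub>R c" "u > 0" "v > 0" "w > 0"
    using in_cone_coords[OF f] .
  have xe: "x = (u / s) *\<^sub>R a + (v / s) *\<^sub>R b + (w / s) *\<^sub>R c"
  proof -
    have "x = (1 / s) *\<^sub>R z" using x(3) s by simp
    then show ?thesis by (simp add: uvw(1) scaleR_add_right)
  qed
  have "y \<bullet> a = 1" "y \<bullet> b = 1" "y \<bullet> c = 1"
    using face_coords[OF y(1) _ _ f(1) xe] x(1) y(2) uvw s by auto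
  then have "a \<in> \<theta>" "b \<in> \<theta>" "c \<in> \<theta>" using facet_in_\<Delta>[OF f(1)] y(2) by auto
  then show thesis using that[OF f(1)] facet_face_eq[OF \<theta>(1) \<open>\<theta> \<noteq> \<Delta>\<close> f(1)] by blast
qed

text \<open>The candidate normal is - det (a, b, c) times the level, an integral combination of
  cross products. It is primitive because it takes the value - 1 at a lattice vector, found from the
  coprimality of p + q - 1 and n.\<close>

lemma lattice_distance_fac:
  assumes f: "(a, b, c) \<in> facets"
  shows "real (lattice_distance latt \<Delta> (fac a b c)) = det3 a b c"
proof -
  note D = facetsD[OF f]
  have l: "a \<in> latt" "b \<in> latt" "c \<in> latt" using facet_latt[OF f] by auto
  obtain i where i: "det3 a b c = of_int i" using det3_Ints[OF l] by (auto elim: Ints_cases)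
  define n where "n = nat i"
  have n: "det3 a b c = real n" "n > 0" using i D(4) by (simp_all add: n_def)
  have ni: "det3 a b c = of_int (int n)" "int n > 0" using n by simp_all
  obtain p q e where tw: "terminal_weights (int n) p q" and e: "e \<in> latt" "of_int (int n) *\<^sub>R e = c - of_int p *\<^sub>R a - of_int q *\<^sub>R b"
    using empty_simplex_weights[OF facet_empty_simplex[OF f] l ni] by metis
  interpret terminal_weights "int n" p q by fact
  define L where "L = level a b c"
  have L: "L \<bullet> a = 1" "L \<bullet> b = 1" "L \<bullet> c = 1" using level_inner[OF f] by (simp_all add: L_def)
  have Le: "real n * (L \<bullet> e) = of_int (1 - p - q)"
  proof -
    have "real n * (L \<bullet> e) = L \<bullet> (of_int (int n) *\<^sub>R e)" by simp
    then show ?thesis unfolding e(2) by (simp add: inner_diff_right L)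
  qed
  obtain j k where jk: "j * (p + q - 1) + k * int n = 1"
    using coprime_sum by (metis coprime_iff_gcd_eq_1 bezout_int)
  \<comment> \<open>The level is (1 - p - q) / n at e and 1 at a, so the Bezout coefficients produce
    a lattice vector where it is 1 / n.\<close>
  define x0 where "x0 = of_int (- j) *\<^sub>R e + of_int k *\<^sub>R a"
  have x0: "x0 \<in> latt" unfolding x0_def using e l by (intro latt_add latt_int_scale)
  have Lx0: "real n * (L \<bullet> x0) = 1"
  proof -
    have "real n * (L \<bullet> x0) = - of_int j * (real n * (L \<bullet> e)) + of_int k * real n"
      by (simp add: x0_def inner_add_right L algebra_simps)
    also have "\<dots> = of_int (j * (p + q - 1) + k * int n)" unfolding Le by (simp add: algebra_simps)
    finally show ?thesis using jk by simp
  qed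
  define m where "m = - (real n *\<^sub>R L)"
  have mM: "m \<in> dual_lattice latt"
  proof -
    have "real n *\<^sub>R L = cross b c + cross c a + cross a b"
      using n by (simp add: L_def level_def dual_fun_def)
    moreover have "x + y \<in> dual_lattice latt" if "x \<in> dual_lattice latt" "y \<in> dual_lattice latt" for x y
      using that by (simp add: dual_lattice_def inner_add_left)
    moreover have "- x \<in> dual_lattice latt" if "x \<in> dual_lattice latt" for x
      using that by (simp add: dual_lattice_def)
    ultimately show ?thesis using cross_dual_lattice l unfolding m_def by metis
  qed
  have unit: "k = 1" if km: "m' \<in> dual_lattice latt" "m = real k *\<^sub>R m'" for k m'
  proof -
    obtain i where i: "m' \<bullet> x0 = of_int i" using km(1) x0 by (auto simp: dual_lattice_def elim: Ints_cases)
    have "m \<bullet> x0 = - 1" using Lx0 by (simp add: m_def)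
    then have "real_of_int (int k * i) = - 1" using km(2) i by simp
    then have "int k * (- i) = 1" by linarith
    from iffD1[OF zmult_eq_1_iff this] have "int k = 1" by auto
    then show ?thesis by simp
  qed
  have facm: "fac a b c = \<Delta> \<inter> {x. - (m \<bullet> x) = real n}"
    using n by (auto simp: fac_def m_def L_def)
  have prim: "primitive_in (dual_lattice latt) m"
  proof -
    have "m \<noteq> 0" using L n by (auto simp: m_def)
    then show ?thesis unfolding primitive_in_def using mM unit by blast
  qed
  have "lattice_distance latt \<Delta> (fac a b c) = n"
    unfolding lattice_distance_def
  proof (rule the_equality)
    show "n > 0 \<and> (\<exists>m. primitive_in (dual_lattice latt) m \<and> fac a b c = \<Delta> \<inter> {x. - (m \<bullet> x) = real n})"
      using n prim facm by blast
    fix n' assume "n' > 0 \<and> (\<exists>m. primitive_in (dual_lattice latt) m \<and> fac a b c = \<Delta> \<inter> {x. - (m \<bullet> x) = real n'})"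
    then obtain m' where n': "n' > 0" and m': "primitive_in (dual_lattice latt) m'" "fac a b c = \<Delta> \<inter> {x. - (m' \<bullet> x) = real n'}"
      by blast
    have "m' \<bullet> a = - real n'" "m' \<bullet> b = - real n'" "m' \<bullet> c = - real n'"
      using in_fac[OF f] unfolding m'(2) by auto
    \<comment> \<open>Any competing normal is - n' L. Integrality at x0 makes n divide n', and
      primitivity makes the quotient 1.\<close>
    then have m'L: "m' = - (real n' *\<^sub>R L)"
      using D(4) L by (intro dual_eqI3[of a b c]) auto
    have "m' \<in> dual_lattice latt" using m'(1) by (simp add: primitive_in_def)
    then obtain i where i: "m' \<bullet> x0 = of_int i"
      using x0 by (auto simp: dual_lattice_def elim: Ints_cases)
    have "real n * (m' \<bullet> x0) = - real n' * (real n * (L \<bullet> x0))" by (simp add: m'L)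
    then have "real_of_int (int n * i) = - real n'" using Lx0 i by simp
    then have ii: "int n' = int n * (- i)" by linarith
    then have "- i > 0" using n' n by (metis of_nat_0_less_iff zero_less_mult_pos)
    then have "n' = n * nat (- i)" using ii by (metis int_nat_eq nat_int nat_mult_distrib less_imp_le of_nat_0_le_iff)
    then have "m' = real (nat (- i)) *\<^sub>R m" by (simp add: m'L m_def mult.commute)
    then have "nat (- i) = 1" using m'(1) mM by (simp add: primitive_in_def)
    then show "n' = n" using \<open>n' = n * nat (- i)\<close> by simp
  qed
  then show ?thesis using n by simp
qed

end

section \<open>Volumes of the faces\<close>

context fan_polytope
begin

lemma generic_in_cone:
  assumes f: "(a, b, c) \<in> facets" and y: "generic_vec y" "y = u *\<^sub>R a + v *\<^sub>R b + w *\<^sub>R c" "u \<ge> 0" "v \<ge> 0" "w \<ge> 0"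
  shows "in_cone a b c y"
proof -
  have d: "det3 y b c = u * det3 a b c" "det3 a y c = v * det3 a b c" "det3 a b y = w * det3 a b c"
    by (simp_all add: y(2) det3_lin)
  then show ?thesis
    using facet_generic[OF f y(1)] y(3-) facetsD(4)[OF f] by (auto simp: in_cone_def le_less)
qed

lemma generic_hull_same:
  assumes f: "(a, b, c) \<in> facets" "(a', b', c') \<in> facets" and y: "generic_vec y"
    "y \<in> convex hull {0, a, b, c}" "y \<in> convex hull {0, a', b', c'}"
  shows "{a', b', c'} = {a, b, c}"
proof -
  have co: "\<exists>u v w. y = u *\<^sub>R a + v *\<^sub>R b + w *\<^sub>R c \<and> u \<ge> 0 \<and> v \<ge> 0 \<and> w \<ge> 0"
    if y0: "y \<in> convex hull {0, a, b, c}" for a b c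
  proof -
    obtain k l z where z: "0 \<le> k" "0 \<le> l" "z \<in> convex hull {a, b, c}" "y = k *\<^sub>R 0 + l *\<^sub>R z"
      using y0 convex_hull_insert[of "{a, b, c}" 0] by auto
    then obtain u v w where "z = u *\<^sub>R a + v *\<^sub>R b + w *\<^sub>R c" "0 \<le> u" "0 \<le> v" "0 \<le> w"
      by (auto simp: convex_hull_3)
    then show ?thesis using z
      by (intro exI[of _ "l * u"] exI[of _ "l * v"] exI[of _ "l * w"]) (simp add: scaleR_add_right)
  qed
  obtain u v w u' v' w' where "y = u *\<^sub>R a + v *\<^sub>R b + w *\<^sub>R c" "u \<ge> 0" "v \<ge> 0" "w \<ge> 0"
    "y = u' *\<^sub>R a' + v' *\<^sub>R b' + w' *\<^sub>R c'" "u' \<ge> 0" "v' \<ge> 0" "w' \<ge> 0"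
    using co y by metis
  then show ?thesis
    using in_cone_same[OF f(1) generic_in_cone[OF f(1) y(1)] f(2) generic_in_cone[OF f(2) y(1)]] by blast
qed

text \<open>Normals of the planes through the origin and two of the lattice points. Points off these
  planes are exactly the generic ones, so in the volume computations they avoid the boundaries of
  all cones.\<close>

definition walls :: "'a set" where
  "walls = {m. m \<noteq> 0 \<and> (\<exists>p\<in>pts. \<exists>q\<in>pts. m = cross p q)}"

lemma finite_walls: "finite walls"
proof -
  have "walls \<subseteq> (\<lambda>(p, q). cross p q) ` (pts \<times> pts)" by (auto simp: walls_def)
  then show ?thesis by (rule finite_subset) (simp add: finite_pts)
qed

lemma generic_walls: "(\<forall>m\<in>walls. m \<bullet> y \<noteq> 0) \<longleftrightarrow> generic_vec y"
  by (auto simp: walls_def generic_vec_def det3_def)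

lemma walls_nonzero:
  assumes "m \<in> walls" "det3 a b c \<noteq> 0"
  shows "m \<bullet> a \<noteq> 0 \<or> m \<bullet> b \<noteq> 0 \<or> m \<bullet> c \<noteq> 0"
  using dual_eqI3[OF assms(2), of m 0] assms(1) by (auto simp: walls_def)

lemma edge_coords:
  assumes f: "(a, b, c) \<in> facets" and z: "level a b c \<bullet> z = 0"
  shows "z = (dual_fun a b c 0 1 0 \<bullet> z) *\<^sub>R (b - a) + (dual_fun a b c 0 0 1 \<bullet> z) *\<^sub>R (c - a)"
proof -
  have d: "det3 a b c \<noteq> 0" using facetsD(4)[OF f] by simp
  obtain u v w where zz: "z = u *\<^sub>R a + v *\<^sub>R b + w *\<^sub>R c" using coords_of[OF d] by blast
  have "u + v + w = 0" using z by (simp add: zz inner_add_right level_inner[OF f])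
  then have u: "u = - v - w" by simp
  have vals: "dual_fun a b c 0 1 0 \<bullet> z = v" "dual_fun a b c 0 0 1 \<bullet> z = w"
    by (simp_all add: zz inner_add_right dual_fun_inner[OF d])
  show ?thesis unfolding vals by (simp add: zz u algebra_simps)
qed

lemma parallel_fac:
  assumes f: "(a, b, c) \<in> facets"
  shows "parallel_lattice latt (fac a b c) = {z \<in> latt. level a b c \<bullet> z = 0}"
proof -
  define D where "D = {x - y | x y. x \<in> fac a b c \<and> y \<in> fac a b c}"
  have "span D \<subseteq> {z. level a b c \<bullet> z = 0}"
    by (rule span_minimal) (auto simp: D_def fac_def inner_diff_right subspace_hyperplane)
  moreover have "z \<in> span D" if "level a b c \<bullet> z = 0" for z
  proof -
    have "b - a \<in> span D" "c - a \<in> span D"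
      using in_fac[OF f] by (auto simp: D_def intro!: span_base)
    then show ?thesis by (subst edge_coords[OF f that]) (intro span_add span_scale)
  qed
  ultimately show ?thesis unfolding parallel_lattice_def D_def by auto
qed

lemma parallel_fac_coords:
  assumes f: "(a, b, c) \<in> facets" and z: "z \<in> latt" "level a b c \<bullet> z = 0"
  shows "\<exists>i j :: int. dual_fun a b c 0 1 0 \<bullet> z = of_int i \<and> dual_fun a b c 0 0 1 \<bullet> z = of_int j"
proof -
  have "dual_fun a b c 0 1 0 \<bullet> z \<in> \<int> \<and> dual_fun a b c 0 0 1 \<bullet> z \<in> \<int>"
    using empty_simplex_triangle[OF facet_empty_simplex[OF f]] facet_latt[OF f] z edge_coords[OF f z(2)] by metis
  then show ?thesis by (auto elim!: Ints_cases)
qed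

text \<open>Emptiness of the triangle makes the coordinates of a parallel lattice vector with
  respect to b - a and c - a integral.\<close>

lemma lattice_basis_fac:
  assumes f: "(a, b, c) \<in> facets"
  shows "lattice_basis (parallel_lattice latt (fac a b c)) {b - a, c - a}" "card {b - a, c - a} = 2"
proof -
  define B C where "B = dual_fun a b c 0 1 0" and "C = dual_fun a b c 0 0 1"
  have d: "det3 a b c \<noteq> 0" using facetsD(4)[OF f] by simp
  have BC: "B \<bullet> (b - a) = 1" "B \<bullet> (c - a) = 0" "C \<bullet> (b - a) = 0" "C \<bullet> (c - a) = 1"
    by (simp_all add: B_def C_def inner_diff_right dual_fun_inner[OF d])
  have ne: "b - a \<noteq> c - a" using facets_distinct[OF f] by simp
  then show "card {b - a, c - a} = 2" by simp
  have "independent {b - a, c - a}"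
  proof (rule independent_if_scalars_zero)
    fix k x assume s: "(\<Sum>x\<in>{b - a, c - a}. k x *\<^sub>R x) = 0" "x \<in> {b - a, c - a}"
    then have "k (b - a) *\<^sub>R (b - a) + k (c - a) *\<^sub>R (c - a) = 0" using ne by simp
    then have "B \<bullet> (k (b - a) *\<^sub>R (b - a) + k (c - a) *\<^sub>R (c - a)) = 0" "C \<bullet> (k (b - a) *\<^sub>R (b - a) + k (c - a) *\<^sub>R (c - a)) = 0"
      by simp_all
    then have "k (b - a) = 0" "k (c - a) = 0" unfolding inner_add_right inner_scaleR_right BC by simp_all
    then show "k x = 0" using s(2) by blast
  qed simp
  moreover have "parallel_lattice latt (fac a b c) = int_span {b - a, c - a}"
    unfolding parallel_fac[OF f]
  proof (intro equalityI subsetI)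
    fix z assume "z \<in> {z \<in> latt. level a b c \<bullet> z = 0}"
    then have z: "z \<in> latt" "level a b c \<bullet> z = 0" by auto
    obtain i j :: int where ij: "B \<bullet> z = of_int i" "C \<bullet> z = of_int j"
      using parallel_fac_coords[OF f z] unfolding B_def C_def by metis
    have "z = of_int i *\<^sub>R (b - a) + of_int j *\<^sub>R (c - a)"
      using edge_coords[OF f z(2)] unfolding B_def[symmetric] C_def[symmetric] ij .
    then have "z = (\<Sum>v\<in>{b - a, c - a}. of_int (if v = b - a then i else j) *\<^sub>R v)" using ne by simp
    then show "z \<in> int_span {b - a, c - a}"
      unfolding int_span_def by (intro CollectI exI[of _ "\<lambda>v. if v = b - a then i else j"] conjI TrueI)
  next
    fix z assume "z \<in> int_span {b - a, c - a}"
    then obtain k :: "'a \<Rightarrow> int" where "z = (\<Sum>v\<in>{b - a, c - a}. of_int (k v) *\<^sub>R v)" by (auto simp: int_span_def)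
    then have z: "z = of_int (k (b - a)) *\<^sub>R (b - a) + of_int (k (c - a)) *\<^sub>R (c - a)" using ne by simp
    have "z \<in> latt" unfolding z using facet_latt[OF f] by (intro latt_add latt_int_scale latt_diff) auto
    moreover have "level a b c \<bullet> z = 0" by (simp add: z inner_add_right inner_diff_right level_inner[OF f])
    ultimately show "z \<in> {z \<in> latt. level a b c \<bullet> z = 0}" by simp
  qed
  ultimately show "lattice_basis (parallel_lattice latt (fac a b c)) {b - a, c - a}"
    by (simp add: lattice_basis_def)
qed

definition facets_in :: "'a set \<Rightarrow> ('a \<times> 'a \<times> 'a) set" where
  "facets_in \<theta> = {(a, b, c) \<in> facets. a \<in> \<theta> \<and> b \<in> \<theta> \<and> c \<in> \<theta>}"

lemma facets_in_fac:
  assumes f: "(a, b, c) \<in> facets" and "(a', b', c') \<in> facets_in (fac a b c)"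
  shows "level a' b' c' = level a b c"
  using assms(2) level_inner[of a' b' c'] facetsD(4)[of a' b' c']
  by (intro dual_eqI3[of a' b' c']) (auto simp: facets_in_def fac_def)

text \<open>The basis \<open>g\<close> and the two edge vectors generate the same plane lattice, so
  the integer matrix relating them has determinant 1 or - 1; half its absolute value is the
  area.\<close>

lemma triangle_measure:
  fixes g :: "2 \<Rightarrow> 'a"
  assumes f: "(a, b, c) \<in> facets"
    and g: "inj g" "lattice_basis {z \<in> latt. level a b c \<bullet> z = 0} (range g)" and a: "a = coord_map p g x"
  shows "measure lborel (coord_map p g -` (convex hull {a, b, c})) = 1 / 2"
proof -
  define P where "P = {z \<in> latt. level a b c \<bullet> z = 0}"
  define B C where "B = dual_fun a b c 0 1 0" and "C = dual_fun a b c 0 0 1"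
  have d: "det3 a b c \<noteq> 0" using facetsD(4)[OF f] by simp
  have BC: "B \<bullet> (b - a) = 1" "B \<bullet> (c - a) = 0" "C \<bullet> (b - a) = 0" "C \<bullet> (c - a) = 1"
    by (simp_all add: B_def C_def inner_diff_right dual_fun_inner[OF d])
  have PI: "P = {\<Sum>i\<in>UNIV. of_int (k i) *\<^sub>R g i | k :: 2 \<Rightarrow> int. True}"
    using g(2) int_span_range[OF g(1)] by (simp add: lattice_basis_def P_def)
  have "b - a \<in> P" "c - a \<in> P"
    using facet_latt[OF f] level_inner[OF f] by (auto simp: P_def inner_diff_right)
  then obtain k k' :: "2 \<Rightarrow> int" where k: "b - a = (\<Sum>i\<in>UNIV. of_int (k i) *\<^sub>R g i)" "c - a = (\<Sum>i\<in>UNIV. of_int (k' i) *\<^sub>R g i)"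
    unfolding PI by blast
  then have k2: "b - a = of_int (k 1) *\<^sub>R g 1 + of_int (k 2) *\<^sub>R g 2" "c - a = of_int (k' 1) *\<^sub>R g 1 + of_int (k' 2) *\<^sub>R g 2"
    by (simp_all add: sum_2)
  have gP: "g i \<in> P" for i
    using mem_int_span_range[OF g(1)] g(2) by (simp add: lattice_basis_def P_def)
  have gc: "\<exists>i j :: int. B \<bullet> g l = of_int i \<and> C \<bullet> g l = of_int j" for l
    unfolding B_def C_def using gP[of l] by (intro parallel_fac_coords[OF f]) (simp_all add: P_def)
  obtain i1 j1 :: int where ij1: "B \<bullet> g 1 = of_int i1" "C \<bullet> g 1 = of_int j1"
    using gc[of 1] by (elim exE conjE)
  obtain i2 j2 :: int where ij2: "B \<bullet> g 2 = of_int i2" "C \<bullet> g 2 = of_int j2"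
    using gc[of 2] by (elim exE conjE)
  have "real_of_int (k 1 * i1 + k 2 * i2) = of_int 1" "real_of_int (k 1 * j1 + k 2 * j2) = of_int 0"
    "real_of_int (k' 1 * i1 + k' 2 * i2) = of_int 0" "real_of_int (k' 1 * j1 + k' 2 * j2) = of_int 1"
    using BC unfolding k2 by (simp_all add: inner_add_right ij1 ij2)
  then have e: "k 1 * i1 + k 2 * i2 = 1" "k 1 * j1 + k 2 * j2 = 0" "k' 1 * i1 + k' 2 * i2 = 0" "k' 1 * j1 + k' 2 * j2 = 1"
    unfolding of_int_eq_iff .
  have "(k 1 * k' 2 - k 2 * k' 1) * (i1 * j2 - j1 * i2) = (k 1 * i1 + k 2 * i2) * (k' 1 * j1 + k' 2 * j2) - (k 1 * j1 + k 2 * j2) * (k' 1 * i1 + k' 2 * i2)"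
    by (simp add: algebra_simps)
  then have "(k 1 * k' 2 - k 2 * k' 1) * (i1 * j2 - j1 * i2) = 1" unfolding e by simp
  from iffD1[OF zmult_eq_1_iff this] have "\<bar>k 1 * k' 2 - k 2 * k' 1\<bar> = 1" by auto
  then have "\<bar>real_of_int (k 1) * real_of_int (k' 2) - real_of_int (k 2) * real_of_int (k' 1)\<bar> = 1"
    by (simp flip: of_int_mult of_int_diff of_int_abs)
  moreover have "measure lborel (coord_map p g -` (convex hull {a, b, c})) = \<bar>real_of_int (k 1) * real_of_int (k' 2) - real_of_int (k 2) * real_of_int (k' 1)\<bar> / 2"
    using g by (intro measure_coord_map_triangle[OF _ k2 a] independent_range_coords[of g]) (auto simp: lattice_basis_def)
  ultimately show ?thesis by simp
qed

lemma coord_map_fac: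
  fixes g :: "2 \<Rightarrow> 'a"
  assumes f: "(a, b, c) \<in> facets"
    and g: "inj g" "lattice_basis {z \<in> latt. level a b c \<bullet> z = 0} (range g)"
    and p: "level a b c \<bullet> p = 1" and y: "level a b c \<bullet> y = 1"
  shows "\<exists>x. y = coord_map p g x"
proof -
  have PI: "{z \<in> latt. level a b c \<bullet> z = 0} = {\<Sum>i\<in>UNIV. of_int (k i) *\<^sub>R g i | k :: 2 \<Rightarrow> int. True}"
    using g(2) int_span_range[OF g(1)] by (simp add: lattice_basis_def)
  have "b - a \<in> {z \<in> latt. level a b c \<bullet> z = 0}" "c - a \<in> {z \<in> latt. level a b c \<bullet> z = 0}"
    using facet_latt[OF f] level_inner[OF f] by (auto simp: inner_diff_right)
  then obtain k k' :: "2 \<Rightarrow> int" where k: "b - a = (\<Sum>i\<in>UNIV. of_int (k i) *\<^sub>R g i)" "c - a = (\<Sum>i\<in>UNIV. of_int (k' i) *\<^sub>R g i)"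
    unfolding PI by blast
  have z: "level a b c \<bullet> (y - p) = 0" using p y by (simp add: inner_diff_right)
  define s t where "s = dual_fun a b c 0 1 0 \<bullet> (y - p)" and "t = dual_fun a b c 0 0 1 \<bullet> (y - p)"
  have "y - p = s *\<^sub>R (b - a) + t *\<^sub>R (c - a)" using edge_coords[OF f z] by (simp add: s_def t_def)
  then have "y = coord_map p g (\<chi> i. s * k i + t * k' i)"
    unfolding k by (simp add: coord_map_def scaleR_sum_right sum.distrib scaleR_add_left algebra_simps)
  then show ?thesis ..
qed

lemma facet_hull_fac:
  assumes f: "(a, b, c) \<in> facets" and t: "(a', b', c') \<in> facets_in (fac a b c)"
  shows "convex hull {a', b', c'} \<subseteq> fac a b c"
  using t face_of_imp_convex[OF fac_face[OF f]] by (intro hull_minimal) (auto simp: facets_in_def)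

text \<open>Every triangle has lattice area 1 / 2, which the factor 2! cancels, so the volume counts
  triangles; the divisor 3 accounts for rotations.\<close>

lemma normalized_vol_fac:
  assumes f: "(a, b, c) \<in> facets"
  shows "normalized_vol latt (fac a b c) = card (facets_in (fac a b c)) / 3"
proof -
  define \<theta> where "\<theta> = fac a b c"
  define L where "L = level a b c"
  have comp: "compact \<theta>" using face_of_imp_compact[OF \<Delta>(1,2) fac_face[OF f]] by (simp add: \<theta>_def)
  have ne: "\<theta> \<noteq> {}" using in_fac[OF f] by (auto simp: \<theta>_def)
  obtain g :: "2 \<Rightarrow> 'a" and p where g: "inj g" "lattice_basis (parallel_lattice latt \<theta>) (range g)" and p: "p \<in> \<theta>"
    and vol: "lattice_vol latt \<theta> = measure lborel (coord_map p g -` \<theta>)"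
    by (rule lattice_vol_eq[where 'n = 2, OF lattice_basis_fac(1)[OF f, folded \<theta>_def]])
      (auto simp: lattice_basis_fac(2)[OF f] ne comp compact_imp_closed)
  have g2: "lattice_basis {z \<in> latt. L \<bullet> z = 0} (range g)" using g(2) parallel_fac[OF f] by (simp add: \<theta>_def L_def)
  have p1: "L \<bullet> p = 1" using p by (simp add: \<theta>_def fac_def L_def)
  define \<T> where "\<T> = facets_in \<theta>"
  define I where "I = (\<lambda>(a, b, c). {a, b, c}) ` \<T>"
  have \<T>: "\<T> \<subseteq> facets" "\<And>a b c. (a, b, c) \<in> \<T> \<Longrightarrow> (b, c, a) \<in> \<T>"
    by (auto simp: \<T>_def facets_in_def intro: facets_rotate)
  have finI: "finite I" using finite_subset[OF \<T>(1) finite_facets] by (simp add: I_def)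
  have coord: "\<exists>x. y = coord_map p g x" if "L \<bullet> y = 1" for y
    using coord_map_fac[OF f g(1) g2[unfolded L_def]] p1 that by (simp add: L_def)
  have "measure lborel (coord_map p g -` \<theta>) = (\<Sum>S\<in>I. measure lborel (coord_map p g -` (convex hull S)))"
  proof (rule measure_coord_map_cover[OF _ finI _ _ comp finite_walls])
    show "x = 0" if "(\<Sum>i\<in>UNIV. x $ i *\<^sub>R g i) = 0" for x
      using independent_range_coords[OF g(1) _ that] g(2) by (simp add: lattice_basis_def)
    show "compact (convex hull S)" if "S \<in> I" for S
      using that by (auto simp: I_def intro!: finite_imp_compact_convex_hull)
    show "convex hull S \<subseteq> \<theta>" if "S \<in> I" for S
      using that facet_hull_fac[OF f] by (auto simp: I_def \<T>_def \<theta>_def)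
    show "\<exists>x. m \<bullet> coord_map p g x \<noteq> 0" if "m \<in> walls" for m
    proof -
      have "det3 a b c \<noteq> 0" using facetsD(4)[OF f] by simp
      then have "m \<bullet> a \<noteq> 0 \<or> m \<bullet> b \<noteq> 0 \<or> m \<bullet> c \<noteq> 0" using walls_nonzero that by blast
      then show ?thesis using coord[of a] coord[of b] coord[of c] level_inner[OF f] by (auto simp: L_def)
    qed
    show "\<exists>S\<in>I. y \<in> convex hull S" if y: "y \<in> \<theta>" "\<forall>m\<in>walls. m \<bullet> y \<noteq> 0" for y
    proof -
      have gen: "generic_vec y" using y(2) generic_walls by blast
      obtain a' b' c' where f': "(a', b', c') \<in> facets" "in_cone a' b' c' y" using exists_facet[OF gen] by blast
      obtain u v w where uvw: "y = u *\<^sub>R a' + v *\<^sub>R b' + w *\<^sub>R c'" "u > 0" "v > 0" "w > 0"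
        using in_cone_coords[OF f'] .
      have y1: "y \<in> \<Delta>" "level a b c \<bullet> y = 1" using y(1) by (auto simp: \<theta>_def fac_def)
      have c1: "u + v + w = 1" "level a b c \<bullet> a' = 1" "level a b c \<bullet> b' = 1" "level a b c \<bullet> c' = 1"
        using face_coords[OF level_le[OF f] y1 f'(1) uvw(1)] uvw by (auto simp: less_imp_le)
      then have "(a', b', c') \<in> \<T>"
        using f'(1) facet_in_\<Delta>[OF f'(1)] by (auto simp: \<T>_def facets_in_def \<theta>_def fac_def)
      moreover have "y \<in> convex hull {a', b', c'}"
        unfolding convex_hull_3 uvw(1) using c1(1) uvw by (auto intro: less_imp_le)
      ultimately show ?thesis unfolding I_def by force
    qed
    show "S = S'" if S: "S \<in> I" "S' \<in> I" and y: "y \<in> convex hull S" "y \<in> convex hull S'" "\<forall>m\<in>walls. m \<bullet> y \<noteq> 0" for y S S'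
    proof -
      have gen: "generic_vec y" using y(3) generic_walls by blast
      obtain a1 b1 c1 where t1: "(a1, b1, c1) \<in> \<T>" "S = {a1, b1, c1}"
        using S(1) by (auto simp: I_def)
      have f1: "(a1, b1, c1) \<in> facets" using t1 \<T>(1) by blast
      obtain a2 b2 c2 where t2: "(a2, b2, c2) \<in> \<T>" "S' = {a2, b2, c2}"
        using S(2) by (auto simp: I_def)
      have f2: "(a2, b2, c2) \<in> facets" using t2 \<T>(1) by blast
      have "convex hull S \<subseteq> convex hull {0, a1, b1, c1}" "convex hull S' \<subseteq> convex hull {0, a2, b2, c2}"
        unfolding t1(2) t2(2) by (intro hull_mono; auto)+
      then show ?thesis using generic_hull_same[OF f1 f2 gen] y t1(2) t2(2) by blast
    qed
  qed
  also have "\<dots> = (\<Sum>S\<in>I. 1 / 2)"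
  proof (rule sum.cong[OF refl])
    fix S assume "S \<in> I"
    then obtain a' b' c' where t: "(a', b', c') \<in> \<T>" "S = {a', b', c'}" by (auto simp: I_def)
    have f': "(a', b', c') \<in> facets" using t(1) \<T>(1) by blast
    have L': "level a' b' c' = L" using facets_in_fac[OF f] t(1) by (simp add: \<T>_def \<theta>_def L_def)
    then obtain x where "a' = coord_map p g x" using coord level_inner(1)[OF f'] by metis
    then show "measure lborel (coord_map p g -` (convex hull S)) = 1 / 2"
      using triangle_measure[OF f' g(1)] g2 L' t(2) by simp
  qed
  finally have "lattice_vol latt \<theta> = card I / 2" using vol by simp
  moreover have "real (card \<T>) = 3 * card I"
    using sum_facet_sets[OF \<T>, of "\<lambda>_. 1"] by (simp add: I_def case_prod_unfold)
  moreover have "nat (aff_dim \<theta>) = 2" using aff_dim_fac[OF f] by (simp add: \<theta>_def)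
  ultimately show ?thesis
    unfolding normalized_vol_def \<theta>_def[symmetric] \<T>_def[symmetric] by simp
qed

end

section \<open>Tetrahedra and the volume of the polytope\<close>

context lattice3
begin

lemma lattice_basis_latt: "lattice_basis latt {b1, b2, b3}" "card {b1, b2, b3} = 3"
proof -
  have ne: "b1 \<noteq> b2" "b1 \<noteq> b3" "b2 \<noteq> b3"
    using biorthogonal by (metis zero_neq_one)+
  then show "card {b1, b2, b3} = 3" by simp
  have "independent {b1, b2, b3}"
  proof (rule independent_if_scalars_zero)
    fix k x assume s: "(\<Sum>x\<in>{b1, b2, b3}. k x *\<^sub>R x) = 0" "x \<in> {b1, b2, b3}"
    then have z: "k b1 *\<^sub>R b1 + k b2 *\<^sub>R b2 + k b3 *\<^sub>R b3 = 0" using ne by (simp add: add.assoc)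
    have "d \<bullet> (k b1 *\<^sub>R b1 + k b2 *\<^sub>R b2 + k b3 *\<^sub>R b3) = 0" for d unfolding z by simp
    from this[of d1] this[of d2] this[of d3] have "k b1 = 0" "k b2 = 0" "k b3 = 0"
      by (simp_all add: inner_add_right biorthogonal)
    then show "k x = 0" using s(2) by blast
  qed simp
  moreover have "latt = int_span {b1, b2, b3}"
  proof (intro equalityI subsetI)
    fix x assume "x \<in> latt"
    then obtain i j k :: int where ijk: "d1 \<bullet> x = of_int i" "d2 \<bullet> x = of_int j" "d3 \<bullet> x = of_int k"
      by (auto simp: latt_def elim!: Ints_cases)
    have "x = (\<Sum>v\<in>{b1, b2, b3}. of_int (if v = b1 then i else if v = b2 then j else k) *\<^sub>R v)"
      using expansion[of x] ne by (simp add: ijk add.assoc)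
    then show "x \<in> int_span {b1, b2, b3}"
      unfolding int_span_def by (intro CollectI exI[of _ "\<lambda>v. if v = b1 then i else if v = b2 then j else k"] conjI TrueI)
  next
    fix x assume "x \<in> int_span {b1, b2, b3}"
    then obtain k :: "'a \<Rightarrow> int" where "x = (\<Sum>v\<in>{b1, b2, b3}. of_int (k v) *\<^sub>R v)" by (auto simp: int_span_def)
    then have "x = of_int (k b1) *\<^sub>R b1 + (of_int (k b2) *\<^sub>R b2 + of_int (k b3) *\<^sub>R b3)" using ne by simp
    then show "x \<in> latt" using basis_latt by (simp add: latt_add latt_int_scale)
  qed
  ultimately show "lattice_basis latt {b1, b2, b3}" by (simp add: lattice_basis_def)
qed

lemma det3_combinations:
  "det3 (x1 *\<^sub>R a + x2 *\<^sub>R b + x3 *\<^sub>R c) (y1 *\<^sub>R a + y2 *\<^sub>R b + y3 *\<^sub>R c) (z1 *\<^sub>R a + z2 *\<^sub>R b + z3 *\<^sub>R c)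
   = (x1 * y2 * z3 + y1 * z2 * x3 + z1 * x2 * y3 - x1 * z2 * y3 - y1 * x2 * z3 - z1 * y2 * x3) * det3 a b c"
proof -
  have perm: "det3 a c b = - det3 a b c" "det3 b a c = - det3 a b c" "det3 b c a = det3 a b c"
    "det3 c a b = det3 a b c" "det3 c b a = - det3 a b c"
    by (simp_all add: det3_coords algebra_simps)
  show ?thesis by (simp add: det3_lin perm algebra_simps)
qed

text \<open>The determinant is an integer dividing the determinant 1 of the reference basis.\<close>

lemma det3_lattice_basis:
  fixes g :: "3 \<Rightarrow> 'a"
  assumes g: "inj g" "lattice_basis latt (range g)"
  shows "\<bar>det3 (g 1) (g 2) (g 3)\<bar> = 1"
proof -
  have PI: "latt = {\<Sum>i\<in>UNIV. of_int (k i) *\<^sub>R g i | k :: 3 \<Rightarrow> int. True}"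
    using g(2) int_span_range[OF g(1)] by (simp add: lattice_basis_def)
  have gP: "g i \<in> latt" for i
    using mem_int_span_range[OF g(1)] g(2) by (simp add: lattice_basis_def)
  have rep: "\<exists>k :: 3 \<Rightarrow> int. x = of_int (k 1) *\<^sub>R g 1 + of_int (k 2) *\<^sub>R g 2 + of_int (k 3) *\<^sub>R g 3" if "x \<in> latt" for x
    using that unfolding PI by (auto simp: sum_3)
  obtain k1 :: "3 \<Rightarrow> int" where k1: "b1 = of_int (k1 1) *\<^sub>R g 1 + of_int (k1 2) *\<^sub>R g 2 + of_int (k1 3) *\<^sub>R g 3"
    using rep[OF basis_latt(1)] ..
  obtain k2 :: "3 \<Rightarrow> int" where k2: "b2 = of_int (k2 1) *\<^sub>R g 1 + of_int (k2 2) *\<^sub>R g 2 + of_int (k2 3) *\<^sub>R g 3"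
    using rep[OF basis_latt(2)] ..
  obtain k3 :: "3 \<Rightarrow> int" where k3: "b3 = of_int (k3 1) *\<^sub>R g 1 + of_int (k3 2) *\<^sub>R g 2 + of_int (k3 3) *\<^sub>R g 3"
    using rep[OF basis_latt(3)] ..
  obtain n where n: "det3 (g 1) (g 2) (g 3) = of_int n" using det3_Ints[OF gP[of 1] gP[of 2] gP[of 3]] by (auto elim: Ints_cases)
  define k where "k = k1 1 * k2 2 * k3 3 + k2 1 * k3 2 * k1 3 + k3 1 * k1 2 * k2 3 - k1 1 * k3 2 * k2 3 - k2 1 * k1 2 * k3 3 - k3 1 * k2 2 * k1 3"
  have "det3 b1 b2 b3 = of_int k * of_int n"
    unfolding n[symmetric] k_def by (subst k1, subst k2, subst k3) (simp add: det3_combinations)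
  then have "of_int (k * n) = (of_int 1 :: real)" using basis_latt(4) by simp
  then have "k * n = 1" unfolding of_int_eq_iff .
  from iffD1[OF zmult_eq_1_iff this] have "\<bar>n\<bar> = 1" by auto
  then show ?thesis unfolding n by (simp flip: of_int_abs)
qed

lemma coord_map_latt:
  fixes g :: "3 \<Rightarrow> 'a"
  assumes "det3 (g 1) (g 2) (g 3) \<noteq> 0"
  shows "\<exists>x. y = coord_map p g x"
proof -
  define e f h where "e = det3 (y - p) (g 2) (g 3) / det3 (g 1) (g 2) (g 3)"
    and "f = det3 (g 1) (y - p) (g 3) / det3 (g 1) (g 2) (g 3)" and "h = det3 (g 1) (g 2) (y - p) / det3 (g 1) (g 2) (g 3)"
  have "y - p = e *\<^sub>R g 1 + f *\<^sub>R g 2 + h *\<^sub>R g 3"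
    using coords_of[OF assms, of "y - p"] by (simp add: e_def f_def h_def)
  then have "y = coord_map p g (vector [e, f, h])"
    by (simp add: coord_map_def sum_3 vector_3 algebra_simps)
  then show ?thesis ..
qed

lemma measure_tetrahedron:
  fixes g :: "3 \<Rightarrow> 'a"
  assumes g: "inj g" "lattice_basis latt (range g)" and d: "det3 a b c \<noteq> 0"
  shows "measure lborel (coord_map p g -` (convex hull {0, a, b, c})) = \<bar>det3 a b c\<bar> / 6"
proof -
  have g1: "\<bar>det3 (g 1) (g 2) (g 3)\<bar> = 1" using det3_lattice_basis[OF g] .
  then have g0: "det3 (g 1) (g 2) (g 3) \<noteq> 0" by auto
  obtain x where x: "0 = coord_map p g x" using coord_map_latt[of g, OF g0] by blast
  obtain A where A: "a = coord_map 0 g A" using coord_map_latt[of g, OF g0] by blast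
  obtain B where B: "b = coord_map 0 g B" using coord_map_latt[of g, OF g0] by blast
  obtain C where C: "c = coord_map 0 g C" using coord_map_latt[of g, OF g0] by blast
  have add: "coord_map 0 g X = coord_map p g (x + X)" for X
    using x by (simp add: coord_map_def scaleR_add_left sum.distrib)
  have det: "det3 a b c = (A$1 * B$2 * C$3 + B$1 * C$2 * A$3 + C$1 * A$2 * B$3 - A$1 * C$2 * B$3 - B$1 * A$2 * C$3 - C$1 * B$2 * A$3)
      * det3 (g 1) (g 2) (g 3)"
    unfolding A B C coord_map_def sum_3 add_0_left by (rule det3_combinations)
  have "measure lborel (coord_map p g -` (convex hull {0, a, b, c})) =
    \<bar>A$1 * B$2 * C$3 + B$1 * C$2 * A$3 + C$1 * A$2 * B$3 - A$1 * C$2 * B$3 - B$1 * A$2 * C$3 - C$1 * B$2 * A$3\<bar> / 6"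
  proof (rule measure_coord_map_tetrahedron[OF _ _ _ _ x])
    show "X = 0" if "(\<Sum>i\<in>UNIV. X $ i *\<^sub>R g i) = 0" for X
      using independent_range_coords[OF g(1) _ that] g(2) by (simp add: lattice_basis_def)
    show "A \<noteq> 0" "B \<noteq> 0" "C \<noteq> 0" "A \<noteq> B" "B \<noteq> C" "A \<noteq> C"
      using d unfolding A B C by (auto simp: coord_map_def det3_lin)
  qed (simp_all add: A B C add)
  then show ?thesis using g1 unfolding det abs_mult by simp
qed

end

context fan_polytope
begin

lemma parallel_\<Delta>: "parallel_lattice latt \<Delta> = latt"
proof -
  define D where "D = {x - y | x y. x \<in> \<Delta> \<and> y \<in> \<Delta>}"
  obtain x where "generic_vec x" using exists_generic by blast
  then obtain a b c where f: "(a, b, c) \<in> facets" using exists_facet by metis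
  have d: "det3 a b c \<noteq> 0" using facetsD(4)[OF f] by simp
  have "v \<in> D" if "v \<in> \<Delta>" for v
    unfolding D_def using that \<Delta>(4) by (intro CollectI exI[of _ v] exI[of _ 0]) simp
  then have "a \<in> span D" "b \<in> span D" "c \<in> span D" using facet_in_\<Delta>[OF f] by (auto intro: span_base)
  then have "z \<in> span D" for z
    by (subst coords_of[OF d, of z]) (intro span_add span_scale)
  then show ?thesis unfolding parallel_lattice_def D_def by auto
qed

lemma cone_hull:
  assumes "x = u *\<^sub>R a + v *\<^sub>R b + w *\<^sub>R c" "0 < u" "0 < v" "0 < w" "u + v + w \<le> 1"
  shows "x \<in> convex hull {0, a, b, c}"
proof -
  define s where "s = u + v + w"
  have s: "s > 0" using assms by (simp add: s_def)
  have "(u / s) *\<^sub>R a + (v / s) *\<^sub>R b + (w / s) *\<^sub>R c \<in> convex hull {a, b, c}"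
    unfolding convex_hull_3 using s assms
    by (intro CollectI exI[of _ "u / s"] exI[of _ "v / s"] exI[of _ "w / s"])
       (auto simp: add_divide_distrib[symmetric] s_def)
  moreover have "x = (1 - s) *\<^sub>R 0 + s *\<^sub>R ((u / s) *\<^sub>R a + (v / s) *\<^sub>R b + (w / s) *\<^sub>R c)"
    using s by (simp add: assms(1) scaleR_add_right)
  moreover have "{a, b, c} \<noteq> {}" by simp
  ultimately show ?thesis
    unfolding convex_hull_insert[OF \<open>{a, b, c} \<noteq> {}\<close>] using s assms(5)
    by (intro CollectI exI[of _ "1 - s"] exI[of _ s] conjI exI[of _ "(u / s) *\<^sub>R a + (v / s) *\<^sub>R b + (w / s) *\<^sub>R c"]) (auto simp: s_def)
qed

text \<open>The tetrahedra with apex 0 over the triangles have a sixth of their determinant as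
  volume; 3! cancels the sixth, and the divisor 3 accounts for rotations.\<close>

lemma normalized_vol_\<Delta>: "normalized_vol latt \<Delta> = (\<Sum>(a, b, c)\<in>facets. det3 a b c) / 3"
proof -
  obtain g :: "3 \<Rightarrow> 'a" and p where g: "inj g" "lattice_basis (parallel_lattice latt \<Delta>) (range g)" and p: "p \<in> \<Delta>"
    and vol: "lattice_vol latt \<Delta> = measure lborel (coord_map p g -` \<Delta>)"
    by (rule lattice_vol_eq[where 'n = 3 and L = latt and \<theta> = \<Delta> and ?B0.0 = "{b1, b2, b3}"])
      (use lattice_basis_latt \<Delta> in \<open>auto simp: parallel_\<Delta> compact_imp_closed\<close>)
  have g2: "lattice_basis latt (range g)" using g(2) parallel_\<Delta> by simp
  have g0: "det3 (g 1) (g 2) (g 3) \<noteq> 0" using det3_lattice_basis[OF g(1) g2] by auto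
  define I where "I = (\<lambda>(a, b, c). {a, b, c}) ` facets"
  define h where "h S = measure lborel (coord_map p g -` (convex hull (insert 0 S)))" for S
  have "measure lborel (coord_map p g -` \<Delta>) = (\<Sum>S\<in>I. measure lborel (coord_map p g -` (convex hull (insert 0 S))))"
  proof (rule measure_coord_map_cover[OF _ _ _ _ \<Delta>(2) finite_walls])
    show "x = 0" if "(\<Sum>i\<in>UNIV. x $ i *\<^sub>R g i) = 0" for x
      using independent_range_coords[OF g(1) _ that] g(2) by (simp add: lattice_basis_def)
    show "finite I" using finite_facets by (simp add: I_def)
    show "compact (convex hull (insert 0 S))" if "S \<in> I" for S
      using that by (auto simp: I_def intro!: finite_imp_compact_convex_hull)
    show "convex hull (insert 0 S) \<subseteq> \<Delta>" if "S \<in> I" for S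
      using that facet_in_\<Delta> \<Delta> by (intro hull_minimal) (auto simp: I_def)
    show "\<exists>x. m \<bullet> coord_map p g x \<noteq> 0" if "m \<in> walls" for m
    proof -
      obtain x where "m = coord_map p g x" using coord_map_latt[of g, OF g0] by blast
      moreover have "m \<bullet> m \<noteq> 0" using that by (simp add: walls_def)
      ultimately show ?thesis by metis
    qed
    show "\<exists>S\<in>I. y \<in> convex hull (insert 0 S)" if y: "y \<in> \<Delta>" "\<forall>m\<in>walls. m \<bullet> y \<noteq> 0" for y
    proof -
      have gen: "generic_vec y" using y(2) generic_walls by blast
      obtain a b c where f: "(a, b, c) \<in> facets" "in_cone a b c y" using exists_facet[OF gen] by blast
      obtain u v w where uvw: "y = u *\<^sub>R a + v *\<^sub>R b + w *\<^sub>R c" "u > 0" "v > 0" "w > 0"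
        using in_cone_coords[OF f] .
      have "u + v + w \<le> 1"
        using level_le[OF f(1) y(1)] by (simp add: uvw(1) inner_add_right level_inner[OF f(1)])
      then have "y \<in> convex hull {0, a, b, c}" using cone_hull uvw by blast
      then show ?thesis unfolding I_def using f(1) by force
    qed
    show "S = S'" if S: "S \<in> I" "S' \<in> I"
      and y: "y \<in> convex hull (insert 0 S)" "y \<in> convex hull (insert 0 S')" "\<forall>m\<in>walls. m \<bullet> y \<noteq> 0" for y S S'
    proof -
      have gen: "generic_vec y" using y(3) generic_walls by blast
      obtain a1 b1 c1 where t1: "(a1, b1, c1) \<in> facets" "S = {a1, b1, c1}"
        using S(1) by (auto simp: I_def)
      obtain a2 b2 c2 where t2: "(a2, b2, c2) \<in> facets" "S' = {a2, b2, c2}"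
        using S(2) by (auto simp: I_def)
      show ?thesis using generic_hull_same[OF t1(1) t2(1) gen] y t1(2) t2(2) by blast
    qed
  qed
  then have "lattice_vol latt \<Delta> = sum h I" unfolding vol h_def .
  moreover have "3 * sum h I = (\<Sum>(a, b, c)\<in>facets. h {a, b, c})"
    unfolding I_def using facets_rotate by (intro sum_facet_sets[symmetric]) auto
  moreover have "(\<Sum>(a, b, c)\<in>facets. h {a, b, c}) = (\<Sum>(a, b, c)\<in>facets. det3 a b c / 6)"
  proof (rule sum.cong[OF refl], clarify)
    fix a b c assume f: "(a, b, c) \<in> facets"
    have "\<bar>det3 a b c\<bar> = det3 a b c" "det3 a b c \<noteq> 0" using facetsD(4)[OF f] by auto
    then show "h {a, b, c} = det3 a b c / 6" unfolding h_def using measure_tetrahedron[OF g(1) g2, of a b c p] by simp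
  qed
  moreover have "(\<Sum>(a, b, c)\<in>facets. det3 a b c / 6) = (\<Sum>(a, b, c)\<in>facets. det3 a b c) / 6"
    by (simp add: case_prod_unfold sum_divide_distrib)
  ultimately show ?thesis by (simp add: normalized_vol_def aff_dim_\<Delta> fact_numeral)
qed

end

section \<open>One-dimensional faces\<close>

context fan_polytope
begin

text \<open>A triple stands for its directed edge from a to b. Each lattice segment of a
  one-dimensional face is counted once from each of the two triangles at it, which is the origin of
  the divisor 2 in its volume.\<close>

definition edge_facets :: "'a set \<Rightarrow> ('a \<times> 'a \<times> 'a) set" where
  "edge_facets \<theta> = {(a, b, c) \<in> facets. a \<in> \<theta> \<and> b \<in> \<theta>}"

context
  fixes \<theta> :: "'a set"
  assumes \<theta>: "\<theta> face_of \<Delta>" "aff_dim \<theta> = 1"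
begin

lemma edge_proper: "\<theta> \<noteq> \<Delta>" "\<theta> \<noteq> {}" "\<theta> \<subseteq> \<Delta>" "convex \<theta>" "compact \<theta>"
  using \<theta> aff_dim_\<Delta> face_of_imp_subset face_of_imp_convex face_of_imp_compact[OF \<Delta>(1,2)] by auto

lemma edge_no_facet:
  assumes "(a, b, c) \<in> facets"
  shows "\<not> (a \<in> \<theta> \<and> b \<in> \<theta> \<and> c \<in> \<theta>)"
  using facet_face_eq[OF \<theta>(1) edge_proper(1) assms] aff_dim_fac[OF assms] \<theta>(2) by auto

text \<open>Take a closed cone that contains y. Generators with positive coefficient lie in the
  edge; all three cannot, and a single one would make y a lattice point. A rotation of the triple
  brings the remaining two to the front.\<close>

lemma edge_cover:
  assumes y: "y \<in> \<theta>" "y \<notin> pts"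
  shows "\<exists>a b c u v. (a, b, c) \<in> edge_facets \<theta> \<and> y = u *\<^sub>R a + v *\<^sub>R b \<and> u > 0 \<and> v > 0 \<and> u + v = 1"
proof -
  obtain l where l: "\<And>x. x \<in> \<Delta> \<Longrightarrow> l \<bullet> x \<le> 1" "\<theta> = \<Delta> \<inter> {x. l \<bullet> x = 1}"
    using face_functional[OF \<theta>(1) edge_proper(2,1)] by blast
  obtain a b c u v w where f: "(a, b, c) \<in> facets" and uvw: "y = u *\<^sub>R a + v *\<^sub>R b + w *\<^sub>R c" "u \<ge> 0" "v \<ge> 0" "w \<ge> 0"
    by (rule cover)
  have y1: "y \<in> \<Delta>" "l \<bullet> y = 1" using y l(2) by auto
  note fc = face_coords[OF l(1) y1 f uvw]
  have abc: "a \<in> \<Delta>" "b \<in> \<Delta>" "c \<in> \<Delta>" using facet_in_\<Delta>[OF f] by auto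
  have in\<theta>: "u > 0 \<longrightarrow> a \<in> \<theta>" "v > 0 \<longrightarrow> b \<in> \<theta>" "w > 0 \<longrightarrow> c \<in> \<theta>" using fc(2-4) abc l(2) by auto
  have ap: "a \<in> pts" "b \<in> pts" "c \<in> pts" using facetsD(1-3)[OF f] .
  have one: "u \<noteq> 1" "v \<noteq> 1" "w \<noteq> 1"
  proof -
    have "y = a" if "u = 1"
    proof -
      have "v = 0" "w = 0" using fc(1) uvw that by linarith+
      then show ?thesis using uvw(1) that by simp
    qed
    moreover have "y = b" if "v = 1"
    proof -
      have "u = 0" "w = 0" using fc(1) uvw that by linarith+
      then show ?thesis using uvw(1) that by simp
    qed
    moreover have "y = c" if "w = 1"
    proof -
      have "u = 0" "v = 0" using fc(1) uvw that by linarith+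
      then show ?thesis using uvw(1) that by simp
    qed
    ultimately show "u \<noteq> 1" "v \<noteq> 1" "w \<noteq> 1" using ap y(2) by auto
  qed
  have "\<not> (u > 0 \<and> v > 0 \<and> w > 0)" using in\<theta> edge_no_facet[OF f] by blast
  then consider "w = 0" "u > 0" "v > 0" "u + v = 1" | "u = 0" "v > 0" "w > 0" "v + w = 1" | "v = 0" "w > 0" "u > 0" "w + u = 1"
    using fc(1) uvw(2-4) one by linarith
  then show ?thesis
  proof cases
    case 1
    then have "(a, b, c) \<in> edge_facets \<theta> \<and> y = u *\<^sub>R a + v *\<^sub>R b" using f in\<theta> uvw(1) by (simp add: edge_facets_def)
    then show ?thesis using 1 by blast
  next
    case 2
    then have "(b, c, a) \<in> edge_facets \<theta> \<and> y = v *\<^sub>R b + w *\<^sub>R c"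
      using facets_rotate[OF f] in\<theta> uvw(1) by (simp add: edge_facets_def)
    then show ?thesis using 2 by blast
  next
    case 3
    then have "(c, a, b) \<in> edge_facets \<theta> \<and> y = w *\<^sub>R c + u *\<^sub>R a"
      using facets_rotate[OF facets_rotate[OF f]] in\<theta> uvw(1) by (simp add: edge_facets_def)
    then show ?thesis using 3 by blast
  qed
qed

lemma edge_facets_nonempty: "edge_facets \<theta> \<noteq> {}"
proof -
  obtain x where x: "x \<in> \<theta>" using edge_proper(2) by blast
  have "\<theta> \<noteq> {x}" using \<theta>(2) by auto
  then obtain y where y: "y \<in> \<theta>" "y \<noteq> x" using x by blast
  have inf: "infinite (closed_segment x y)" using y(2) by simp
  have sub: "closed_segment x y \<subseteq> \<theta>" using closed_segment_subset[OF x y(1) edge_proper(4)] .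
  have "\<not> \<theta> \<subseteq> pts"
  proof
    assume "\<theta> \<subseteq> pts"
    from finite_subset[OF subset_trans[OF sub this] finite_pts] inf show False by simp
  qed
  then obtain z where "z \<in> \<theta>" "z \<notin> pts" by blast
  then show ?thesis using edge_cover by blast
qed

lemma edge_line:
  assumes f: "(a, b, c) \<in> edge_facets \<theta>" and y: "y \<in> \<theta>"
  obtains t where "y = a + t *\<^sub>R (b - a)"
proof -
  have ab: "a \<in> \<theta>" "b \<in> \<theta>" "a \<noteq> b" using f facets_distinct by (auto simp: edge_facets_def)
  have "affine hull {a, b} = affine hull \<theta>"
  proof (rule affine_dim_equal)
    show "affine hull {a, b} \<subseteq> affine hull \<theta>" using ab by (intro hull_mono) auto
    show "aff_dim (affine hull {a, b}) = aff_dim (affine hull \<theta>)" using ab \<theta>(2) by (simp add: aff_dim_2)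
  qed auto
  then have "y \<in> affine hull {a, b}" using y hull_subset[of \<theta> affine] by auto
  then obtain u v where "y = u *\<^sub>R a + v *\<^sub>R b" "u + v = 1" by (auto simp: affine_hull_2)
  moreover have "u = 1 - v" using \<open>u + v = 1\<close> by simp
  ultimately have "y = a + v *\<^sub>R (b - a)" by (simp add: algebra_simps)
  then show thesis by (rule that)
qed

lemma parallel_edge:
  assumes f: "(a, b, c) \<in> edge_facets \<theta>"
  shows "parallel_lattice latt \<theta> = range (\<lambda>k::int. of_int k *\<^sub>R (b - a))"
proof -
  define D where "D = {x - y | x y. x \<in> \<theta> \<and> y \<in> \<theta>}"
  have ff: "(a, b, c) \<in> facets" "a \<in> \<theta>" "b \<in> \<theta>" using f by (auto simp: edge_facets_def)
  have l: "a \<in> latt" "b \<in> latt" using facet_latt[OF ff(1)] by auto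
  have "D \<subseteq> span {b - a}"
  proof
    fix z assume "z \<in> D"
    then obtain x y where xy: "z = x - y" "x \<in> \<theta>" "y \<in> \<theta>" by (auto simp: D_def)
    obtain t t' where xt: "x = a + t *\<^sub>R (b - a)" "y = a + t' *\<^sub>R (b - a)"
      using edge_line[OF f xy(2)] edge_line[OF f xy(3)] by metis
    have "z = (t - t') *\<^sub>R (b - a)" unfolding xy(1) xt by (simp add: algebra_simps)
    then show "z \<in> span {b - a}" by (simp add: span_scale span_base)
  qed
  moreover have "b - a \<in> D" using ff by (auto simp: D_def)
  ultimately have "span D = span {b - a}"
    by (intro antisym) (simp_all add: span_minimal span_base)
  then have "parallel_lattice latt \<theta> = latt \<inter> range (\<lambda>t. t *\<^sub>R (b - a))"
    by (simp add: parallel_lattice_def D_def span_singleton)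
  also have "\<dots> = range (\<lambda>k::int. of_int k *\<^sub>R (b - a))"
  proof (intro equalityI subsetI)
    fix z assume "z \<in> latt \<inter> range (\<lambda>t. t *\<^sub>R (b - a))"
    then obtain t where t: "z \<in> latt" "z = t *\<^sub>R (b - a)" by blast
    have "(- t) *\<^sub>R a + t *\<^sub>R b \<in> latt" using t by (simp add: algebra_simps)
    then have "t \<in> \<int>" using empty_simplex_edge[OF facet_empty_simplex[OF ff(1)] l] by blast
    then show "z \<in> range (\<lambda>k::int. of_int k *\<^sub>R (b - a))" using t(2) by (auto elim!: Ints_cases)
  next
    fix z assume "z \<in> range (\<lambda>k::int. of_int k *\<^sub>R (b - a))"
    then show "z \<in> latt \<inter> range (\<lambda>t. t *\<^sub>R (b - a))" using l by (auto intro: latt_int_scale latt_diff)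
  qed
  finally show ?thesis .
qed

text \<open>The planes of \<open>walls\<close> cannot serve as null sets here, as one of them
  contains the whole edge. The plane through 0, p and the apex c of an adjacent triangle meets the
  edge only in p; such planes cut out its lattice points.\<close>

lemma edge_separate:
  assumes f: "(a, b, c) \<in> edge_facets \<theta>" and p: "p \<in> \<theta>" "y \<in> \<theta>"
  shows "cross p c \<bullet> y = 0 \<longleftrightarrow> y = p"
proof -
  obtain s t where st: "p = a + s *\<^sub>R (b - a)" "y = a + t *\<^sub>R (b - a)"
    using edge_line[OF f p(1)] edge_line[OF f p(2)] by metis
  have d: "det3 a b c > 0" "a \<noteq> b" using f facetsD(4)[of a b c] facets_distinct[of a b c] by (auto simp: edge_facets_def)
  have perm: "det3 a c b = - det3 a b c" "det3 b c a = det3 a b c"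
    by (simp_all add: det3_coords algebra_simps)
  have "cross p c \<bullet> y = (s - t) * det3 a b c"
    unfolding det3_def[symmetric] st by (simp add: det3_lin perm algebra_simps)
  then show ?thesis using d st by auto
qed

lemma edge_segments_same:
  assumes f: "(a, b, c) \<in> edge_facets \<theta>" "(a', b', c') \<in> edge_facets \<theta>"
    and y: "y \<in> convex hull {a, b}" "y \<in> convex hull {a', b'}" "y \<notin> pts"
  shows "{a, b} = {a', b'}"
proof -
  have co: "\<exists>u v. y = u *\<^sub>R a + v *\<^sub>R b + 0 *\<^sub>R c \<and> u > 0 \<and> v > 0" if "y \<in> convex hull {a, b}" "(a, b, c) \<in> edge_facets \<theta>" for a b c
  proof -
    obtain u v where uv: "y = u *\<^sub>R a + v *\<^sub>R b" "u \<ge> 0" "v \<ge> 0" "u + v = 1"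
      using \<open>y \<in> convex hull {a, b}\<close> unfolding convex_hull_2 by blast
    have "a \<in> pts" "b \<in> pts" using that(2) facetsD(1,2) by (auto simp: edge_facets_def)
    then have "u \<noteq> 0" "v \<noteq> 0" using uv y(3) by auto
    then show ?thesis using uv by (intro exI[of _ u] exI[of _ v]) simp
  qed
  have F: "(a, b, c) \<in> facets" "(a', b', c') \<in> facets" and in\<theta>: "a \<in> \<theta>" "b \<in> \<theta>" "a' \<in> \<theta>" "b' \<in> \<theta>"
    using f by (auto simp: edge_facets_def)
  obtain u v where uv: "y = u *\<^sub>R a + v *\<^sub>R b + 0 *\<^sub>R c" "u > 0" "v > 0" using co[OF y(1) f(1)] by blast
  obtain u' v' where uv': "y = u' *\<^sub>R a' + v' *\<^sub>R b' + 0 *\<^sub>R c'" "u' > 0" "v' > 0" using co[OF y(2) f(2)] by blast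
  have "a \<in> {a', b', c'}" "b \<in> {a', b', c'}"
    using facet_cone_unique[OF F uv(1) _ _ _ uv'(1)] uv(2,3) uv'(2,3) by (simp_all add: less_imp_le)
  moreover have "c' \<noteq> a" "c' \<noteq> b" using edge_no_facet[OF F(2)] in\<theta> by auto
  moreover have "a \<noteq> b" using facets_distinct[OF F(1)] by simp
  ultimately show ?thesis by auto
qed

lemma edge_facets_opp: "(a, b, c) \<in> edge_facets \<theta> \<Longrightarrow> (b, a, opp b a) \<in> edge_facets \<theta>"
  by (auto simp: edge_facets_def intro: facets_opp)

text \<open>By emptiness each difference b - a generates the parallel lattice, so every segment has
  length 1 and the volume counts segments.\<close>

lemma normalized_vol_edge: "normalized_vol latt \<theta> = card (edge_facets \<theta>) / 2"
proof -
  obtain a b c where f: "(a, b, c) \<in> edge_facets \<theta>" using edge_facets_nonempty by auto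
  then have ne: "a \<noteq> b" using facets_distinct by (auto simp: edge_facets_def)
  have sub: "edge_facets \<theta> \<subseteq> facets" by (auto simp: edge_facets_def)
  have "int_span {b - a} = range (\<lambda>k::int. of_int k *\<^sub>R (b - a))"
    by (auto simp: int_span_def)
  then have B0: "lattice_basis (parallel_lattice latt \<theta>) {b - a}"
    using ne parallel_edge[OF f] by (simp add: lattice_basis_def)
  obtain g :: "1 \<Rightarrow> 'a" and p where g: "inj g" "lattice_basis (parallel_lattice latt \<theta>) (range g)" "p \<in> \<theta>"
    and vol: "lattice_vol latt \<theta> = measure lborel (coord_map p g -` \<theta>)"
    by (rule lattice_vol_eq[OF B0, where 'n = 1]) (use edge_proper in \<open>auto simp: compact_imp_closed\<close>)
  define e where "e = g 1"
  have re: "range g = {e}" by (auto simp: e_def)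
  have "int_span {e} = range (\<lambda>k::int. of_int k *\<^sub>R e)"
    by (auto simp: int_span_def)
  then have par: "parallel_lattice latt \<theta> = range (\<lambda>k::int. of_int k *\<^sub>R e)"
    using g(2) unfolding lattice_basis_def re by simp
  have "e \<noteq> 0" using g(2) unfolding lattice_basis_def re by simp
  have cm: "coord_map p g x = p + x $ 1 *\<^sub>R e" for x
    by (simp add: coord_map_def e_def sum_1)
  have ind: "x = 0" if "(\<Sum>i\<in>UNIV. x $ i *\<^sub>R g i) = 0" for x :: "real ^ 1"
    using that \<open>e \<noteq> 0\<close> by (simp add: sum_1 e_def vec_eq_iff)
  have unit: "\<exists>j :: int. \<bar>j\<bar> = 1 \<and> b' - a' = of_int j *\<^sub>R e" if f': "(a', b', c') \<in> edge_facets \<theta>" for a' b' c'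
  proof -
    have "range (\<lambda>k::int. of_int k *\<^sub>R e) = range (\<lambda>k::int. of_int k *\<^sub>R (b' - a'))"
      using par parallel_edge[OF f'] by simp
    moreover have "x \<in> range (\<lambda>k::int. of_int k *\<^sub>R x)" for x :: 'a by (rule range_eqI[of _ _ 1]) simp
    ultimately have "e \<in> range (\<lambda>k::int. of_int k *\<^sub>R (b' - a'))" "b' - a' \<in> range (\<lambda>k::int. of_int k *\<^sub>R e)" by metis+
    then obtain j k :: int where jk: "e = of_int k *\<^sub>R (b' - a')" "b' - a' = of_int j *\<^sub>R e" by blast
    then have "e = of_int (k * j) *\<^sub>R e" by (metis of_int_mult scaleR_scaleR)
    then have "k * j = 1" using \<open>e \<noteq> 0\<close> by (metis of_int_eq_1_iff scaleR_one scaleR_right_imp_eq)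
    from iffD1[OF zmult_eq_1_iff this] have "\<bar>j\<bar> = 1" by auto
    then show ?thesis using jk(2) by blast
  qed
  have coord: "\<exists>x. y = coord_map p g x" if y: "y \<in> \<theta>" for y
  proof -
    obtain j :: int where j: "b - a = of_int j *\<^sub>R e" using unit[OF f] by blast
    obtain s t where "p = a + s *\<^sub>R (b - a)" "y = a + t *\<^sub>R (b - a)"
      using edge_line[OF f g(3)] edge_line[OF f y] by metis
    then have "y = p + ((t - s) * j) *\<^sub>R e" by (simp add: j algebra_simps)
    then show ?thesis unfolding cm by (intro exI[of _ "\<chi> i. (t - s) * j"]) simp
  qed
  define I where "I = (\<lambda>(a, b, c). {a, b}) ` edge_facets \<theta>"
  have "measure lborel (coord_map p g -` \<theta>) = (\<Sum>S\<in>I. measure lborel (coord_map p g -` (convex hull S)))"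
  proof (rule measure_coord_map_cover[OF ind _ _ _ edge_proper(5), where M = "(\<lambda>q. cross q c) ` (pts \<inter> \<theta>)"])
    show "finite I" using finite_subset[OF sub finite_facets] by (simp add: I_def)
    show "compact (convex hull S)" if "S \<in> I" for S
      using that by (auto simp: I_def intro!: finite_imp_compact_convex_hull)
    show "convex hull S \<subseteq> \<theta>" if "S \<in> I" for S
      using that edge_proper(4) by (intro hull_minimal) (auto simp: I_def edge_facets_def)
    show "finite ((\<lambda>q. cross q c) ` (pts \<inter> \<theta>))" using finite_pts by simp
    show "\<exists>x. m \<bullet> coord_map p g x \<noteq> 0" if "m \<in> (\<lambda>q. cross q c) ` (pts \<inter> \<theta>)" for m
    proof -
      obtain q where q: "q \<in> \<theta>" "m = cross q c" using \<open>m \<in> _\<close> by blast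
      have ab: "a \<in> \<theta>" "b \<in> \<theta>" using f by (auto simp: edge_facets_def)
      have "m \<bullet> a \<noteq> 0 \<or> m \<bullet> b \<noteq> 0"
        using edge_separate[OF f q(1) ab(1)] edge_separate[OF f q(1) ab(2)] ne q(2) by auto
      then show ?thesis using coord[OF ab(1)] coord[OF ab(2)] by metis
    qed
    have np: "y \<notin> pts" if "y \<in> \<theta>" "\<forall>m\<in>(\<lambda>q. cross q c) ` (pts \<inter> \<theta>). m \<bullet> y \<noteq> 0" for y
      using that edge_separate[OF f] by auto
    show "\<exists>S\<in>I. y \<in> convex hull S" if y: "y \<in> \<theta>" "\<forall>m\<in>(\<lambda>q. cross q c) ` (pts \<inter> \<theta>). m \<bullet> y \<noteq> 0" for y
    proof -
      obtain a' b' c' u v where t: "(a', b', c') \<in> edge_facets \<theta>" "y = u *\<^sub>R a' + v *\<^sub>R b'" "u > 0" "v > 0" "u + v = 1"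
        using edge_cover[OF y(1) np[OF y]] by blast
      then have "y \<in> convex hull {a', b'}" unfolding convex_hull_2 by (auto intro: less_imp_le)
      then show ?thesis using t(1) by (force simp: I_def)
    qed
    show "S = S'" if S: "S \<in> I" "S' \<in> I" and y: "y \<in> convex hull S" "y \<in> convex hull S'"
      "\<forall>m\<in>(\<lambda>q. cross q c) ` (pts \<inter> \<theta>). m \<bullet> y \<noteq> 0" for y S S'
    proof -
      obtain a1 b1 c1 where t1: "(a1, b1, c1) \<in> edge_facets \<theta>" "S = {a1, b1}"
        using S(1) by (auto simp: I_def)
      obtain a2 b2 c2 where t2: "(a2, b2, c2) \<in> edge_facets \<theta>" "S' = {a2, b2}"
        using S(2) by (auto simp: I_def)
      have "convex hull S \<subseteq> \<theta>"
        using t1 edge_proper(4) by (intro hull_minimal) (auto simp: edge_facets_def)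
      then have "y \<notin> pts" using np y by blast
      then show ?thesis using edge_segments_same[OF t1(1) t2(1)] y t1(2) t2(2) by blast
    qed
  qed
  also have "\<dots> = (\<Sum>S\<in>I. 1)"
  proof (rule sum.cong[OF refl])
    fix S assume "S \<in> I"
    then obtain a' b' c' where t: "(a', b', c') \<in> edge_facets \<theta>" "S = {a', b'}" by (auto simp: I_def)
    obtain j :: int where j: "\<bar>j\<bar> = 1" "b' - a' = of_int j *\<^sub>R e" using unit[OF t(1)] by blast
    have "a' \<in> \<theta>" using t(1) by (auto simp: edge_facets_def)
    then obtain x where x: "a' = coord_map p g x" using coord by blast
    define y where "y = x + (\<chi> i. of_int j)"
    have "b' = a' + of_int j *\<^sub>R e" using j(2) by (metis add_diff_cancel_left' diff_add_cancel add.commute)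
    then have "b' = coord_map p g y" unfolding x cm by (simp add: y_def algebra_simps)
    then have Sxy: "S = coord_map p g ` {x, y}" using t(2) x by simp
    have "coord_map p g -` (convex hull S) = convex hull {x, y}"
      unfolding Sxy by (rule coord_map_affine_hull[where f = g, OF ind])
    then show "measure lborel (coord_map p g -` (convex hull S)) = 1"
      using j(1) by (simp add: measure_hull_real1 y_def flip: of_int_abs)
  qed
  finally have "lattice_vol latt \<theta> = card I" using vol by simp
  moreover have "card (edge_facets \<theta>) = 2 * card I"
    unfolding I_def using edge_facets_opp by (intro sum_edge_sets[OF sub])
  ultimately show ?thesis by (simp add: normalized_vol_def \<theta>(2))
qed

end

end

section \<open>The dual polytope\<close>

context fan_polytope
begin

lemma convex_dual_polytope: "convex (dual_polytope \<Delta>)"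
proof -
  have "dual_polytope \<Delta> = (\<Inter>x\<in>\<Delta>. {y. x \<bullet> y \<ge> - 1})" by (auto simp: dual_polytope_def inner_commute)
  then show ?thesis by (simp add: convex_INT convex_halfspace_ge)
qed

lemma level_in_dual: "(a, b, c) \<in> facets \<Longrightarrow> - level a b c \<in> dual_polytope \<Delta>"
  using level_le by (auto simp: dual_polytope_def)

text \<open>A linear functional on the dual polytope is a vector \<open>x\<close>, and the functional is minimized
  at the vertex belonging to the cone that contains \<open>x\<close>.\<close>

lemma dual_polytope_hull: "dual_polytope \<Delta> = convex hull ((\<lambda>(a, b, c). - level a b c) ` facets)"
proof
  define K where "K = convex hull ((\<lambda>(a, b, c). - level a b c) ` facets)"
  show "K \<subseteq> dual_polytope \<Delta>"
    unfolding K_def using level_in_dual by (intro hull_minimal convex_dual_polytope) auto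
  show "dual_polytope \<Delta> \<subseteq> K"
  proof (rule subsetI, rule ccontr)
    fix y assume y: "y \<in> dual_polytope \<Delta>" "y \<notin> K"
    have "compact K" unfolding K_def by (intro finite_imp_compact_convex_hull finite_imageI finite_facets)
    then have "closed K" by (rule compact_imp_closed)
    moreover have "convex K" by (simp add: K_def)
    ultimately obtain x \<beta> where x: "x \<bullet> y < \<beta>" "\<And>v. v \<in> K \<Longrightarrow> x \<bullet> v > \<beta>"
      using separating_hyperplane_closed_point[of K y] y(2) by blast
    obtain a b c u v w where f: "(a, b, c) \<in> facets" and xe: "x = u *\<^sub>R a + v *\<^sub>R b + w *\<^sub>R c" "u \<ge> 0" "v \<ge> 0" "w \<ge> 0"
      by (rule cover)
    have "- level a b c \<in> K" unfolding K_def using f by (intro hull_inc) force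
    then have "x \<bullet> (- level a b c) > \<beta>" by (rule x(2))
    moreover have "x \<bullet> (- level a b c) = - (u + v + w)"
      using level_inner[OF f] by (simp add: xe(1) inner_add_right inner_commute[of _ "level a b c"])
    moreover have "u * (y \<bullet> a) + v * (y \<bullet> b) + w * (y \<bullet> c) \<ge> u * (- 1) + v * (- 1) + w * (- 1)"
      using y(1) facet_in_\<Delta>[OF f] xe(2-) by (intro add_mono mult_left_mono) (auto simp: dual_polytope_def)
    moreover have "x \<bullet> y = u * (y \<bullet> a) + v * (y \<bullet> b) + w * (y \<bullet> c)"
      by (simp add: xe(1) inner_add_right inner_commute[of _ y])
    ultimately show False using x(1) by simp
  qed
qed

lemma det3_level_dual:
  assumes f: "(a, b, c) \<in> facets"
  shows "det3 a b c *\<^sub>R level a b c \<in> dual_lattice latt"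
proof -
  have "det3 a b c *\<^sub>R level a b c = cross b c + cross c a + cross a b"
    using facetsD(4)[OF f] by (simp add: level_def dual_fun_def)
  moreover have "x + y \<in> dual_lattice latt" if "x \<in> dual_lattice latt" "y \<in> dual_lattice latt" for x y
    using that by (simp add: dual_lattice_def inner_add_left)
  ultimately show ?thesis using cross_dual_lattice facet_latt[OF f] by metis
qed

text \<open>The dual polytope is spanned by the negated levels, each of which becomes integral after
  multiplication by its determinant; the product of all determinants clears every denominator.
  Existence of l gives the choice in \<open>rational_normalized_vol\<close> its meaning.\<close>

lemma dual_polytope_rational:
  "\<exists>l::nat. l > 0 \<and> lattice_polytope (dual_lattice latt) ((*\<^sub>R) (real l) ` dual_polytope \<Delta>)"
proof -
  define n where "n = (\<lambda>(a, b, c). nat \<lfloor>det3 a b c\<rfloor>)"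
  have n: "det3 a b c = real (n (a, b, c))" "n (a, b, c) > 0" if f: "(a, b, c) \<in> facets" for a b c
  proof -
    obtain i where i: "det3 a b c = of_int i" using det3_Ints facet_latt[OF f] by (meson Ints_cases)
    then have "i > 0" using facetsD(4)[OF f] by simp
    then show "det3 a b c = real (n (a, b, c))" "n (a, b, c) > 0" using i by (simp_all add: n_def)
  qed
  define l where "l = prod n facets"
  have l: "l > 0" unfolding l_def using n(2) by (intro prod_pos) auto
  define V where "V = (\<lambda>(a, b, c). - level a b c) ` facets"
  have eq: "(*\<^sub>R) (real l) ` dual_polytope \<Delta> = convex hull ((*\<^sub>R) (real l) ` V)"
    unfolding dual_polytope_hull V_def[symmetric] by (rule convex_hull_scaling[symmetric])
  have fin: "finite ((*\<^sub>R) (real l) ` V)" using finite_facets by (simp add: V_def)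
  have V: "real l *\<^sub>R v \<in> dual_lattice latt" if v: "v \<in> V" for v
  proof -
    obtain a b c where f: "(a, b, c) \<in> facets" "v = - level a b c" using v by (auto simp: V_def)
    have "n (a, b, c) dvd l" unfolding l_def by (rule dvd_prodI[OF finite_facets f(1)])
    then obtain k where k: "l = n (a, b, c) * k" ..
    have "real l *\<^sub>R v = (- real k) *\<^sub>R (det3 a b c *\<^sub>R level a b c)"
      by (simp add: f(2) k n(1)[OF f(1)])
    also have "\<dots> \<in> dual_lattice latt"
    proof -
      have "(- real k) *\<^sub>R m \<in> dual_lattice latt" if "m \<in> dual_lattice latt" for m
        using that by (auto simp: dual_lattice_def intro!: Ints_mult)
      then show ?thesis using det3_level_dual[OF f(1)] .
    qed
    finally show ?thesis .
  qed
  obtain C where C: "\<And>x. x \<in> \<Delta> \<Longrightarrow> norm x \<le> C" "C > 0"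
    using compact_imp_bounded[OF \<Delta>(2)] by (auto simp: bounded_pos)
  have ball: "cball 0 (1 / C) \<subseteq> dual_polytope \<Delta>"
  proof
    fix y :: 'a assume "y \<in> cball 0 (1 / C)"
    then have y: "norm y \<le> 1 / C" by simp
    have "y \<bullet> x \<ge> - 1" if "x \<in> \<Delta>" for x
    proof -
      have "\<bar>y \<bullet> x\<bar> \<le> norm y * norm x" by (rule Cauchy_Schwarz_ineq2)
      also have "\<dots> \<le> 1 / C * C" using y C that by (intro mult_mono) auto
      finally show ?thesis using C(2) by simp
    qed
    then show "y \<in> dual_polytope \<Delta>" by (simp add: dual_polytope_def)
  qed
  have "aff_dim (cball (0 :: 'a) (1 / C)) = int DIM('a)" using C(2) by (simp add: aff_dim_cball)
  then have "aff_dim (dual_polytope \<Delta>) = int DIM('a)"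
    using aff_dim_subset[OF ball] aff_dim_le_DIM[of "dual_polytope \<Delta>"] by simp
  moreover have "aff_dim ((*\<^sub>R) (real l) ` dual_polytope \<Delta>) = aff_dim (dual_polytope \<Delta>)"
    using l by (intro aff_dim_injective_linear_image linear_scaleR) (simp add: inj_def)
  ultimately have "lattice_polytope (dual_lattice latt) ((*\<^sub>R) (real l) ` dual_polytope \<Delta>)"
    unfolding lattice_polytope_def eq
    using fin V extreme_point_of_convex_hull[of _ "(*\<^sub>R) (real l) ` V"] by (auto simp: polytope_convex_hull)
  then show ?thesis using l by blast
qed

lemma kink_nonneg: "(a, b, c) \<in> facets \<Longrightarrow> kink a b c \<ge> 0"
  using level_le[OF facets_opp, of a b c c] facet_in_\<Delta>[of a b c] facetsD(4)[of a b c] by (simp add: kink_def)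

text \<open>Without a bend both adjacent triangles have the same level. The exposing functional of
  the edge minus this level is a multiple of \<open>cross a b\<close>, so it has opposite signs at
  the two apexes, yet it is nonpositive at both. Hence it vanishes, and the apex c would lie in the
  edge.\<close>

lemma edge_kink_pos:
  assumes \<theta>: "\<theta> face_of \<Delta>" "aff_dim \<theta> = 1" and f: "(a, b, c) \<in> edge_facets \<theta>"
  shows "kink a b c > 0"
proof (rule ccontr)
  assume "\<not> kink a b c > 0"
  have F: "(a, b, c) \<in> facets" and ab: "a \<in> \<theta>" "b \<in> \<theta>" using f by (auto simp: edge_facets_def)
  note G = facets_opp[OF F]
  have "kink a b c = 0" using \<open>\<not> kink a b c > 0\<close> kink_nonneg[OF F] by simp
  then have LL: "level b a (opp b a) = level a b c" using level_diff_kink[OF F] by simp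
  obtain l where l: "\<And>x. x \<in> \<Delta> \<Longrightarrow> l \<bullet> x \<le> 1" "\<theta> = \<Delta> \<inter> {x. l \<bullet> x = 1}"
    using face_functional[OF \<theta>(1) edge_proper(2,1)[OF \<theta>]] by blast
  define m where "m = l - level a b c"
  have m0: "m \<bullet> a = 0" "m \<bullet> b = 0"
    using ab l(2) level_inner[OF F] by (auto simp: m_def inner_diff_left)
  have mc: "m \<bullet> c \<le> 0" "m \<bullet> opp b a \<le> 0"
    using l(1) facet_in_\<Delta>[OF F] facet_in_\<Delta>[OF G] level_inner[OF F] level_inner[OF G] LL
    by (simp_all add: m_def inner_diff_left)
  have d: "det3 a b c > 0" "det3 a b (opp b a) < 0"
    using facetsD(4)[OF F] facetsD(4)[OF G] det3_swap[of b a "opp b a"] by simp_all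
  have "m = (m \<bullet> c / det3 a b c) *\<^sub>R cross a b"
    using d(1) by (intro orthogonal_cross[OF _ m0]) simp
  then have "m \<bullet> opp b a = (m \<bullet> c / det3 a b c) * det3 a b (opp b a)"
    unfolding det3_def by (metis inner_scaleR_left)
  moreover have "(m \<bullet> c / det3 a b c) * det3 a b (opp b a) \<ge> 0"
    using d mc(1) by (simp add: divide_nonpos_pos mult_nonpos_nonpos)
  ultimately have "(m \<bullet> c / det3 a b c) * det3 a b (opp b a) = 0" using mc(2) by simp
  then have "m \<bullet> c = 0" using d by simp
  then have "c \<in> \<theta>" using l(2) facet_in_\<Delta>[OF F] level_inner[OF F] by (simp add: m_def inner_diff_left)
  then show False using edge_no_facet[OF \<theta> F] ab by blast
qed

text \<open>The conditions at a and b confine y to the line through - \<open>level a b c\<close> in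
  direction \<open>cross a b\<close>. The inequalities at the two adjacent apexes bound y to the
  segment between the two negated levels, and both ends belong to the dual polytope.\<close>

lemma dual_face_edge:
  assumes \<theta>: "\<theta> face_of \<Delta>" "aff_dim \<theta> = 1" and f: "(a, b, c) \<in> edge_facets \<theta>"
  shows "dual_face \<Delta> \<theta> = closed_segment (- level a b c) (- level a b c + kink a b c *\<^sub>R cross a b)"
proof (intro equalityI subsetI)
  define L L' k where "L = level a b c" and "L' = level b a (opp b a)" and "k = kink a b c"
  have F: "(a, b, c) \<in> facets" and ab: "a \<in> \<theta>" "b \<in> \<theta>" using f by (auto simp: edge_facets_def)
  note G = facets_opp[OF F]
  have d: "det3 a b c > 0" "det3 a b (opp b a) < 0"
    using facetsD(4)[OF F] facetsD(4)[OF G] det3_swap[of b a "opp b a"] by simp_all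
  have k: "k > 0" using edge_kink_pos[OF \<theta> f] by (simp add: k_def)
  have LL: "L - L' = k *\<^sub>R cross a b" using level_diff_kink[OF F] by (simp add: L_def L'_def k_def)
  have Lv: "L \<bullet> a = 1" "L \<bullet> b = 1" "L \<bullet> c = 1" "L' \<bullet> a = 1" "L' \<bullet> b = 1" "L' \<bullet> opp b a = 1"
    using level_inner[OF F] level_inner[OF G] by (simp_all add: L_def L'_def)
  fix y
  show "y \<in> closed_segment (- level a b c) (- level a b c + kink a b c *\<^sub>R cross a b)" if y: "y \<in> dual_face \<Delta> \<theta>"
  proof -
    have ya: "y \<bullet> a = - 1" "y \<bullet> b = - 1" using y ab by (auto simp: dual_face_def)
    have yc: "y \<bullet> c \<ge> - 1" "y \<bullet> opp b a \<ge> - 1"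
      using y facet_in_\<Delta>[OF F] facet_in_\<Delta>[OF G] by (auto simp: dual_face_def dual_polytope_def)
    define s where "s = ((y + L) \<bullet> c) / det3 a b c"
    have "y + L = s *\<^sub>R cross a b"
      unfolding s_def using d(1) ya Lv by (intro orthogonal_cross) (auto simp: inner_add_left)
    then have ys: "y = - L + s *\<^sub>R cross a b" by (metis add.commute add_diff_cancel_right' diff_conv_add_uminus)
    have "s \<ge> 0" unfolding s_def using yc(1) Lv d(1) by (simp add: inner_add_left)
    moreover have "s \<le> k"
    proof -
      have "y = - L' + (s - k) *\<^sub>R cross a b" using LL ys by (simp add: algebra_simps)
      then have "y \<bullet> opp b a = - 1 + (s - k) * det3 a b (opp b a)"
        by (simp add: inner_add_left inner_diff_left Lv det3_def)
      then have "(s - k) * det3 a b (opp b a) \<ge> 0" using yc(2) by simp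
      then show ?thesis using d(2) by (auto simp: zero_le_mult_iff)
    qed
    ultimately show ?thesis
      unfolding L_def[symmetric] k_def[symmetric] closed_segment_def using k ys
      by (intro CollectI exI[of _ "s / k"]) (simp add: algebra_simps)
  qed
  show "y \<in> dual_face \<Delta> \<theta>" if y: "y \<in> closed_segment (- level a b c) (- level a b c + kink a b c *\<^sub>R cross a b)"
  proof -
    have "- L + k *\<^sub>R cross a b = - L'" using LL by (simp add: algebra_simps)
    then have y2: "y \<in> closed_segment (- L) (- L')" using y by (simp add: L_def k_def)
    have "y \<in> dual_polytope \<Delta>"
      using closed_segment_subset[OF _ _ convex_dual_polytope, of "- L" "- L'"] y2 level_in_dual[OF F] level_in_dual[OF G]
      by (auto simp: L_def L'_def)
    moreover have "y \<bullet> x = - 1" if x: "x \<in> \<theta>" for x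
    proof -
      obtain t where t: "x = a + t *\<^sub>R (b - a)" using edge_line[OF \<theta> f x] .
      obtain u where u: "y = (1 - u) *\<^sub>R (- L) + u *\<^sub>R (- L')" using y2 by (auto simp: closed_segment_def)
      have "L \<bullet> x = 1" "L' \<bullet> x = 1" unfolding t by (simp_all add: inner_add_right inner_diff_right Lv)
      then show ?thesis unfolding u by (simp add: inner_diff_left inner_add_left)
    qed
    ultimately show ?thesis by (simp add: dual_face_def)
  qed
qed

text \<open>\<open>cross a b\<close> is primitive: it takes the value 1 at the lattice vector that
  completes a, b to a basis, so a real multiple of it in the dual lattice is an integral
  multiple.\<close>

lemma parallel_dual_segment:
  assumes F: "(a, b, c) \<in> facets" and t: "t > 0"
  shows "parallel_lattice (dual_lattice latt) (closed_segment P (P + t *\<^sub>R cross a b)) = range (\<lambda>k::int. of_int k *\<^sub>R cross a b)"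
proof -
  define m S where "m = cross a b" and "S = closed_segment P (P + t *\<^sub>R cross a b)"
  define D where "D = {x - y | x y. x \<in> S \<and> y \<in> S}"
  note l = facet_latt[OF F]
  have "D \<subseteq> span {m}"
  proof
    fix z assume "z \<in> D"
    then obtain x y where xy: "z = x - y" "x \<in> S" "y \<in> S" by (auto simp: D_def)
    obtain u v where uv: "x = (1 - u) *\<^sub>R P + u *\<^sub>R (P + t *\<^sub>R m)" "y = (1 - v) *\<^sub>R P + v *\<^sub>R (P + t *\<^sub>R m)"
      using xy(2,3) unfolding S_def m_def closed_segment_def by blast
    have "z = ((u - v) * t) *\<^sub>R m" unfolding xy(1) uv by (simp add: algebra_simps)
    then show "z \<in> span {m}" by (simp add: span_scale span_base)
  qed
  moreover have "m \<in> span D"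
  proof -
    have "t *\<^sub>R m \<in> D"
      unfolding D_def S_def m_def by (intro CollectI exI[of _ "P + t *\<^sub>R cross a b"] exI[of _ P]) simp
    then have "(1 / t) *\<^sub>R (t *\<^sub>R m) \<in> span D" by (intro span_scale span_base)
    then show ?thesis using t by simp
  qed
  ultimately have "span D = span {m}"
    by (intro antisym span_minimal) auto
  then have "parallel_lattice (dual_lattice latt) S = dual_lattice latt \<inter> range (\<lambda>t. t *\<^sub>R m)"
    by (simp add: parallel_lattice_def D_def span_singleton)
  also have "\<dots> = range (\<lambda>k::int. of_int k *\<^sub>R m)"
  proof (intro equalityI subsetI)
    fix z assume "z \<in> dual_lattice latt \<inter> range (\<lambda>t. t *\<^sub>R m)"
    then obtain s where s: "z \<in> dual_lattice latt" "z = s *\<^sub>R m" by blast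
    obtain e where e: "e \<in> latt" "det3 a b e = 1"
      using empty_simplex_complement[OF facet_empty_simplex[OF F] _ _ _ facetsD(4)[OF F]] l by metis
    have "z \<bullet> e = s" using e(2) by (simp add: s(2) m_def det3_def)
    moreover have "z \<bullet> e \<in> \<int>" using s(1) e(1) by (auto simp: dual_lattice_def)
    ultimately show "z \<in> range (\<lambda>k::int. of_int k *\<^sub>R m)" using s(2) by (auto elim!: Ints_cases)
  next
    fix z assume "z \<in> range (\<lambda>k::int. of_int k *\<^sub>R m)"
    then show "z \<in> dual_lattice latt \<inter> range (\<lambda>t. t *\<^sub>R m)"
      using cross_dual_lattice[of a b] l by (auto simp: m_def dual_lattice_def intro!: Ints_mult)
  qed
  finally show ?thesis by (simp add: S_def m_def)
qed

text \<open>Dilation by the unknown l multiplies the length by l, and division by l to the power 1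
  removes it again.\<close>

lemma rational_normalized_vol_dual_edge:
  assumes \<theta>: "\<theta> face_of \<Delta>" "aff_dim \<theta> = 1" and f: "(a, b, c) \<in> edge_facets \<theta>"
  shows "rational_normalized_vol (dual_lattice latt) (dual_polytope \<Delta>) (dual_face \<Delta> \<theta>) = kink a b c"
proof -
  have F: "(a, b, c) \<in> facets" using f by (auto simp: edge_facets_def)
  define l where "l = (SOME l::nat. l > 0 \<and> lattice_polytope (dual_lattice latt) ((*\<^sub>R) (real l) ` dual_polytope \<Delta>))"
  have l: "l > 0" unfolding l_def using someI_ex[OF dual_polytope_rational] by blast
  define P k where "P = - level a b c" and "k = kink a b c"
  have k: "k > 0" using edge_kink_pos[OF \<theta> f] by (simp add: k_def)
  have m0: "cross a b \<noteq> 0" using cross_nonzero[of a b c] facetsD(4)[OF F] by simp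
  have face: "dual_face \<Delta> \<theta> = closed_segment P (P + k *\<^sub>R cross a b)"
    using dual_face_edge[OF \<theta> f] by (simp add: P_def k_def)
  have "(*\<^sub>R) (real l) ` dual_face \<Delta> \<theta> = closed_segment (real l *\<^sub>R P) (real l *\<^sub>R (P + k *\<^sub>R cross a b))"
    unfolding face by (rule closed_segment_linear_image[symmetric]) (rule linear_scaleR)
  then have lface: "(*\<^sub>R) (real l) ` dual_face \<Delta> \<theta> = closed_segment (real l *\<^sub>R P) (real l *\<^sub>R P + (real l * k) *\<^sub>R cross a b)"
    by (simp add: scaleR_add_right)
  have dim: "aff_dim (closed_segment Q (Q + t *\<^sub>R cross a b)) = 1" if "t > 0" for Q t
    using that m0 by (simp add: segment_convex_hull aff_dim_convex_hull aff_dim_2)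
  have lk: "real l * k > 0" using l k by simp
  have "lattice_vol (dual_lattice latt) ((*\<^sub>R) (real l) ` dual_face \<Delta> \<theta>) = real l * k"
    unfolding lface by (rule lattice_vol_segment[OF m0 lk parallel_dual_segment[OF F lk]])
  moreover have "aff_dim ((*\<^sub>R) (real l) ` dual_face \<Delta> \<theta>) = 1" unfolding lface by (rule dim[OF lk])
  moreover have "aff_dim (dual_face \<Delta> \<theta>) = 1" unfolding face by (rule dim[OF k])
  ultimately show ?thesis
    unfolding rational_normalized_vol_def Let_def l_def[symmetric] normalized_vol_def using l by (simp add: k_def)
qed

text \<open>A bend means that the triangles at the segment lie in different facets, whose
  intersection contains a and b and is therefore an edge. Contrapositively, segments inside a
  two-dimensional face drop out of the sum of kinks.\<close>

lemma kink_edge: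
  assumes F: "(a, b, c) \<in> facets" and k: "kink a b c \<noteq> 0"
  obtains \<theta> where "\<theta> face_of \<Delta>" "aff_dim \<theta> = 1" "(a, b, c) \<in> edge_facets \<theta>"
proof -
  note G = facets_opp[OF F]
  define \<theta> where "\<theta> = fac a b c \<inter> fac b a (opp b a)"
  have face: "\<theta> face_of \<Delta>" unfolding \<theta>_def using fac_face[OF F] fac_face[OF G] by (rule face_of_Int)
  have ab: "a \<in> \<theta>" "b \<in> \<theta>" using in_fac[OF F] in_fac[OF G] by (auto simp: \<theta>_def)
  have "c \<notin> fac b a (opp b a)" using k by (auto simp: kink_def fac_def)
  then have "\<theta> \<noteq> fac a b c" using in_fac[OF F] by (auto simp: \<theta>_def)
  moreover have "\<theta> face_of fac a b c"
    using face_of_subset[OF face, of "fac a b c"] by (auto simp: \<theta>_def fac_def)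
  ultimately have "aff_dim \<theta> < 2"
    using face_of_aff_dim_lt[OF face_of_imp_convex[OF fac_face[OF F]]] aff_dim_fac[OF F] by auto
  moreover have "aff_dim {a, b} \<le> aff_dim \<theta>" using ab by (intro aff_dim_subset) auto
  then have "1 \<le> aff_dim \<theta>" using facets_distinct[OF F] by (simp add: aff_dim_2)
  ultimately show thesis using that[of \<theta>] face ab F by (simp add: edge_facets_def)
qed

lemma edge_unique:
  assumes "\<theta> face_of \<Delta>" "aff_dim \<theta> = 1" "\<theta>' face_of \<Delta>" "aff_dim \<theta>' = 1"
    and f: "(a, b, c) \<in> edge_facets \<theta>" "(a, b, c) \<in> edge_facets \<theta>'"
  shows "\<theta> = \<theta>'"
proof -
  have sub: "\<theta> \<inter> \<theta>' = \<theta>" if \<theta>: "\<theta> face_of \<Delta>" "aff_dim \<theta> = 1" "\<theta>' face_of \<Delta>"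
    and f: "(a, b, c) \<in> edge_facets \<theta>" "(a, b, c) \<in> edge_facets \<theta>'" for \<theta> \<theta>'
  proof (rule ccontr)
    assume ne: "\<theta> \<inter> \<theta>' \<noteq> \<theta>"
    have ab: "a \<in> \<theta> \<inter> \<theta>'" "b \<in> \<theta> \<inter> \<theta>'" "a \<noteq> b" using f facets_distinct[of a b c] by (auto simp: edge_facets_def)
    have "\<theta> \<inter> \<theta>' face_of \<theta>"
      using face_of_subset[OF face_of_Int[OF \<theta>(1,3)], of \<theta>] face_of_imp_subset[OF \<theta>(1)] by auto
    then have "aff_dim (\<theta> \<inter> \<theta>') < 1"
      using face_of_aff_dim_lt[OF face_of_imp_convex[OF \<theta>(1)]] ne \<theta>(2) by auto
    moreover have "aff_dim {a, b} \<le> aff_dim (\<theta> \<inter> \<theta>')" using ab by (intro aff_dim_subset) auto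
    ultimately show False using ab(3) by (simp add: aff_dim_2)
  qed
  show ?thesis using sub[OF assms(1,2,3) f] sub[OF assms(3,4,1) f(2,1)] by blast
qed

text \<open>The kink is the same for all triples of an edge, being the length of its dual, so each
  product becomes half a sum of kinks over directed segments; triples belonging to no edge
  contribute 0.\<close>

lemma sum_edges:
  "(\<Sum>\<theta> | \<theta> face_of \<Delta> \<and> aff_dim \<theta> = 1. normalized_vol latt \<theta> *
      rational_normalized_vol (dual_lattice latt) (dual_polytope \<Delta>) (dual_face \<Delta> \<theta>))
    = (\<Sum>(a, b, c)\<in>facets. kink a b c) / 2"
proof -
  define E where "E = {\<theta>. \<theta> face_of \<Delta> \<and> aff_dim \<theta> = 1}"
  define K where "K = (\<lambda>(a, b, c). kink a b c)"
  define W where "W \<theta> = rational_normalized_vol (dual_lattice latt) (dual_polytope \<Delta>) (dual_face \<Delta> \<theta>)" for \<theta>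
  have finE: "finite E" using finite_subset[OF _ finite_polytope_faces[OF polytope], of E] by (auto simp: E_def)
  have sub: "edge_facets \<theta> \<subseteq> facets" for \<theta> by (auto simp: edge_facets_def)
  have finf: "finite (edge_facets \<theta>)" for \<theta> using finite_subset[OF sub finite_facets] .
  have "(\<Sum>\<theta>\<in>E. normalized_vol latt \<theta> * W \<theta>) = (\<Sum>\<theta>\<in>E. (\<Sum>t\<in>edge_facets \<theta>. K t) / 2)"
  proof (rule sum.cong[OF refl])
    fix \<theta> assume "\<theta> \<in> E"
    then have \<theta>: "\<theta> face_of \<Delta>" "aff_dim \<theta> = 1" by (auto simp: E_def)
    have "K t = W \<theta>" if "t \<in> edge_facets \<theta>" for t
      using rational_normalized_vol_dual_edge[OF \<theta>] that by (cases t) (simp add: K_def W_def)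
    then have "(\<Sum>t\<in>edge_facets \<theta>. K t) = (\<Sum>t\<in>edge_facets \<theta>. W \<theta>)" by (rule sum.cong[OF refl])
    then show "normalized_vol latt \<theta> * W \<theta> = (\<Sum>t\<in>edge_facets \<theta>. K t) / 2"
      using normalized_vol_edge[OF \<theta>] by simp
  qed
  also have "\<dots> = (\<Sum>\<theta>\<in>E. \<Sum>t\<in>edge_facets \<theta>. K t) / 2" by (simp add: sum_divide_distrib)
  also have "(\<Sum>\<theta>\<in>E. \<Sum>t\<in>edge_facets \<theta>. K t) = sum K (\<Union>\<theta>\<in>E. edge_facets \<theta>)"
  proof (rule sum.UNION_disjoint[symmetric, OF finE])
    show "\<forall>\<theta>\<in>E. finite (edge_facets \<theta>)" using finf by blast
    show "\<forall>\<theta>\<in>E. \<forall>\<theta>'\<in>E. \<theta> \<noteq> \<theta>' \<longrightarrow> edge_facets \<theta> \<inter> edge_facets \<theta>' = {}"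
    proof (intro ballI impI, rule ccontr)
      fix \<theta> \<theta>' assume t: "\<theta> \<in> E" "\<theta>' \<in> E" "\<theta> \<noteq> \<theta>'" "edge_facets \<theta> \<inter> edge_facets \<theta>' \<noteq> {}"
      then obtain a b c where "(a, b, c) \<in> edge_facets \<theta>" "(a, b, c) \<in> edge_facets \<theta>'" by auto
      then show False using edge_unique[of \<theta> \<theta>' a b c] t(1-3) by (auto simp: E_def)
    qed
  qed
  also have "\<dots> = sum K facets"
  proof (rule sum.mono_neutral_left[OF finite_facets])
    show "(\<Union>\<theta>\<in>E. edge_facets \<theta>) \<subseteq> facets" using sub by blast
    show "\<forall>t\<in>facets - (\<Union>\<theta>\<in>E. edge_facets \<theta>). K t = 0"
    proof
      fix t assume t: "t \<in> facets - (\<Union>\<theta>\<in>E. edge_facets \<theta>)"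
      obtain a b c where abc: "t = (a, b, c)" by (cases t)
      show "K t = 0"
      proof (rule ccontr)
        assume "K t \<noteq> 0"
        then have "kink a b c \<noteq> 0" "(a, b, c) \<in> facets" using t by (auto simp: K_def abc)
        then obtain \<theta> where "\<theta> face_of \<Delta>" "aff_dim \<theta> = 1" "(a, b, c) \<in> edge_facets \<theta>" using kink_edge by metis
        then show False using t by (auto simp: E_def abc)
      qed
    qed
  qed
  finally show ?thesis unfolding E_def W_def K_def .
qed

text \<open>All triangles of a face have the same determinant, namely its lattice distance, so a
  face contributes a third of the sum over its triples.\<close>

lemma sum_faces:
  "(\<Sum>\<theta> | \<theta> face_of \<Delta> \<and> aff_dim \<theta> = 2. 1 / real (lattice_distance latt \<Delta> \<theta>) * normalized_vol latt \<theta>)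
    = (\<Sum>(a, b, c)\<in>facets. 1 / det3 a b c) / 3"
proof -
  define E where "E = {\<theta>. \<theta> face_of \<Delta> \<and> aff_dim \<theta> = 2}"
  define K where "K = (\<lambda>(a, b, c). 1 / det3 a b c)"
  have finE: "finite E" using finite_subset[OF _ finite_polytope_faces[OF polytope], of E] by (auto simp: E_def)
  have sub: "facets_in \<theta> \<subseteq> facets" for \<theta> by (auto simp: facets_in_def)
  have finf: "finite (facets_in \<theta>)" for \<theta> using finite_subset[OF sub finite_facets] .
  have fe: "\<theta> = fac a b c" if "\<theta> \<in> E" "(a, b, c) \<in> facets_in \<theta>" for \<theta> a b c
  proof -
    have "\<theta> \<noteq> \<Delta>" using that(1) aff_dim_\<Delta> by (auto simp: E_def)
    then show ?thesis using that facet_face_eq[of \<theta> a b c] by (simp add: E_def facets_in_def)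
  qed
  have "(\<Sum>\<theta>\<in>E. 1 / real (lattice_distance latt \<Delta> \<theta>) * normalized_vol latt \<theta>) = (\<Sum>\<theta>\<in>E. (\<Sum>t\<in>facets_in \<theta>. K t) / 3)"
  proof (rule sum.cong[OF refl])
    fix \<theta> assume \<theta>: "\<theta> \<in> E"
    then have "\<theta> face_of \<Delta>" "aff_dim \<theta> = 2" by (auto simp: E_def)
    then obtain a b c where f: "(a, b, c) \<in> facets" "\<theta> = fac a b c" by (rule face_contains_facet)
    have "K t = 1 / real (lattice_distance latt \<Delta> \<theta>)" if t: "t \<in> facets_in \<theta>" for t
    proof -
      obtain a' b' c' where abc: "t = (a', b', c')" by (cases t)
      have "\<theta> = fac a' b' c'" "(a', b', c') \<in> facets" using fe[OF \<theta>] t sub[of \<theta>] by (auto simp: abc)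
      then show ?thesis using lattice_distance_fac by (simp add: K_def abc)
    qed
    then have K: "(\<Sum>t\<in>facets_in \<theta>. K t) = (\<Sum>t\<in>facets_in \<theta>. 1 / real (lattice_distance latt \<Delta> \<theta>))" by (rule sum.cong[OF refl])
    show "1 / real (lattice_distance latt \<Delta> \<theta>) * normalized_vol latt \<theta> = (\<Sum>t\<in>facets_in \<theta>. K t) / 3"
      unfolding K normalized_vol_fac[OF f(1), folded f(2)] by simp
  qed
  also have "\<dots> = (\<Sum>\<theta>\<in>E. \<Sum>t\<in>facets_in \<theta>. K t) / 3" by (simp add: sum_divide_distrib)
  also have "(\<Sum>\<theta>\<in>E. \<Sum>t\<in>facets_in \<theta>. K t) = sum K (\<Union>\<theta>\<in>E. facets_in \<theta>)"
  proof (rule sum.UNION_disjoint[symmetric, OF finE])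
    show "\<forall>\<theta>\<in>E. finite (facets_in \<theta>)" using finf by blast
    show "\<forall>\<theta>\<in>E. \<forall>\<theta>'\<in>E. \<theta> \<noteq> \<theta>' \<longrightarrow> facets_in \<theta> \<inter> facets_in \<theta>' = {}"
    proof (intro ballI impI, rule ccontr)
      fix \<theta> \<theta>' assume t: "\<theta> \<in> E" "\<theta>' \<in> E" "\<theta> \<noteq> \<theta>'" "facets_in \<theta> \<inter> facets_in \<theta>' \<noteq> {}"
      then obtain a b c where "(a, b, c) \<in> facets_in \<theta>" "(a, b, c) \<in> facets_in \<theta>'" by auto
      then show False using fe[OF t(1), of a b c] fe[OF t(2), of a b c] t(3) by simp
    qed
  qed
  also have "(\<Union>\<theta>\<in>E. facets_in \<theta>) = facets"
  proof
    show "(\<Union>\<theta>\<in>E. facets_in \<theta>) \<subseteq> facets" using sub by blast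
    show "facets \<subseteq> (\<Union>\<theta>\<in>E. facets_in \<theta>)"
    proof
      fix t assume "t \<in> facets"
      obtain a b c where abc: "t = (a, b, c)" by (cases t)
      then have f: "(a, b, c) \<in> facets" using \<open>t \<in> facets\<close> by simp
      then have "fac a b c \<in> E" "(a, b, c) \<in> facets_in (fac a b c)"
        using fac_face aff_dim_fac in_fac[OF f] by (simp_all add: E_def facets_in_def)
      then show "t \<in> (\<Union>\<theta>\<in>E. facets_in \<theta>)" using abc by blast
    qed
  qed
  finally show ?thesis unfolding E_def K_def .
qed

text \<open>A third of \<open>sum_kinks\<close>: the coefficient 3 / 2 of the kinks becomes the half
  in \<open>sum_edges\<close>, and 72 becomes 24.\<close>

lemma twenty_four:
  "24 = normalized_vol latt \<Delta>
       - (\<Sum>\<theta> | \<theta> face_of \<Delta> \<and> aff_dim \<theta> = 2. 1 / real (lattice_distance latt \<Delta> \<theta>) * normalized_vol latt \<theta>)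
       + (\<Sum>\<theta> | \<theta> face_of \<Delta> \<and> aff_dim \<theta> = 1. normalized_vol latt \<theta> *
            rational_normalized_vol (dual_lattice latt) (dual_polytope \<Delta>) (dual_face \<Delta> \<theta>))"
  using sum_kinks unfolding normalized_vol_\<Delta> sum_faces sum_edges
  by (simp add: case_prod_unfold sum.distrib sum_subtractf sum_distrib_left[symmetric] sum_divide_distrib[symmetric])

end

section \<open>The formula\<close>

lemma exists_biorthogonal:
  fixes B :: "'a::euclidean_space set"
  assumes "independent B" "span B = UNIV" "card B = 3"
  obtains b1 b2 b3 d1 d2 d3 where "lattice3 b1 b2 b3 d1 d2 d3" "B = {b1, b2, b3}"
proof -
  obtain b1 b2 b3 where B: "B = {b1, b2, b3}" "b1 \<noteq> b2" "b1 \<noteq> b3" "b2 \<noteq> b3"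
    using assms(3) by (auto simp: card_3_iff)
  have "\<exists>d. \<forall>x\<in>B. d \<bullet> x = (if x = b then 1 else 0)" for b
  proof -
    obtain h :: "'a \<Rightarrow> real" where h: "linear h" "\<forall>x\<in>B. h x = (if x = b then 1 else 0)"
      using linear_independent_extend[OF assms(1), of "\<lambda>x. if x = b then 1 else 0"] by blast
    \<comment> \<open>The adjoint at 1 is the vector representing the coordinate functional through
      the inner product.\<close>
    have "adjoint h 1 \<bullet> x = h x" for x
      using adjoint_works[OF h(1), of x 1] by (simp add: inner_commute)
    then show ?thesis using h(2) by (intro exI[of _ "adjoint h 1"]) simp
  qed
  then obtain d where d: "\<And>b x. x \<in> B \<Longrightarrow> d b \<bullet> x = (if x = b then 1 else 0)" by metis
  have "lattice3 b1 b2 b3 (d b1) (d b2) (d b3)"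
  proof
    fix x
    have "linear (\<lambda>x. (d b1 \<bullet> x) *\<^sub>R b1 + (d b2 \<bullet> x) *\<^sub>R b2 + (d b3 \<bullet> x) *\<^sub>R b3)"
      by (rule linearI) (simp_all add: inner_add_right algebra_simps)
    moreover have "b = (d b1 \<bullet> b) *\<^sub>R b1 + (d b2 \<bullet> b) *\<^sub>R b2 + (d b3 \<bullet> b) *\<^sub>R b3" if "b \<in> B" for b
      using d[OF that] that B by auto
    moreover have "x \<in> span B" using assms(2) by simp
    ultimately show "x = (d b1 \<bullet> x) *\<^sub>R b1 + (d b2 \<bullet> x) *\<^sub>R b2 + (d b3 \<bullet> x) *\<^sub>R b3"
      using linear_eq_on[OF linear_id[unfolded id_def]] by blast
  qed (use d B in auto)
  then show thesis using that B(1) by blast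
qed

text \<open>A lattice point strictly between the origin and the boundary would pair to an integer in
  \<open>(-1, 0)\<close> with one of the lattice points of the dual polytope, which surround the origin.\<close>

lemma almost_reflexive_canonical:
  assumes ar: "almost_reflexive N \<Delta>" and x: "x \<in> \<Delta>" "0 \<le> s" "s < 1" "s *\<^sub>R x \<in> N"
  shows "s *\<^sub>R x = 0"
proof (rule ccontr)
  assume z0: "s *\<^sub>R x \<noteq> 0"
  define z where "z = s *\<^sub>R x"
  have zn: "norm z > 0" using z0 by (simp add: z_def)
  define S where "S = dual_polytope \<Delta> \<inter> dual_lattice N"
  have "0 \<in> interior (convex hull S)" using ar by (simp add: almost_reflexive_def lattice_hull_def S_def)
  then obtain e where e: "e > 0" "cball 0 e \<subseteq> convex hull S" using mem_interior_cball by blast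
  have "\<exists>m\<in>S. m \<bullet> z < 0"
  proof (rule ccontr)
    assume "\<not> ?thesis"
    then have "convex hull S \<subseteq> {m. z \<bullet> m \<ge> 0}"
      by (intro hull_minimal convex_halfspace_ge) (auto simp: not_less inner_commute)
    moreover have "- (e / norm z) *\<^sub>R z \<in> cball 0 e" using e(1) zn by simp
    ultimately have "z \<bullet> (- (e / norm z) *\<^sub>R z) \<ge> 0" using e(2) by blast
    then have "e / norm z * (z \<bullet> z) \<le> 0" by simp
    moreover have "e / norm z * (z \<bullet> z) > 0" using e(1) zn by simp
    ultimately show False by simp
  qed
  then obtain m where m: "m \<in> S" "m \<bullet> z < 0" by blast
  have "m \<bullet> z \<in> \<int>" using m(1) x(4) by (auto simp: S_def dual_lattice_def z_def)
  then obtain i where i: "m \<bullet> z = of_int i" by (auto elim: Ints_cases)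
  then have "m \<bullet> z \<le> - 1" using m(2) by simp
  moreover have "m \<bullet> x \<ge> - 1" using m(1) x(1) by (auto simp: S_def dual_polytope_def)
  then have "s * (m \<bullet> x) \<ge> s * (- 1)" using x(2) by (intro mult_left_mono)
  then have "m \<bullet> z \<ge> - s" by (simp add: z_def)
  ultimately show False using x(3) by simp
qed

lemma (in canonical_polytope) exists_fan:
  obtains r :: "'a \<Rightarrow> real" where "fan_polytope b1 b2 b3 d1 d2 d3 \<Delta> r"
proof (rule exists_weights[OF finite_pts], erule surround_pts, goal_cases)
  case (1 r)
  have "fan_polytope b1 b2 b3 d1 d2 d3 \<Delta> r"
    by (rule fan_polytope.intro[OF canonical_polytope_axioms fan_polytope_axioms.intro]) (fact 1)+
  then show ?case by (rule that)
qed

theorem theorem0p1: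
  fixes N \<Delta> :: "'a::euclidean_space set"
  assumes "DIM('a) = 3"
    and "full_lattice N"
    and "almost_reflexive N \<Delta>"
  shows "24 = normalized_vol N \<Delta>
           - (\<Sum>\<theta> | \<theta> face_of \<Delta> \<and> aff_dim \<theta> = 2.
                1 / real (lattice_distance N \<Delta> \<theta>) * normalized_vol N \<theta>)
           + (\<Sum>\<theta> | \<theta> face_of \<Delta> \<and> aff_dim \<theta> = 1.
                normalized_vol N \<theta> *
                rational_normalized_vol (dual_lattice N) (dual_polytope \<Delta>) (dual_face \<Delta> \<theta>))"
proof -
  obtain B where B: "independent B" "N = int_span B" "span B = UNIV"
    using assms(2) by (auto simp: full_lattice_def lattice_basis_def)
  have "card B = dim (span B)" using B(1) by (simp add: dim_eq_card_independent)
  then have "card B = 3" using B(3) assms(1) by simp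
  then obtain b1 b2 b3 d1 d2 d3 where l3: "lattice3 b1 b2 b3 d1 d2 d3" and Bb: "B = {b1, b2, b3}"
    using exists_biorthogonal[OF B(1,3)] by metis
  interpret lattice3 b1 b2 b3 d1 d2 d3 by fact
  have N: "N = latt" using lattice_basis_latt(1) B(2) Bb by (simp add: lattice_basis_def)
  interpret canonical_polytope b1 b2 b3 d1 d2 d3 \<Delta>
  proof
    show "x \<in> latt" if "x extreme_point_of \<Delta>" for x
      using assms(3) that by (auto simp: almost_reflexive_def lattice_polytope_def N)
    show "s *\<^sub>R x = 0" if "x \<in> \<Delta>" "0 \<le> s" "s < 1" "s *\<^sub>R x \<in> latt" for x s
      using almost_reflexive_canonical[OF assms(3)] that by (simp add: N)
  qed (use assms in \<open>auto simp: almost_reflexive_def lattice_polytope_def\<close>)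
  obtain r where "fan_polytope b1 b2 b3 d1 d2 d3 \<Delta> r" by (rule exists_fan)
  then interpret fan_polytope b1 b2 b3 d1 d2 d3 \<Delta> r .
  show ?thesis unfolding N by (rule twenty_four)
qed

end
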